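(* Let $(X,f)$ be a dynamical system with an expansive $\ell$-Markov partition $\mathscr{H}=\{H_i\}$, $\lambda(H_i)<\infty$ for all $i$, whose transition matrix $P$ defines an irreducible aperiodic Markov chain with $f^*_{ii}=1$ for all states $i$. Let $\pi:\mathscr{L}(X)\to[0,\infty]$ be the absolutely continuous measure with density $\tau$, where $\tau(x)=\frac{\lim_{k\to\infty}p_{ii}^{(k)}}{\lambda(H_i)}$ for all $x\in\operatorname{int}(H_i)$ and all $i$. Let $\mu:\mathscr{L}(X)\to[0,\infty]$ be an absolutely continuous measure with $\mu(X)<\infty$. 1. If $A\in\mathscr{L}(X)$ is such that there exists $N\in\mathbb{N}$ with $\lambda\big(A\setminus\bigcup_{i=1}^N H_i\big)=0$, then $\lim_{n\to\infty}\mu(f^{-n}(A))=\mu(X)\,\pi(A)$. 2. If the Markov chain defined by $P$ is positive recurrent, then for all $A\in\mathscr{L}(X)$ we have $\lim_{n\to\infty}\mu(f^{-n}(A))=\mu(X)\,\pi(A)$.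
   Context: $\lambda$ is Lebesgue measure and $\mathscr{L}(X)$ is the Lebesgue $\sigma$-algebra on $X$; measurable means Lebesgue measurable. A measure $\mu$ on $\mathscr{L}(X)$ is absolutely continuous with density $\gamma:X\to[0,\infty]$ if $\mu(H)=\int_H\gamma\,d\lambda$ for all $H\in\mathscr{L}(X)$ (convention $0\cdot\infty=0$). "Linear" means affine. $\ell$-Markov partition: Let $X\subseteq\mathbb{R}$ be a measurable set which is a countable union of closed intervals with non-empty interiors, and $f:X\to X$ measurable. $(X,f)$ has an $\ell$-Markov partition $\mathscr{H}$ if $\mathscr{H}$ is a countable (finite or countably infinite) set of closed subintervals of $\mathbb{R}$ with non-empty interior such that: (1) $\operatorname{int}(A)\cap\operatorname{int}(B)=\emptyset$ for distinct $A,B\in\mathscr{H}$; (2) $X=\bigcup\mathscr{H}$; (3) for all $A\in\mathscr{H}$ there is $\emptyset\ne\mathscr{A}\subseteq\mathscr{H}$ with $\operatorname{int}(f(A))=\operatorname{int}(\bigcup\mathscr{A})$; (4) $f$ is linear on the interior of each $H\in\mathscr{H}$. The elements of $\mathscr{H}$ are enumerated as $H_i$, with $i$ ranging over $\mathbb{Z}^+$ (or over $\{1,\dots,m\}$ if $\mathscr{H}$ has $m<\infty$ elements). For a finite sequence of indices let $H_{i_0\dots i_n}=\bigcap_{k=0}^n f^{-k}(H_{i_k})$. The partition is expansive if for every $\delta>0$ and every bounded interval $I\subseteq X$ there are finitely many finite index sequences $(i^{(k)}_0,\dots,i^{(k)}_{n_k})$, $1\le k\le N$, with $\lambda\big(I\,\Delta\,\bigcup_{k=1}^N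 H_{i^{(k)}_0\dots i^{(k)}_{n_k}}\big)<\delta$, where $\Delta$ denotes symmetric difference. Transition matrix (defined when all $\lambda(H_i)<\infty$): $P=(p_{ij})$ with $p_{ij}=\frac{\lambda(H_j)}{\lambda(H_i)\,|f'(H_i)|}$ if $\operatorname{int}(H_j)\subseteq f(H_i)$ and $p_{ij}=0$ otherwise, where $f'(H_i)$ is the slope of $f$ on $\operatorname{int}(H_i)$. $P$ is row-stochastic and defines a Markov chain on the index set. $p_{ij}^{(k)}=(P^k)_{ij}$, and $f^*_{ii}$ is the probability that the chain started at $i$ eventually returns to $i$. For an irreducible aperiodic chain the limits $\lim_k p_{ii}^{(k)}$ exist. The chain is positive recurrent if all states have finite mean return time. *)

theory Defs
  imports "HOL-Probability.Probability"
begin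

section \<open>Piecewise affine systems on subsets of the real line\<close>

text \<open>Closed intervals may be unbounded.\<close>

definition nondegenerate_closed_interval :: "real set \<Rightarrow> bool" where
  "nondegenerate_closed_interval I \<longleftrightarrow> is_interval I \<and> closed I \<and> interior I \<noteq> {}"

text \<open>
  The map is a total function on the reals of which only the restriction to \<open>X\<close> matters.
  Measurability is with respect to the Lebesgue sigma-algebra of \<open>X\<close> on both sides (and
  includes \<open>f ` X \<subseteq> X\<close>).
\<close>

definition dynamical_system :: "real set \<Rightarrow> (real \<Rightarrow> real) \<Rightarrow> bool" where
  "dynamical_system X f \<longleftrightarrow>
     X \<in> sets lebesgue \<and>
     (\<exists>\<C>. countable \<C> \<and> (\<forall>I\<in>\<C>. nondegenerate_closed_interval I) \<and> X = \<Union>\<C>) \<and>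
     f \<in> lebesgue_on X \<rightarrow>\<^sub>M lebesgue_on X"

definition affine_on :: "(real \<Rightarrow> real) \<Rightarrow> real set \<Rightarrow> bool" where
  "affine_on f S \<longleftrightarrow> (\<exists>a b. \<forall>x\<in>S. f x = a * x + b)"

definition markov_partition :: "real set \<Rightarrow> (real \<Rightarrow> real) \<Rightarrow> real set set \<Rightarrow> bool" where
  "markov_partition X f \<H> \<longleftrightarrow>
     countable \<H> \<and>
     (\<forall>A\<in>\<H>. nondegenerate_closed_interval A) \<and>
     (\<forall>A\<in>\<H>. \<forall>B\<in>\<H>. A \<noteq> B \<longrightarrow> interior A \<inter> interior B = {}) \<and>
     X = \<Union>\<H> \<and>
     (\<forall>A\<in>\<H>. \<exists>\<A>. \<A> \<noteq> {} \<and> \<A> \<subseteq> \<H> \<and> interior (f ` A) = interior (\<Union>\<A>)) \<and>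
     (\<forall>A\<in>\<H>. affine_on f (interior A))"

text \<open>Enumerations are indexed from 1: by all positive integers, or by \<open>1, \<dots>, m\<close>.\<close>

definition enumerates :: "nat set \<Rightarrow> (nat \<Rightarrow> 'a) \<Rightarrow> 'a set \<Rightarrow> bool" where
  "enumerates J H \<H> \<longleftrightarrow> (J = {1..} \<or> (\<exists>m. J = {1..m})) \<and> bij_betw H J \<H>"

definition preimage_iter :: "real set \<Rightarrow> (real \<Rightarrow> real) \<Rightarrow> nat \<Rightarrow> real set \<Rightarrow> real set" where
  "preimage_iter X f n A = (f ^^ n) -` A \<inter> X"

text \<open>The list \<open>[i\<^sub>0, \<dots>, i\<^sub>n]\<close> stands for the set \<open>H\<close> with index sequence \<open>i\<^sub>0 \<dots> i\<^sub>n\<close>;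
  only nonempty lists are used.\<close>

definition cylinder ::
    "real set \<Rightarrow> (real \<Rightarrow> real) \<Rightarrow> (nat \<Rightarrow> real set) \<Rightarrow> nat list \<Rightarrow> real set" where
  "cylinder X f H w = (\<Inter>k<length w. preimage_iter X f k (H (w ! k)))"

definition expansive ::
    "real set \<Rightarrow> (real \<Rightarrow> real) \<Rightarrow> nat set \<Rightarrow> (nat \<Rightarrow> real set) \<Rightarrow> bool" where
  "expansive X f J H \<longleftrightarrow>
     (\<forall>\<delta>>0. \<forall>I. is_interval I \<and> bounded I \<and> I \<subseteq> X \<longrightarrow>
        (\<exists>W. finite W \<and> (\<forall>w\<in>W. w \<noteq> [] \<and> set w \<subseteq> J) \<and>
             emeasure lebesgue (sym_diff I (\<Union>w\<in>W. cylinder X f H w)) < ennreal \<delta>))"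

text \<open>The slope is unique when \<open>A\<close> has nonempty interior and \<open>f\<close> is affine there.\<close>

definition slope :: "(real \<Rightarrow> real) \<Rightarrow> real set \<Rightarrow> real" where
  "slope f A = (THE a. \<exists>b. \<forall>x\<in>interior A. f x = a * x + b)"

definition transition_matrix :: "(real \<Rightarrow> real) \<Rightarrow> (nat \<Rightarrow> real set) \<Rightarrow> nat \<Rightarrow> nat \<Rightarrow> real" where
  "transition_matrix f H i j =
     (if interior (H j) \<subseteq> f ` H i
      then measure lebesgue (H j) / (measure lebesgue (H i) * \<bar>slope f (H i)\<bar>)
      else 0)"

text \<open>Measures on the Lebesgue sigma-algebra of \<open>X\<close> given by a density. In \<^typ>\<open>ennreal\<close>,
  \<open>0 * \<infinity> = 0\<close>. Unlike \<^const>\<open>absolutely_continuous\<close>, absolute continuity is here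
  the existence of a density.\<close>

definition has_density :: "real set \<Rightarrow> real measure \<Rightarrow> (real \<Rightarrow> ennreal) \<Rightarrow> bool" where
  "has_density X \<mu> \<gamma> \<longleftrightarrow>
     sets \<mu> = sets (lebesgue_on X) \<and>
     \<gamma> \<in> borel_measurable (lebesgue_on X) \<and>
     (\<forall>A\<in>sets (lebesgue_on X). emeasure \<mu> A = (\<integral>\<^sup>+x\<in>A. \<gamma> x \<partial>lebesgue_on X))"

definition has_some_density :: "real set \<Rightarrow> real measure \<Rightarrow> bool" where
  "has_some_density X \<mu> \<longleftrightarrow> (\<exists>\<gamma>. has_density X \<mu> \<gamma>)"

section \<open>Countable Markov chains\<close>

text \<open>A matrix on the index set \<open>J\<close> is a function of which only the values on \<open>J \<times> J\<close> matter.\<close>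

definition row_stochastic :: "nat set \<Rightarrow> (nat \<Rightarrow> nat \<Rightarrow> real) \<Rightarrow> bool" where
  "row_stochastic J P \<longleftrightarrow> (\<forall>i\<in>J. (\<forall>j\<in>J. 0 \<le> P i j) \<and> (P i has_sum 1) J)"

primrec matrix_power ::
    "nat set \<Rightarrow> (nat \<Rightarrow> nat \<Rightarrow> real) \<Rightarrow> nat \<Rightarrow> nat \<Rightarrow> nat \<Rightarrow> real" where
  "matrix_power J P 0 i j = of_bool (i = j)"
| "matrix_power J P (Suc n) i j = (\<Sum>\<^sub>\<infinity>l\<in>J. P i l * matrix_power J P n l j)"

definition irreducible_chain :: "nat set \<Rightarrow> (nat \<Rightarrow> nat \<Rightarrow> real) \<Rightarrow> bool" where
  "irreducible_chain J P \<longleftrightarrow> (\<forall>i\<in>J. \<forall>j\<in>J. \<exists>n. matrix_power J P n i j > 0)"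

definition aperiodic_chain :: "nat set \<Rightarrow> (nat \<Rightarrow> nat \<Rightarrow> real) \<Rightarrow> bool" where
  "aperiodic_chain J P \<longleftrightarrow> (\<forall>i\<in>J. Gcd {n. n \<ge> 1 \<and> matrix_power J P n i i > 0} = 1)"

definition path_space :: "nat set \<Rightarrow> (nat \<Rightarrow> nat) measure" where
  "path_space J = (\<Pi>\<^sub>M n\<in>UNIV. count_space J)"

text \<open>\<open>is_chain_law J P i M\<close>: under \<open>M\<close> the coordinates form a Markov chain with transition
  matrix \<open>P\<close> started at \<open>i\<close>.\<close>

definition is_chain_law ::
    "nat set \<Rightarrow> (nat \<Rightarrow> nat \<Rightarrow> real) \<Rightarrow> nat \<Rightarrow> (nat \<Rightarrow> nat) measure \<Rightarrow> bool" where
  "is_chain_law J P i M \<longleftrightarrow>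
     prob_space M \<and> sets M = sets (path_space J) \<and>
     (\<forall>s n. (\<forall>k. s k \<in> J) \<longrightarrow>
        measure M {\<omega> \<in> space M. \<forall>k\<le>n. \<omega> k = s k} =
        (if s 0 = i then \<Prod>k<n. P (s k) (s (Suc k)) else 0))"

text \<open>The description is legitimate for stochastic matrices, by \<open>ex1_chain_law\<close> below.\<close>

definition chain_law ::
    "nat set \<Rightarrow> (nat \<Rightarrow> nat \<Rightarrow> real) \<Rightarrow> nat \<Rightarrow> (nat \<Rightarrow> nat) measure" where
  "chain_law J P i = (THE M. is_chain_law J P i M)"

definition return_prob :: "nat set \<Rightarrow> (nat \<Rightarrow> nat \<Rightarrow> real) \<Rightarrow> nat \<Rightarrow> real" where
  "return_prob J P i =
     measure (chain_law J P i) {\<omega> \<in> space (chain_law J P i). \<exists>n\<ge>1. \<omega> n = i}"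

text \<open>The infimum of the empty set, i.e. the time of a return that never happens, is \<open>\<infinity>\<close>.\<close>

definition return_time :: "nat \<Rightarrow> (nat \<Rightarrow> nat) \<Rightarrow> ennreal" where
  "return_time i \<omega> = (INF n\<in>{n. n \<ge> 1 \<and> \<omega> n = i}. of_nat n)"

definition mean_return_time :: "nat set \<Rightarrow> (nat \<Rightarrow> nat \<Rightarrow> real) \<Rightarrow> nat \<Rightarrow> ennreal" where
  "mean_return_time J P i = (\<integral>\<^sup>+\<omega>. return_time i \<omega> \<partial>chain_law J P i)"

definition positive_recurrent_chain :: "nat set \<Rightarrow> (nat \<Rightarrow> nat \<Rightarrow> real) \<Rightarrow> bool" where
  "positive_recurrent_chain J P \<longleftrightarrow> (\<forall>i\<in>J. mean_return_time J P i < \<infinity>)"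

subsection \<open>Existence and uniqueness of the chain law\<close>

definition chain_kernel ::
    "nat set \<Rightarrow> (nat \<Rightarrow> nat \<Rightarrow> real) \<Rightarrow> nat \<Rightarrow> nat \<Rightarrow> (nat \<Rightarrow> nat) \<Rightarrow> nat measure" where
  "chain_kernel J P i n \<omega> =
     (case n of 0 \<Rightarrow> return (count_space J) i
      | Suc m \<Rightarrow> density (count_space J) (\<lambda>j. ennreal (P (\<omega> m) j)))"

lemma chain_step_prob_space:
  assumes "row_stochastic J P" "i \<in> J"
  shows "prob_space (density (count_space J) (\<lambda>j. ennreal (P i j)))"
proof
  have nonneg: "P i j \<ge> 0" if "j \<in> J" for j
    using assms that by (auto simp: row_stochastic_def)
  have hs: "(P i has_sum 1) J"
    using assms by (auto simp: row_stochastic_def)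
  have abs: "Infinite_Set_Sum.abs_summable_on (P i) J"
    using has_sum_imp_summable[OF hs] summable_on_iff_abs_summable_on_real abs_summable_equivalent
    by blast
  have "(\<integral>\<^sup>+j. ennreal (P i j) \<partial>count_space J) = ennreal (infsetsum (P i) J)"
    by (rule nn_integral_conv_infsetsum[OF abs nonneg])
  also have "\<dots> = 1"
    using infsetsum_infsum[OF abs] infsumI[OF hs] by simp
  finally show "emeasure (density (count_space J) (\<lambda>j. ennreal (P i j)))
      (space (density (count_space J) (\<lambda>j. ennreal (P i j)))) = 1"
    by (simp add: emeasure_density nn_integral_count_space_indicator[symmetric]
          cong: nn_integral_cong_simp)
qed

lemma chain_kernel_Ionescu_Tulcea:
  assumes P: "row_stochastic J P" and i: "i \<in> J"
  shows "Ionescu_Tulcea (chain_kernel J P i) (\<lambda>_. count_space J)"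
proof (rule Ionescu_Tulcea.intro)
  fix n
  show "prob_space (chain_kernel J P i n x)" if "x \<in> space (PiM {0..<n} (\<lambda>_. count_space J))" for x
    using that i
    by (cases n)
       (auto simp: chain_kernel_def space_PiM PiE_iff intro!: prob_space_return chain_step_prob_space[OF P])
  show "chain_kernel J P i n \<in> PiM {0..<n} (\<lambda>_. count_space J) \<rightarrow>\<^sub>M subprob_algebra (count_space J)"
  proof (cases n)
    case 0
    have "return (count_space J) i \<in> space (subprob_algebra (count_space J))"
      using i by (auto simp: space_subprob_algebra intro!: prob_space_imp_subprob_space prob_space_return)
    then show ?thesis
      using 0 by (simp add: chain_kernel_def[abs_def])
  next
    case (Suc m)
    have "(\<lambda>l. density (count_space J) (\<lambda>j. ennreal (P l j)))
        \<in> count_space J \<rightarrow>\<^sub>M subprob_algebra (count_space J)"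
      by (auto simp: space_subprob_algebra intro!: prob_space_imp_subprob_space chain_step_prob_space[OF P])
    moreover have "(\<lambda>x. x m) \<in> PiM {0..<n} (\<lambda>_. count_space J) \<rightarrow>\<^sub>M count_space J"
      using Suc by (intro measurable_component_singleton) auto
    ultimately have "(\<lambda>x. density (count_space J) (\<lambda>j. ennreal (P (x m) j)))
        \<in> PiM {0..<n} (\<lambda>_. count_space J) \<rightarrow>\<^sub>M subprob_algebra (count_space J)"
      by (rule measurable_compose[rotated])
    then show ?thesis
      using Suc by (simp add: chain_kernel_def[abs_def])
  qed
qed

lemma ex_chain_law:
  assumes P: "row_stochastic J P" and i: "i \<in> J"
  shows "\<exists>M. is_chain_law J P i M"
proof -
  let ?M = "\<lambda>_::nat. count_space J"
  interpret IT: Ionescu_Tulcea "chain_kernel J P i" ?M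
    by (rule chain_kernel_Ionescu_Tulcea[OF P i])
  have cyl_sets [measurable]: "{\<omega> \<in> space (PiM {0..<m} ?M). \<forall>k<m. \<omega> k = s k} \<in> sets (PiM {0..<m} ?M)"
    if "\<And>k. s k \<in> J" for s m
  proof -
    have "{\<omega> \<in> space (PiM {0..<m} ?M). \<forall>k<m. \<omega> k = s k} = (\<Pi>\<^sub>E k\<in>{0..<m}. {s k})"
      using that by (auto simp: space_PiM PiE_iff extensional_def)
    also have "\<dots> \<in> sets (PiM {0..<m} ?M)"
      using that by (intro sets_PiM_I_finite) auto
    finally show ?thesis .
  qed
  have u: "(\<lambda>_. undefined) \<in> space (PiM {0..<0} ?M)"
    by (simp add: space_PiM)
  have C: "emeasure (IT.C 0 m (\<lambda>_. undefined)) {\<omega> \<in> space (PiM {0..<m} ?M). \<forall>k<m. \<omega> k = s k}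
      = (\<Prod>k<m. emeasure (chain_kernel J P i k s) {s k})" if s: "\<And>k. s k \<in> J" for s m
  proof (induction m)
    case 0
    show ?case by (simp add: space_PiM sets_PiM_empty)
  next
    case (Suc m)
    let ?A = "\<lambda>m. {\<omega> \<in> space (PiM {0..<m} ?M). \<forall>k<m. \<omega> k = s k}"
    have "emeasure (IT.C 0 (Suc m) (\<lambda>_. undefined)) (?A (Suc m))
        = (\<integral>\<^sup>+x. emeasure (IT.eP m x) (?A (Suc m)) \<partial>IT.C 0 m (\<lambda>_. undefined))"
      unfolding IT.C.simps add_0
    proof (rule emeasure_bind[where N="PiM {0..<Suc m} ?M"])
      show "space (IT.C 0 m (\<lambda>_. undefined)) \<noteq> {}"
        by (rule prob_space.not_empty[OF IT.prob_space_C[OF u]])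
      show "IT.eP m \<in> IT.C 0 m (\<lambda>_. undefined) \<rightarrow>\<^sub>M subprob_algebra (PiM {0..<Suc m} ?M)"
        unfolding measurable_cong_sets[OF IT.sets_C[OF u, of m] refl] add_0 by (rule IT.measurable_eP)
    qed (rule cyl_sets[OF s])
    also have "\<dots> = (\<integral>\<^sup>+x. emeasure (chain_kernel J P i m s) {s m} * indicator (?A m) x
        \<partial>IT.C 0 m (\<lambda>_. undefined))"
    proof (rule nn_integral_cong)
      fix x assume "x \<in> space (IT.C 0 m (\<lambda>_. undefined))"
      then have x: "x \<in> space (PiM {0..<m} ?M)"
        using IT.space_C[OF u, of m] by simp
      have "emeasure (IT.eP m x) (?A (Suc m))
          = emeasure (chain_kernel J P i m x) ((\<lambda>y. x(m := y)) -` ?A (Suc m) \<inter> J)"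
        using IT.emeasure_eP[OF x cyl_sets[OF s]] by simp
      also have "(\<lambda>y. x(m := y)) -` ?A (Suc m) \<inter> J = (if x \<in> ?A m then {s m} else {})"
        using x s by (auto simp: space_PiM PiE_iff extensional_def less_Suc_eq split: if_splits)
      also have "emeasure (chain_kernel J P i m x) \<dots>
          = emeasure (chain_kernel J P i m s) {s m} * indicator (?A m) x"
        by (auto simp: chain_kernel_def split: nat.splits)
      finally show "emeasure (IT.eP m x) (?A (Suc m))
          = emeasure (chain_kernel J P i m s) {s m} * indicator (?A m) x" .
    qed
    also have "\<dots> = emeasure (chain_kernel J P i m s) {s m} * emeasure (IT.C 0 m (\<lambda>_. undefined)) (?A m)"
      using cyl_sets[OF s, of m] IT.sets_C[OF u, of m] by (intro nn_integral_cmult_indicator) simp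
    finally show ?case
      by (simp add: Suc.IH mult.commute)
  qed
  interpret L: prob_space IT.PF.lim
    using IT.distr_lim[of "{}"] IT.PF.prob_space_P[of "{}"]
    by (intro prob_space_distrD[of "\<lambda>x. restrict x {}" IT.PF.lim "PiM {} ?M"])
       (auto intro!: measurable_restrict simp: measurable_cong_sets[OF IT.PF.sets_lim refl])
  have "is_chain_law J P i IT.PF.lim"
    unfolding is_chain_law_def
  proof (intro conjI allI impI)
    fix s :: "nat \<Rightarrow> nat" and n :: nat assume "\<forall>k. s k \<in> J"
    then have s: "s k \<in> J" for k by blast
    let ?A = "{\<omega> \<in> space (PiM {0..<Suc n} ?M). \<forall>k<Suc n. \<omega> k = s k}"
    have "{\<omega> \<in> space IT.PF.lim. \<forall>k\<le>n. \<omega> k = s k} = IT.PF.emb UNIV {0..<Suc n} ?A"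
      by (auto simp: prod_emb_def space_PiM PiE_iff less_Suc_eq_le)
    then have "emeasure IT.PF.lim {\<omega> \<in> space IT.PF.lim. \<forall>k\<le>n. \<omega> k = s k}
        = emeasure (IT.CI {0..<Suc n}) ?A"
      using IT.lim[OF _ cyl_sets[OF s]] by simp
    also have "\<dots> = emeasure (IT.C 0 (Suc n) (\<lambda>_. undefined)) (IT.PF.emb {0..<Suc n} {0..<Suc n} ?A)"
      by (rule IT.emeasure_CI[OF order_refl cyl_sets[OF s]])
    also have "IT.PF.emb {0..<Suc n} {0..<Suc n} ?A = ?A"
      by (rule prod_emb_id) (auto simp: space_PiM)
    also have "emeasure (IT.C 0 (Suc n) (\<lambda>_. undefined)) ?A
        = (\<Prod>k<Suc n. emeasure (chain_kernel J P i k s) {s k})"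
      by (rule C[OF s])
    also have "\<dots> = emeasure (chain_kernel J P i 0 s) {s 0}
        * (\<Prod>k<n. emeasure (chain_kernel J P i (Suc k) s) {s (Suc k)})"
      by (rule prod.lessThan_Suc_shift)
    also have "emeasure (chain_kernel J P i 0 s) {s 0} = of_bool (s 0 = i)"
      using s by (simp add: chain_kernel_def indicator_def)
    also have "(\<Prod>k<n. emeasure (chain_kernel J P i (Suc k) s) {s (Suc k)})
        = (\<Prod>k<n. ennreal (P (s k) (s (Suc k))))"
    proof (rule prod.cong[OF refl])
      fix k
      show "emeasure (chain_kernel J P i (Suc k) s) {s (Suc k)} = ennreal (P (s k) (s (Suc k)))"
        using s[of "Suc k"]
        by (simp add: chain_kernel_def emeasure_density nn_integral_cmult_indicator
              nn_integral_count_space_indicator[symmetric]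
              nn_integral_indicator_singleton)
    qed
    also have "\<dots> = ennreal (\<Prod>k<n. P (s k) (s (Suc k)))"
      using P s by (intro prod_ennreal) (auto simp: row_stochastic_def)
    finally have *: "emeasure IT.PF.lim {\<omega> \<in> space IT.PF.lim. \<forall>k\<le>n. \<omega> k = s k}
        = of_bool (s 0 = i) * ennreal (\<Prod>k<n. P (s k) (s (Suc k)))" .
    have "0 \<le> (\<Prod>k<n. P (s k) (s (Suc k)))"
      using P s by (intro prod_nonneg) (auto simp: row_stochastic_def)
    then show "measure IT.PF.lim {\<omega> \<in> space IT.PF.lim. \<forall>k\<le>n. \<omega> k = s k}
        = (if s 0 = i then \<Prod>k<n. P (s k) (s (Suc k)) else 0)"
      unfolding measure_def * by simp
  qed (auto simp: path_space_def L.prob_space_axioms)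
  then show ?thesis ..
qed

lemma chain_law_unique:
  assumes M: "is_chain_law J P i M" and M': "is_chain_law J P i M'" and i: "i \<in> J"
  shows "M = M'"
proof -
  let ?M = "\<lambda>_::nat. count_space J"
  interpret M: prob_space M using M by (simp add: is_chain_law_def)
  interpret M': prob_space M' using M' by (simp add: is_chain_law_def)
  have sets: "sets M = sets (PiM UNIV ?M)" "sets M' = sets (PiM UNIV ?M)"
    using M M' by (auto simp: is_chain_law_def path_space_def)
  then have space: "space M = space (PiM UNIV ?M)" "space M' = space (PiM UNIV ?M)"
    by (auto dest: sets_eq_imp_space_eq)
  have [measurable]: "(\<lambda>\<omega>. \<omega> k) \<in> PiM UNIV ?M \<rightarrow>\<^sub>M count_space J" for k
    by (rule measurable_component_singleton) simp
  let ?cyl = "\<lambda>s n. {\<omega> \<in> space (PiM UNIV ?M). \<forall>k\<le>n. \<omega> k = s k}"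
  have cyl_sets: "?cyl s n \<in> sets (PiM UNIV ?M)" if "\<And>k. s k \<in> J" for s n
  proof -
    have "{\<omega> \<in> space (PiM UNIV ?M). \<omega> k = s k} \<in> sets (PiM UNIV ?M)" for k
    proof -
      have "{\<omega> \<in> space (PiM UNIV ?M). \<omega> k = s k} = (\<lambda>\<omega>. \<omega> k) -` {s k} \<inter> space (PiM UNIV ?M)"
        by auto
      also have "\<dots> \<in> sets (PiM UNIV ?M)"
        by (rule measurable_sets[of _ _ "count_space J"]) (use that in auto)
      finally show ?thesis .
    qed
    then show ?thesis
      by (intro sets.sets_Collect_countable_All sets.sets_Collect_imp) (auto simp: sets.sets_Collect_const)
  qed
  have cyl_eq: "emeasure M (?cyl s n) = emeasure M' (?cyl s n)" if "\<And>k. s k \<in> J" for s n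
    using M M' that unfolding M.emeasure_eq_measure M'.emeasure_eq_measure is_chain_law_def
    by (simp add: space)
  show ?thesis
  proof (rule measure_eqI_PiM_infinite[OF sets])
    show "finite_measure M" by unfold_locales
    fix A :: "nat \<Rightarrow> nat set" and K :: "nat set"
    assume K: "finite K" and A: "\<And>k. k \<in> K \<Longrightarrow> A k \<in> sets (count_space J)"
    obtain n where n: "K \<subseteq> {..n}"
      using K finite_nat_iff_bounded_le by blast
    define B where "B = {b \<in> {..n} \<rightarrow>\<^sub>E J. \<forall>k\<in>K. b k \<in> A k}"
    define ext where "ext b k = (if k \<le> n then b k else i)" for b :: "nat \<Rightarrow> nat" and k
    have ext: "ext b k \<in> J" if "b \<in> B" for b k
      using that i by (auto simp: B_def ext_def)
    have "countable ({..n} \<rightarrow>\<^sub>E J)"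
      by (rule countable_PiE) auto
    then have count: "countable B"
      by (rule countable_subset[rotated]) (auto simp: B_def)
    have disj: "disjoint_family_on (\<lambda>b. ?cyl (ext b) n) B"
    proof -
      have "b = b'" if "b \<in> B" "b' \<in> B" and *: "\<forall>k\<le>n. \<omega> k = ext b k" "\<forall>k\<le>n. \<omega> k = ext b' k" for b b' \<omega>
      proof (rule PiE_ext)
        show "b \<in> {..n} \<rightarrow>\<^sub>E J" "b' \<in> {..n} \<rightarrow>\<^sub>E J" using that by (auto simp: B_def)
        show "b k = b' k" if "k \<in> {..n}" for k
          using * that unfolding ext_def by fastforce
      qed
      then show ?thesis
        by (auto simp: disjoint_family_on_def)
    qed
    have un: "prod_emb UNIV ?M K (Pi\<^sub>E K A) = (\<Union>b\<in>B. ?cyl (ext b) n)" (is "?L = ?R")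
    proof (intro set_eqI iffI)
      fix \<omega> assume w: "\<omega> \<in> ?L"
      have "restrict \<omega> {..n} \<in> B"
        using w n by (auto simp: B_def prod_emb_def PiE_iff space_PiM)
      moreover have "\<omega> \<in> ?cyl (ext (restrict \<omega> {..n})) n"
        using w by (auto simp: ext_def prod_emb_def PiE_iff space_PiM)
      ultimately show "\<omega> \<in> ?R" by blast
    next
      fix \<omega> assume "\<omega> \<in> ?R"
      then obtain b where b: "b \<in> B" "\<omega> \<in> space (PiM UNIV ?M)" "\<forall>k\<le>n. \<omega> k = ext b k"
        by blast
      have "\<omega> k \<in> A k" if "k \<in> K" for k
      proof -
        have "k \<le> n" using n that by auto
        then have "\<omega> k = b k" using b(3) by (simp add: ext_def)
        then show ?thesis using b(1) that by (simp add: B_def)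
      qed
      then show "\<omega> \<in> ?L"
        using b(2) by (auto simp: prod_emb_def space_PiM)
    qed
    have "emeasure M ?L = (\<integral>\<^sup>+b. emeasure M (?cyl (ext b) n) \<partial>count_space B)"
      unfolding un
      by (rule emeasure_UN_countable[OF _ count disj]) (use cyl_sets ext sets in blast)
    also have "\<dots> = (\<integral>\<^sup>+b. emeasure M' (?cyl (ext b) n) \<partial>count_space B)"
      by (intro nn_integral_cong cyl_eq ext) simp
    also have "\<dots> = emeasure M' ?L"
      unfolding un
      by (rule emeasure_UN_countable[OF _ count disj, symmetric]) (use cyl_sets ext sets in blast)
    finally show "emeasure M ?L = emeasure M' ?L" .
  qed
qed

lemma ex1_chain_law:
  assumes "row_stochastic J P" and "i \<in> J"
  shows "\<exists>!M. is_chain_law J P i M"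
  using ex_chain_law[OF assms] chain_law_unique[OF _ _ assms(2)] by blast

end

theory Submission
  imports Defs
begin

text \<open>
  For $A$ fixed, let $u_i(A)$ be the share of $H_i$ covered by $A$. Since $f$ is affine on $H_i$, it
  carries the uniform distribution on $H_i$ to the mixture of the uniform distributions on the $H_j$
  with weights $p_{ij}$, so $u_i(f^{-n}(A)) = \sum_j p^{(n)}_{ij} u_j(A)$. The ergodic theorem for
  the chain turns this into $u_i(f^{-n}(A)) \to \pi(A)$: only finitely many $j$ contribute in part 1,
  and in part 2 the limits form a probability distribution, so that Fatou's lemma for $u_j(A)$ and
  $1 - u_j(A)$ suffices. Conditioning on the first step extends the convergence from the $H_i$ to all
  cylinders, expansiveness to bounded intervals, and a Dynkin argument to all densities.

  The limits of $p^{(n)}_{ij}$ come from the Erdos-Feller-Pollard renewal theorem. If $u$ is a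
  renewal sequence, one passes to a limit of its shifts along a subsequence realising the limsup;
  the renewal equation for the shift limit and the maximum principle make it eventually constant.
\<close>

text \<open>A constant limit of shifts has a determined value because every renewal sequence
  satisfies \<open>(\<Sum>k\<le>n. r k * u (n - k)) = 1\<close>, where \<open>r k\<close> is the
  probability that a return takes longer than \<open>k\<close>. If \<open>r\<close> is summable,
  this forces the limsup to be \<open>1 / suminf r\<close>, and the same argument for
  \<open>- u\<close> gives the same liminf. Off the diagonal the limit is inherited through
  convolution with the first passage distribution.

  For the interval map the obstacle is the endpoints: partition elements may share them, and
  \<open>f\<close> is arbitrary there. Identities therefore hold modulo null sets only, and that
  preimages of null sets are null has to be derived from the formula for the shares. Since the limit
  \<open>c\<close> of the shares is the same for every starting interval, the target is that the
  measure of \<open>E \<inter> B n\<close>, with \<open>B n\<close> the preimage of \<open>A\<close>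
  under \<open>f ^^ n\<close>, tends to \<open>c\<close> times the measure of \<open>E\<close>. This
  property of \<open>E\<close> survives approximation, differences and almost disjoint unions of
  finite measure.\<close>

section \<open>Renewal sequences\<close>

text \<open>The least positive difference \<open>d\<close> of two elements divides every element,
  because a nonzero remainder modulo \<open>d\<close> would be a smaller difference. As the gcd is
  1, the set contains consecutive numbers \<open>b\<close> and \<open>b + 1\<close>, and their
  combinations reach every \<open>n \<ge> b * b\<close>.\<close>

lemma additive_set_cofinal:
  fixes S :: "nat set"
  assumes zero: "0 \<in> S" and add: "\<And>a b. a \<in> S \<Longrightarrow> b \<in> S \<Longrightarrow> a + b \<in> S" and gcd: "Gcd S = 1"
  shows "\<exists>N. \<forall>n\<ge>N. n \<in> S"
proof -
  have mult: "k * a \<in> S" if "a \<in> S" for k a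
    using that by (induction k) (auto intro: zero add)
  let ?D = "\<lambda>d. d > 0 \<and> (\<exists>a\<in>S. \<exists>b\<in>S. a = b + d)"
  have "\<exists>s\<in>S. s \<noteq> 0"
    using gcd by (metis Gcd_0_iff subsetI zero_neq_one insertI1)
  then obtain s where "s \<in> S" "s > 0" by auto
  then have "?D s" using zero by auto
  then have D: "?D (LEAST d. ?D d)" by (rule LeastI)
  define d where "d = (LEAST d. ?D d)"
  obtain a b where ab: "a \<in> S" "b \<in> S" "a = b + d" and d: "d > 0"
    using D unfolding d_def by blast
  have "d dvd s" if s: "s \<in> S" for s
  proof (rule ccontr)
    assume "\<not> d dvd s"
    then have t: "s mod d > 0" by (simp add: mod_greater_zero_iff_not_dvd)
    \<comment> \<open>This exhibits \<open>s mod d\<close> as a difference of two elements of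
      \<open>S\<close>.\<close>
    have "s + (s div d) * b = (s div d) * a + s mod d"
      using ab(3) by (simp add: algebra_simps)
    then have "?D (s mod d)"
      using t add[OF s mult[OF ab(2)]] mult[OF ab(1)] by metis
    then have "d \<le> s mod d" unfolding d_def by (rule Least_le)
    then show False using d mod_less_divisor[of d s] by linarith
  qed
  then have "d dvd Gcd S" by (rule Gcd_greatest)
  then have a: "a = b + 1" using gcd ab by simp
  have "n \<in> S" if n: "n \<ge> b * b" for n
  proof (cases "b = 0")
    case True
    then show ?thesis using mult[OF ab(1), of n] a by simp
  next
    case False
    \<comment> \<open>From \<open>n \<ge> b * b\<close> follows \<open>t < b \<le> q\<close>, so
      \<open>t\<close> of the \<open>q\<close> copies of \<open>b\<close> can be exchanged for
      \<open>b + 1\<close>, which absorbs the remainder.\<close>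
    define q t where "q = n div b" and "t = n mod b"
    have "t < b" using False by (simp add: t_def)
    moreover have "b \<le> q" using n False by (simp add: q_def less_eq_div_iff_mult_less_eq)
    ultimately obtain c where c: "q = t + c" by (metis le_add_diff_inverse less_imp_le order_trans)
    have "n = q * b + t" by (simp add: q_def t_def)
    then have "n = c * b + t * a"
      using a c by (simp add: algebra_simps)
    then show ?thesis using add[OF mult[OF ab(2)] mult[OF ab(1)]] by metis
  qed
  then show ?thesis by blast
qed

section \<open>Dominated convergence of series, convolutions and limits of shifts\<close>

lemma tendsto_suminf_dominated:
  fixes a :: "nat \<Rightarrow> nat \<Rightarrow> real"
  assumes "\<And>k. (\<lambda>n. a n k) \<longlonglongrightarrow> b k" "\<And>n k. \<bar>a n k\<bar> \<le> g k" "summable g"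
  shows "summable b" "(\<lambda>n. \<Sum>k. a n k) \<longlonglongrightarrow> (\<Sum>k. b k)"
proof -
  have b: "\<bar>b k\<bar> \<le> g k" for k
    by (rule LIMSEQ_le_const2[OF tendsto_rabs[OF assms(1)]]) (use assms(2) in auto)
  have g: "integrable (count_space UNIV) g"
    using assms(3) order_trans[OF abs_ge_zero assms(2)] by (simp add: integrable_count_space_nat_iff)
  have ia: "integrable (count_space UNIV) (a n)" for n
    by (rule Bochner_Integration.integrable_bound[OF g]) (use assms(2) in \<open>auto intro: order_trans[OF _ abs_ge_self]\<close>)
  have ib: "integrable (count_space UNIV) b"
    by (rule Bochner_Integration.integrable_bound[OF g]) (use b in \<open>auto intro: order_trans[OF _ abs_ge_self]\<close>)
  show "summable b" using ib by (simp add: integrable_count_space_nat_iff summable_rabs_cancel)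
  have "(\<lambda>n. integral\<^sup>L (count_space UNIV) (a n)) \<longlonglongrightarrow> integral\<^sup>L (count_space UNIV) b"
    by (rule integral_dominated_convergence[OF _ _ g]) (use assms in auto)
  then show "(\<lambda>n. \<Sum>k. a n k) \<longlonglongrightarrow> (\<Sum>k. b k)"
    using ia ib by (simp add: integral_count_space_nat)
qed

lemma suminf_truncated: "(\<Sum>k. if k \<le> n then a k else 0) = (\<Sum>k\<le>n. a k :: real)"
  by (subst suminf_finite[of "{..n}"]) auto

text \<open>Extended by zero beyond \<open>n\<close>, the convolution is a series dominated by
  \<open>f k * B\<close>, so the limit may be taken termwise.\<close>

lemma convolution_tendsto:
  fixes f u :: "nat \<Rightarrow> real"
  assumes f: "\<And>k. 0 \<le> f k" "summable f" and u: "u \<longlonglongrightarrow> L" "\<And>n. \<bar>u n\<bar> \<le> B"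
  shows "(\<lambda>n. \<Sum>k\<le>n. f k * u (n - k)) \<longlonglongrightarrow> suminf f * L"
proof -
  let ?a = "\<lambda>n k. if k \<le> n then f k * u (n - k) else 0"
  have "(\<lambda>n. \<Sum>k. ?a n k) \<longlonglongrightarrow> (\<Sum>k. f k * L)"
  proof (rule tendsto_suminf_dominated)
    fix k
    have "(\<lambda>n. f k * u (n - k)) \<longlonglongrightarrow> f k * L"
      by (intro tendsto_mult tendsto_const filterlim_compose[OF u(1)] filterlim_minus_const_nat_at_top)
    then show "(\<lambda>n. ?a n k) \<longlonglongrightarrow> f k * L"
      by (rule Lim_transform_eventually) (use eventually_ge_at_top[of k] in eventually_elim, simp)
  next
    fix n k
    have "0 \<le> B" using u(2)[of 0] by linarith
    then show "\<bar>?a n k\<bar> \<le> f k * B"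
      using f(1)[of k] u(2)[of "n - k"] by (auto simp: abs_mult intro: mult_left_mono)
  qed (use f(2) in \<open>rule summable_mult2\<close>)
  then show ?thesis
    by (simp add: suminf_truncated suminf_mult2[OF f(2), symmetric] cong: if_cong)
qed

text \<open>The sequences \<open>\<lambda>d. v (s n - d)\<close> lie in a product of compact
  intervals, which is compact by Tychonoff, and convergence in the product is convergence for each
  \<open>d\<close>. For fixed \<open>d\<close> and large \<open>n\<close> the subtraction is not
  truncated, so these are genuine shifts.\<close>

lemma bounded_shifts_subseq:
  fixes v :: "nat \<Rightarrow> real" and s :: "nat \<Rightarrow> nat"
  assumes B: "\<And>n. \<bar>v n\<bar> \<le> B" and s: "strict_mono s"
  shows "\<exists>r w. strict_mono r \<and> (\<forall>d. (\<lambda>n. v (s (r n) - d)) \<longlonglongrightarrow> w d)"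
proof -
  let ?K = "PiE UNIV (\<lambda>_::nat. {-B..B})"
  have "compact ?K"
  proof -
    have "compactin (product_topology (\<lambda>_. euclidean) UNIV) ?K"
      by (subst compactin_PiE) auto
    then show ?thesis by (simp add: euclidean_product_topology)
  qed
  then have "seq_compact ?K" by (rule compact_imp_seq_compact)
  moreover have "\<forall>n. (\<lambda>d. v (s n - d)) \<in> ?K"
  proof -
    have "v n \<in> {-B..B}" for n
      using B[of n] by auto
    then show ?thesis by auto
  qed
  ultimately obtain w r where r: "strict_mono r" "((\<lambda>n. (\<lambda>d. v (s n - d))) \<circ> r) \<longlonglongrightarrow> w"
    using seq_compactE[of ?K "\<lambda>n d. v (s n - d)"] by metis
  have "(\<lambda>n. (((\<lambda>n. (\<lambda>d. v (s n - d))) \<circ> r) n) d) \<longlonglongrightarrow> w d" for d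
    by (rule continuous_on_tendsto_compose[OF continuous_on_product_coordinates r(2)]) auto
  then have "(\<lambda>n. v (s (r n) - d)) \<longlonglongrightarrow> w d" for d
    by (simp add: o_def)
  with r(1) show ?thesis by blast
qed


section \<open>The Erdos-Feller-Pollard renewal theorem\<close>

lemma ereal_between_real:
  assumes "L \<le> ereal b" "ereal a \<le> L" "\<And>x. L = ereal x \<Longrightarrow> thesis"
  shows thesis
  using assms by (cases L) auto

text \<open>A limit \<open>w\<close> of shifts along a subsequence realising the limsup \<Lambda>
  satisfies \<open>w 0 = \<Lambda>\<close> and \<open>w \<le> \<Lambda>\<close>, and
  \<open>w d\<close> is the average of the \<open>w (d + k)\<close> with weights \<open>f k\<close>.
  Hence the value \<Lambda> spreads from \<open>d\<close> to \<open>d + k\<close> whenever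
  \<open>f k > 0\<close>, and by the last assumption such steps from 0 reach everything from
  \<open>N\<close> on. The sign of \<open>v\<close> is left open so that \<open>- u\<close> may be
  inserted too.\<close>

lemma renewal_limsup:
  fixes f v :: "nat \<Rightarrow> real"
  assumes f: "\<And>k. 0 \<le> f k" "f sums 1"
    and v: "\<And>n. \<bar>v n\<bar> \<le> B" "\<And>n. 1 \<le> n \<Longrightarrow> v n = (\<Sum>k\<le>n. f k * v (n - k))"
    and N: "\<And>S n. 0 \<in> S \<Longrightarrow> (\<And>d k. d \<in> S \<Longrightarrow> f k > 0 \<Longrightarrow> d + k \<in> S) \<Longrightarrow> n \<ge> N \<Longrightarrow> n \<in> S"
  obtains \<Lambda> p where "filterlim p at_top sequentially" "\<And>d. (\<lambda>n. v (p n - d)) \<longlonglongrightarrow> \<Lambda>"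
    "\<And>\<epsilon>. \<epsilon> > 0 \<Longrightarrow> eventually (\<lambda>n. v n < \<Lambda> + \<epsilon>) sequentially"
proof -
  obtain s where s: "strict_mono s" "((\<lambda>n. ereal (v n)) \<circ> s) \<longlonglongrightarrow> limsup (\<lambda>n. ereal (v n))"
    using limsup_subseq_lim by blast
  have "limsup (\<lambda>n. ereal (v n)) \<le> ereal B"
    by (rule Limsup_bounded) (use abs_le_D1[OF v(1)] in simp)
  moreover have "ereal (- B) \<le> limsup (\<lambda>n. ereal (v n))"
    by (rule le_Limsup) (use abs_le_D2[OF v(1)] in \<open>simp_all add: minus_le_iff[of B]\<close>)
  ultimately have "\<exists>\<Lambda>. limsup (\<lambda>n. ereal (v n)) = ereal \<Lambda>"
    by (rule ereal_between_real) (rule exI)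
  then obtain \<Lambda> where \<Lambda>: "limsup (\<lambda>n. ereal (v n)) = ereal \<Lambda>" ..
  have lt: "eventually (\<lambda>n. v n < \<Lambda> + \<epsilon>) sequentially" if "\<epsilon> > 0" for \<epsilon>
  proof -
    have "limsup (\<lambda>n. ereal (v n)) < ereal (\<Lambda> + \<epsilon>)"
      unfolding \<Lambda> using that by simp
    from Limsup_lessD[OF this] show ?thesis
      by (rule eventually_mono) simp
  qed
  obtain r w where r: "strict_mono r" and w: "\<And>d. (\<lambda>n. v (s (r n) - d)) \<longlonglongrightarrow> w d"
    using bounded_shifts_subseq[of v, OF v(1) s(1)] by blast
  have sr: "filterlim (\<lambda>n. s (r n) - d) at_top sequentially" for d
    by (rule filterlim_compose[OF filterlim_minus_const_nat_at_top])
       (rule filterlim_compose[OF filterlim_subseq[OF s(1)] filterlim_subseq[OF r]])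
  have w_le: "w d \<le> \<Lambda>" for d
  proof (rule field_le_epsilon)
    fix \<epsilon> :: real assume "\<epsilon> > 0"
    have "eventually (\<lambda>n. v (s (r n) - d) < \<Lambda> + \<epsilon>) sequentially"
      using lt[OF \<open>\<epsilon> > 0\<close>] sr by (rule eventually_compose_filterlim)
    then show "w d \<le> \<Lambda> + \<epsilon>"
      by (intro tendsto_upperbound[OF w]) (auto elim: eventually_mono)
  qed
  have "(\<lambda>n. v (s (r n))) \<longlonglongrightarrow> \<Lambda>"
    using s(2) LIMSEQ_subseq_LIMSEQ[OF _ r] unfolding \<Lambda> by (fastforce simp: o_def)
  with w[of 0] have w0: "w 0 = \<Lambda>"
    by (simp add: LIMSEQ_unique)
  \<comment> \<open>This is the limit of the renewal equation at the index
    \<open>s (r n) - d\<close>, available once that index is at least 1; its finite sum is extended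
    by zero to a series.\<close>
  have w_eq: "(\<lambda>k. f k * w (d + k)) sums w d" for d
  proof -
    let ?a = "\<lambda>n k. if k \<le> s (r n) - d then f k * v (s (r n) - (d + k)) else 0"
    have lim: "(\<lambda>n. ?a n k) \<longlonglongrightarrow> f k * w (d + k)" for k
    proof (rule Lim_transform_eventually)
      show "(\<lambda>n. f k * v (s (r n) - (d + k))) \<longlonglongrightarrow> f k * w (d + k)"
        by (intro tendsto_intros w)
      show "eventually (\<lambda>n. f k * v (s (r n) - (d + k)) = ?a n k) sequentially"
        using eventually_compose_filterlim[OF eventually_ge_at_top[of k] sr[of d]]
        by eventually_elim simp
    qed
    have bound: "\<bar>?a n k\<bar> \<le> f k * B" for n k
    proof -
      have "0 \<le> B" using v(1)[of 0] by linarith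
      then show ?thesis
        using f(1)[of k] v(1) by (auto simp: abs_mult intro: mult_left_mono)
    qed
    have sB: "summable (\<lambda>k. f k * B)"
      using f(2) by (intro summable_mult2) (rule sums_summable)
    note * = tendsto_suminf_dominated[OF lim bound sB]
    have "eventually (\<lambda>n. (\<Sum>k. ?a n k) = v (s (r n) - d)) sequentially"
      using eventually_compose_filterlim[OF eventually_ge_at_top[of 1] sr[of d]]
    proof eventually_elim
      case (elim n)
      then show ?case
        using v(2)[of "s (r n) - d"] by (simp add: suminf_truncated)
    qed
    then have "(\<lambda>n. v (s (r n) - d)) \<longlonglongrightarrow> (\<Sum>k. f k * w (d + k))"
      by (rule Lim_transform_eventually[OF *(2)])
    then show ?thesis
      using LIMSEQ_unique[OF w[of d]] summable_sums[OF *(1)] by simp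
  qed
  \<comment> \<open>Maximum principle: the nonnegative terms
    \<open>f k * (\<Lambda> - w (d + k))\<close> sum to 0.\<close>
  have step: "w (d + k) = \<Lambda>" if "w d = \<Lambda>" "f k > 0" for d k
  proof -
    have "(\<lambda>k. f k * \<Lambda> - f k * w (d + k)) sums (1 * \<Lambda> - w d)"
      by (intro sums_diff sums_mult2 f(2) w_eq)
    then have sums: "(\<lambda>k. f k * (\<Lambda> - w (d + k))) sums 0"
      using that(1) by (simp add: algebra_simps)
    have "f k * (\<Lambda> - w (d + k)) = 0"
      using suminf_eq_zero_iff[OF sums_summable[OF sums]] sums f(1) w_le
      by (simp add: sums_unique[symmetric])
    then show ?thesis using that(2) by simp
  qed
  have wN: "w n = \<Lambda>" if "n \<ge> N" for n
    using N[of "{d. w d = \<Lambda>}" n] w0 step that by auto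
  \<comment> \<open>Shifting by a further \<open>N\<close> moves into the range where
    \<open>w\<close> is constant.\<close>
  show ?thesis
  proof (rule that)
    show "filterlim (\<lambda>n. s (r n) - N) at_top sequentially" by (rule sr)
    show "(\<lambda>n. v (s (r n) - N - d)) \<longlonglongrightarrow> \<Lambda>" for d
      using w[of "N + d"] wN[of "N + d"] by simp
  qed (rule lt)
qed

text \<open>Here \<open>suminf r\<close> is the mean of the distribution \<open>f\<close>, so the
  two cases are finite and infinite mean. In the second one a positive limsup would make the partial
  sums of \<open>r\<close> bounded.\<close>

theorem renewal_limit:
  fixes f u :: "nat \<Rightarrow> real"
  assumes f: "f 0 = 0" "\<And>k. 0 \<le> f k" "f sums 1"
    and u: "u 0 = 1" "\<And>n. 1 \<le> n \<Longrightarrow> u n = (\<Sum>k\<le>n. f k * u (n - k))"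
    and gcd: "Gcd {n. 1 \<le> n \<and> u n > 0} = 1"
  defines "r \<equiv> \<lambda>k. 1 - (\<Sum>j\<le>k. f j)"
  shows "summable r \<Longrightarrow> u \<longlonglongrightarrow> 1 / suminf r" "\<not> summable r \<Longrightarrow> u \<longlonglongrightarrow> 0"
proof -
  have F: "(\<Sum>j\<le>k. f j) \<le> 1" for k
    using sum_le_suminf[OF sums_summable[OF f(3)], of "{..k}"] f by (simp add: sums_unique[symmetric])
  have r0: "r k \<ge> 0" for k using F by (simp add: r_def)
  have u01: "0 \<le> u n \<and> u n \<le> 1" for n
  proof (induction n rule: less_induct)
    case (less n)
    show ?case
    proof (cases "n = 0")
      case False
      have *: "0 \<le> f k * u (n - k) \<and> f k * u (n - k) \<le> f k" if "k \<le> n" for k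
        using less[of "n - k"] that f(1) f(2)[of k] False by (cases "k = 0") (auto intro: mult_left_le)
      then have "(\<Sum>k\<le>n. f k * u (n - k)) \<le> (\<Sum>k\<le>n. f k)" by (intro sum_mono) auto
      then show ?thesis using u(2)[of n] F[of n] False * by (auto intro: sum_nonneg)
    qed (simp add: u)
  qed
  \<comment> \<open>From \<open>n\<close> to \<open>n + 1\<close> the sum gains
    \<open>r 0 * u (n + 1) = u (n + 1)\<close> and loses the sum of the
    \<open>f (k + 1) * u (n - k)\<close>, which is \<open>u (n + 1)\<close> by the renewal
    equation.\<close>
  have ru: "(\<Sum>k\<le>n. r k * u (n - k)) = 1" for n
  proof (induction n)
    case 0
    show ?case by (simp add: r_def f u)
  next
    case (Suc n)
    have "(\<Sum>k\<le>Suc n. r k * u (Suc n - k)) = r 0 * u (Suc n) + (\<Sum>k\<le>n. r (Suc k) * u (n - k))"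
      by (subst sum.atMost_Suc_shift) simp
    also have "(\<Sum>k\<le>n. r (Suc k) * u (n - k)) = (\<Sum>k\<le>n. r k * u (n - k)) - (\<Sum>k\<le>n. f (Suc k) * u (n - k))"
      by (simp add: r_def sum_subtractf[symmetric] algebra_simps)
    also have "(\<Sum>k\<le>n. f (Suc k) * u (n - k)) = (\<Sum>k\<le>Suc n. f k * u (Suc n - k))"
      by (subst sum.atMost_Suc_shift) (simp add: f)
    also have "\<dots> = u (Suc n)" by (rule u(2)[symmetric]) simp
    finally show ?case using Suc by (simp add: r_def f)
  qed
  \<comment> \<open>Returning at time \<open>m\<close> and again \<open>n\<close> later is one way
    to return at time \<open>m + n\<close>. Hence the times with positive \<open>u\<close> form an
    additive semigroup.\<close>
  have umult: "u m * u n \<le> u (m + n)" for m n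
  proof (induction m rule: less_induct)
    case (less m)
    show ?case
    proof (cases "m = 0")
      case False
      have "u m * u n = (\<Sum>k\<le>m. f k * (u (m - k) * u n))"
        using False by (subst u(2)) (auto simp: sum_distrib_right mult.assoc)
      also have "\<dots> \<le> (\<Sum>k\<le>m. f k * u (m + n - k))"
      proof (rule sum_mono)
        fix k assume k: "k \<in> {..m}"
        show "f k * (u (m - k) * u n) \<le> f k * u (m + n - k)"
        proof (cases "k = 0")
          case False
          then have "u (m - k) * u n \<le> u (m - k + n)" using less[of "m - k"] k \<open>m \<noteq> 0\<close> by auto
          then show ?thesis using f(2)[of k] k by (simp add: mult_left_mono)
        qed (simp add: f)
      qed
      also have "\<dots> \<le> (\<Sum>k\<le>m + n. f k * u (m + n - k))"
        using f(2) u01 by (intro sum_mono2) auto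
      also have "\<dots> = u (m + n)" using False by (subst u(2)[of "m + n"]) auto
      finally show ?thesis .
    qed (simp add: u)
  qed
  have "\<exists>N. \<forall>n\<ge>N. n \<in> {n. u n > 0}"
  proof (rule additive_set_cofinal)
    show "a + b \<in> {n. 0 < u n}" if "a \<in> {n. 0 < u n}" "b \<in> {n. 0 < u n}" for a b
      using that less_le_trans[OF mult_pos_pos umult] by simp
    have "{n. u n > 0} = insert 0 {n. 1 \<le> n \<and> u n > 0}" using u(1) by (auto simp: Suc_le_eq)
    then show "Gcd {n. u n > 0} = 1" using gcd by simp
  qed (simp add: u)
  then obtain N where N: "\<And>n. n \<ge> N \<Longrightarrow> u n > 0" by auto
  \<comment> \<open>\<open>u n > 0\<close> makes \<open>n\<close> a sum of elements of the support
    of \<open>f\<close>; the induction splits off one summand.\<close>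
  have reach: "d + n \<in> S" if S: "\<And>d k. d \<in> S \<Longrightarrow> f k > 0 \<Longrightarrow> d + k \<in> S" and "d \<in> S" "u n > 0" for S d n
    using that(2,3)
  proof (induction n arbitrary: d rule: less_induct)
    case (less n)
    show ?case
    proof (cases "n = 0")
      case False
      then have "(\<Sum>k\<le>n. f k * u (n - k)) > 0" using u(2)[of n] less.prems by simp
      then obtain k where k: "k \<le> n" "f k * u (n - k) > 0"
        using sum_nonpos[of "{..n}" "\<lambda>k. f k * u (n - k)"] by (force simp: not_le)
      then have "f k > 0" "u (n - k) > 0"
        using f(2)[of k] u01[of "n - k"] by (auto simp: zero_less_mult_iff)
      moreover from this have "k > 0" using f(1) by (cases k) auto
      ultimately have "(d + k) + (n - k) \<in> S"
        using False less.prems(1) by (intro less.IH S) auto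
      then show ?thesis using k(1) by simp
    qed (use less.prems in simp)
  qed
  have reach0: "n \<in> S" if "0 \<in> S" "\<And>d k. d \<in> S \<Longrightarrow> f k > 0 \<Longrightarrow> d + k \<in> S" "n \<ge> N" for S n
    using reach[of S 0 n] that N by auto
  obtain \<Lambda> p where p: "filterlim p at_top sequentially" "\<And>d. (\<lambda>n. u (p n - d)) \<longlonglongrightarrow> \<Lambda>"
    and up: "\<And>\<epsilon>. \<epsilon> > 0 \<Longrightarrow> eventually (\<lambda>n. u n < \<Lambda> + \<epsilon>) sequentially"
  proof (rule renewal_limsup[of f u 1 N, OF f(2,3) _ _ reach0])
    show "u n = (\<Sum>k\<le>n. f k * u (n - k))" if "1 \<le> n" for n
      by (rule u(2)[OF that])
  qed (use u01 in auto)
  \<comment> \<open>\<open>- \<Lambda>'\<close> is the liminf of \<open>u\<close>.\<close>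
  obtain \<Lambda>' p' where p': "filterlim p' at_top sequentially" "\<And>d. (\<lambda>n. - u (p' n - d)) \<longlonglongrightarrow> \<Lambda>'"
    and low: "\<And>\<epsilon>. \<epsilon> > 0 \<Longrightarrow> eventually (\<lambda>n. - u n < \<Lambda>' + \<epsilon>) sequentially"
  proof (rule renewal_limsup[of f "\<lambda>n. - u n" 1 N, OF f(2,3) _ _ reach0])
    show "- u n = (\<Sum>k\<le>n. f k * - u (n - k))" if "1 \<le> n" for n
      using u(2)[OF that] by (simp add: sum_negf)
  qed (use u01 in auto)
  show "u \<longlonglongrightarrow> 1 / suminf r" if r: "summable r"
  proof -
    \<comment> \<open>In \<open>ru\<close> at the index \<open>q n\<close> each
      \<open>u (q n - k)\<close> tends to \<open>L\<close>, and \<open>r\<close> itself dominates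
      because \<open>u\<close> lies between 0 and 1.\<close>
    have lim1: "suminf r * L = 1" if q: "filterlim q at_top sequentially" "\<And>d. (\<lambda>n. u (q n - d)) \<longlonglongrightarrow> L" for q L
    proof -
      let ?a = "\<lambda>n k. if k \<le> q n then r k * u (q n - k) else 0"
      have "(\<lambda>n. \<Sum>k. ?a n k) \<longlonglongrightarrow> (\<Sum>k. r k * L)"
      proof (rule tendsto_suminf_dominated[OF _ _ r])
        show "(\<lambda>n. ?a n k) \<longlonglongrightarrow> r k * L" for k
        proof (rule Lim_transform_eventually)
          show "(\<lambda>n. r k * u (q n - k)) \<longlonglongrightarrow> r k * L" by (intro tendsto_intros q(2))
          show "eventually (\<lambda>n. r k * u (q n - k) = ?a n k) sequentially"
            using eventually_compose_filterlim[OF eventually_ge_at_top[of k] q(1)]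
            by eventually_elim simp
        qed
        show "\<bar>?a n k\<bar> \<le> r k" for n k
          using r0[of k] u01 by (auto simp: abs_mult intro: mult_left_le)
      qed
      then have "(\<lambda>n::nat. 1::real) \<longlonglongrightarrow> (\<Sum>k. r k * L)" by (simp add: suminf_truncated ru)
      then show ?thesis using suminf_mult2[OF r, of L] by (simp add: LIMSEQ_const_iff)
    qed
    have "suminf r * \<Lambda> = 1" by (rule lim1[OF p])
    moreover have "suminf r * (- \<Lambda>') = 1"
      by (rule lim1[OF p'(1)]) (use tendsto_minus[OF p'(2)] in simp)
    ultimately have "\<Lambda> = 1 / suminf r" "\<Lambda>' = - (1 / suminf r)"
      by (auto simp: eq_divide_eq mult.commute eq_minus_divide_eq)
    with up low show ?thesis
      unfolding order_tendsto_iff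
    proof (intro conjI allI impI)
      fix l assume "l < 1 / suminf r"
      then show "eventually (\<lambda>n. l < u n) sequentially"
        using low[of "1 / suminf r - l"] \<open>\<Lambda>' = _\<close> by simp
    next
      fix l assume "1 / suminf r < l"
      then show "eventually (\<lambda>n. u n < l) sequentially"
        using up[of "l - 1 / suminf r"] \<open>\<Lambda> = _\<close> by simp
    qed
  qed
  show "u \<longlonglongrightarrow> 0" if r: "\<not> summable r"
  proof -
    have "\<Lambda> \<le> 0"
    proof (rule ccontr)
      assume "\<not> \<Lambda> \<le> 0"
      \<comment> \<open>The first \<open>K\<close> terms of \<open>ru\<close> at the index
        \<open>p n\<close> tend to \<Lambda> times the partial sum and never exceed 1.\<close>
      have "(\<Sum>k<K. r k) \<le> 1 / \<Lambda>" for K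
      proof -
        have "(\<lambda>n. \<Sum>k<K. r k * u (p n - k)) \<longlonglongrightarrow> (\<Sum>k<K. r k * \<Lambda>)"
          by (intro tendsto_intros p(2))
        moreover have "eventually (\<lambda>n. (\<Sum>k<K. r k * u (p n - k)) \<le> 1) sequentially"
          using eventually_compose_filterlim[OF eventually_ge_at_top[of K] p(1)]
        proof eventually_elim
          case (elim n)
          have "(\<Sum>k<K. r k * u (p n - k)) \<le> (\<Sum>k\<le>p n. r k * u (p n - k))"
            using elim r0 u01 by (intro sum_mono2) auto
          then show ?case by (simp add: ru)
        qed
        ultimately have "(\<Sum>k<K. r k * \<Lambda>) \<le> 1"
          by (rule tendsto_upperbound) simp
        then show ?thesis using \<open>\<not> \<Lambda> \<le> 0\<close> by (simp add: field_simps sum_distrib_left)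
      qed
      then have "summable r"

        using bounded_imp_summable[of r "1 / \<Lambda>"] r0 unfolding lessThan_Suc_atMost[symmetric] by blast
      with r show False ..
    qed
    then show ?thesis
      unfolding order_tendsto_iff
    proof (intro conjI allI impI)
      fix l :: real assume "0 < l"
      from up[OF this] show "eventually (\<lambda>n. u n < l) sequentially"
        by eventually_elim (use \<open>\<Lambda> \<le> 0\<close> in simp)
    qed (use u01 in \<open>auto intro: always_eventually less_le_trans\<close>)
  qed
qed

section \<open>Countable Markov chains\<close>

lemma integrable_pmf_bounded:
  fixes g :: "'a \<Rightarrow> real"
  assumes "\<And>x. \<bar>g x\<bar> \<le> B"
  shows "integrable (measure_pmf p) g"
  by (rule measure_pmf.integrable_const_bound[where B = B]) (use assms in auto)

text \<open>Bridge between the unordered sums in \<open>matrix_power\<close> and expectations; the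
  bound \<open>B\<close> supplies absolute summability.\<close>

lemma infsum_expectation_pmf:
  fixes g :: "'a \<Rightarrow> real"
  assumes J: "set_pmf p \<subseteq> J" and g: "\<And>x. x \<in> J \<Longrightarrow> \<bar>g x\<bar> \<le> B"
  shows "(\<Sum>\<^sub>\<infinity>x\<in>J. pmf p x * g x) = measure_pmf.expectation p g"
proof -
  have abs: "Infinite_Set_Sum.abs_summable_on (\<lambda>x. pmf p x * g x) J"
  proof (rule abs_summable_on_comparison_test')
    show "Infinite_Set_Sum.abs_summable_on (\<lambda>x. pmf p x * B) J"
      by (rule abs_summable_on_cmult_left) (rule pmf_abs_summable)
    show "norm (pmf p x * g x) \<le> pmf p x * B" if "x \<in> J" for x
      using g[OF that] by (simp add: abs_mult mult_left_mono)
  qed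
  have "(\<Sum>\<^sub>\<infinity>x\<in>J. pmf p x * g x) = infsetsum (\<lambda>x. pmf p x * g x) J"
    by (rule infsetsum_infsum[OF abs, symmetric])
  also have "\<dots> = infsetsum (\<lambda>x. pmf p x * g x) UNIV"
    by (rule infsetsum_cong_neutral) (use J in \<open>auto simp: set_pmf_iff\<close>)
  also have "\<dots> = measure_pmf.expectation p g"
    by (simp add: pmf_expectation_eq_infsetsum)
  finally show ?thesis .
qed

section \<open>Measurable events in path space\<close>

lemma measurable_case_nat_path_space:
  assumes "i \<in> J"
  shows "case_nat i \<in> path_space J \<rightarrow>\<^sub>M path_space J"
  unfolding path_space_def
proof (rule measurable_PiM_single')
  show "(\<lambda>\<omega>. case_nat i \<omega> n) \<in> PiM UNIV (\<lambda>_. count_space J) \<rightarrow>\<^sub>M count_space J" for n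
    using assms by (cases n) (auto intro: measurable_component_singleton)
  show "case_nat i \<in> space (PiM UNIV (\<lambda>_. count_space J)) \<rightarrow> (\<Pi>\<^sub>E n\<in>UNIV. space (count_space J))"
    using assms by (auto simp: space_PiM PiE_iff split: nat.split)
qed

lemma space_path_space: "space (path_space J) = {\<omega>. \<forall>n. \<omega> n \<in> J}"
  by (auto simp: path_space_def space_PiM PiE_iff)

lemma sets_path_space_coordinate [measurable]:
  "{\<omega> \<in> space (path_space J). \<omega> n = j} \<in> sets (path_space J)"
proof -
  \<comment> \<open>\<open>j\<close> may lie outside \<open>J\<close>; the intersection keeps the
    set in \<open>count_space J\<close>.\<close>
  have "(\<lambda>\<omega>. \<omega> n) -` ({j} \<inter> J) \<inter> space (path_space J) \<in> sets (path_space J)"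
    unfolding path_space_def
    by (rule measurable_sets[OF measurable_component_singleton]) auto
  also have "(\<lambda>\<omega>. \<omega> n) -` ({j} \<inter> J) \<inter> space (path_space J) = {\<omega> \<in> space (path_space J). \<omega> n = j}"
    by (auto simp: space_path_space)
  finally show ?thesis .
qed

lemma sets_path_space_first_hit [measurable]:
  "{\<omega> \<in> space (path_space J). 1 \<le> n \<and> \<omega> n = j \<and> (\<forall>k. 1 \<le> k \<and> k < n \<longrightarrow> \<omega> k \<noteq> j)} \<in> sets (path_space J)"
  by measurable

section \<open>Rows and powers of a stochastic matrix as probability mass functions\<close>

locale stochastic_matrix =
  fixes J :: "nat set" and P :: "nat \<Rightarrow> nat \<Rightarrow> real"
  assumes stochastic: "row_stochastic J P"
begin

text \<open>With rows as probability mass functions on \<open>nat\<close>, matrix products become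
  monadic binds and sums over states become expectations. The point masses outside \<open>J\<close>
  make \<open>step\<close> total.\<close>

definition step :: "nat \<Rightarrow> nat pmf" where
  "step i = (if i \<in> J then embed_pmf (\<lambda>j. if j \<in> J then P i j else 0) else return_pmf i)"

lemma pmf_step:
  assumes i: "i \<in> J"
  shows "pmf (step i) j = (if j \<in> J then P i j else 0)"
  unfolding step_def if_P[OF i]
proof (rule pmf_embed_pmf)
  show "0 \<le> (if x \<in> J then P i x else 0)" for x
    using stochastic i by (auto simp: row_stochastic_def)
  interpret prob_space "density (count_space J) (\<lambda>j. ennreal (P i j))"
    by (rule chain_step_prob_space[OF stochastic i])
  have "(\<integral>\<^sup>+x. ennreal (if x \<in> J then P i x else 0) \<partial>count_space UNIV) = (\<integral>\<^sup>+x. ennreal (P i x) * indicator J x \<partial>count_space UNIV)"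
    by (intro nn_integral_cong) auto
  also have "\<dots> = (\<integral>\<^sup>+x. ennreal (P i x) \<partial>count_space J)"
    by (simp add: nn_integral_count_space_indicator)
  also have "\<dots> = 1"
    using emeasure_space_1 by (simp add: emeasure_density cong: nn_integral_cong_simp)
  finally show "(\<integral>\<^sup>+x. ennreal (if x \<in> J then P i x else 0) \<partial>count_space UNIV) = 1" .
qed

lemma set_pmf_step: "i \<in> J \<Longrightarrow> set_pmf (step i) \<subseteq> J"
  by (auto simp: set_pmf_iff pmf_step split: if_splits)

lemma AE_step: "i \<in> J \<Longrightarrow> AE l in measure_pmf (step i). l \<in> J"
  using set_pmf_step by (auto intro!: AE_pmfI)

primrec iter :: "nat \<Rightarrow> nat \<Rightarrow> nat pmf" where
  "iter 0 i = return_pmf i"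
| "iter (Suc n) i = bind_pmf (step i) (iter n)"

text \<open>The Chapman-Kolmogorov equation, as associativity of \<open>bind_pmf\<close>.\<close>

lemma iter_add: "iter (m + n) i = bind_pmf (iter m i) (iter n)"
proof (induction m arbitrary: i)
  case (Suc m)
  then have "iter (m + n) = (\<lambda>i. bind_pmf (iter m i) (iter n))" by blast
  then show ?case by (simp add: bind_assoc_pmf)
qed (simp add: bind_return_pmf)

lemma set_pmf_iter: "i \<in> J \<Longrightarrow> set_pmf (iter n i) \<subseteq> J"
  by (induction n arbitrary: i) (use set_pmf_step in fastforce)+

lemma matrix_power_eq_pmf: "i \<in> J \<Longrightarrow> matrix_power J P n i j = pmf (iter n i) j"
proof (induction n arbitrary: i)
  case (Suc n)
  have "matrix_power J P (Suc n) i j = (\<Sum>\<^sub>\<infinity>l\<in>J. pmf (step i) l * pmf (iter n l) j)"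
    using Suc by (auto simp: pmf_step intro!: infsum_cong)
  also have "\<dots> = measure_pmf.expectation (step i) (\<lambda>l. pmf (iter n l) j)"
    by (rule infsum_expectation_pmf[OF set_pmf_step[OF Suc.prems], of _ 1]) (simp add: pmf_le_1)
  finally show ?case by (simp add: pmf_bind)
qed (simp add: of_bool_def)

section \<open>The law of the chain and its decomposition after the first step\<close>

abbreviation law :: "nat \<Rightarrow> (nat \<Rightarrow> nat) measure" where
  "law i \<equiv> chain_law J P i"

lemma is_chain_law_law: "i \<in> J \<Longrightarrow> is_chain_law J P i (law i)"
  unfolding chain_law_def by (rule theI') (rule ex1_chain_law[OF stochastic])

lemma prob_space_law: "i \<in> J \<Longrightarrow> prob_space (law i)"
  using is_chain_law_law by (auto simp: is_chain_law_def)

lemma sets_law: "i \<in> J \<Longrightarrow> sets (law i) = sets (path_space J)"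
  using is_chain_law_law by (auto simp: is_chain_law_def)

lemma space_law: "i \<in> J \<Longrightarrow> space (law i) = space (path_space J)"
  using sets_law sets_eq_imp_space_eq by blast

lemma measure_law_cylinder:
  assumes "i \<in> J" "\<And>k. s k \<in> J"
  shows "measure (law i) {\<omega> \<in> space (path_space J). \<forall>k\<le>n. \<omega> k = s k} =
    (if s 0 = i then \<Prod>k<n. P (s k) (s (Suc k)) else 0)"
  using is_chain_law_law[OF assms(1)] assms(2) unfolding is_chain_law_def space_law[OF assms(1)] by blast

lemma AE_law_start: "i \<in> J \<Longrightarrow> AE \<omega> in law i. \<omega> 0 = i"
proof -
  assume i: "i \<in> J"
  interpret prob_space "law i" by (rule prob_space_law[OF i])
  have "prob {\<omega> \<in> space (law i). \<omega> 0 = i} = 1"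
    using measure_law_cylinder[OF i, of "\<lambda>_. i" 0] i by (simp add: space_law)
  from AE_prob_1[OF this] show ?thesis by simp
qed

text \<open>The mixture \<open>?K\<close> of the laws of the successors of \<open>i\<close>, prefixed by \<open>i\<close>, satisfies the
  characterization of \<open>law i\<close>; uniqueness identifies the two.\<close>

theorem law_one_step:
  assumes i: "i \<in> J" and A: "A \<in> sets (path_space J)"
  shows "emeasure (law i) A =
    (\<integral>\<^sup>+l. emeasure (law l) (case_nat i -` A \<inter> space (path_space J)) \<partial>measure_pmf (step i))"
proof -
  let ?S = "path_space J"
  \<comment> \<open>The kernel has to be a probability measure at every natural number;
    \<open>i\<close> stands in for the states outside \<open>J\<close>, which have mass 0 under
    \<open>step i\<close>.\<close>
  let ?\<kappa> = "\<lambda>l. distr (law (if l \<in> J then l else i)) ?S (case_nat i)"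
  let ?K = "measure_pmf (step i) \<bind> ?\<kappa>"
  have meas: "case_nat i \<in> law l \<rightarrow>\<^sub>M ?S" if "l \<in> J" for l
    using measurable_case_nat_path_space[OF i] sets_law[OF that] by (simp cong: measurable_cong_sets)
  have k: "?\<kappa> \<in> measure_pmf (step i) \<rightarrow>\<^sub>M subprob_algebra ?S"
    using i by (auto simp: space_subprob_algebra
        intro!: prob_space_imp_subprob_space prob_space.prob_space_distr prob_space_law meas)
  have K: "emeasure ?K B = (\<integral>\<^sup>+l. emeasure (law l) (case_nat i -` B \<inter> space ?S) \<partial>measure_pmf (step i))"
    if B: "B \<in> sets ?S" for B
  proof -
    have "emeasure ?K B = (\<integral>\<^sup>+l. emeasure (?\<kappa> l) B \<partial>measure_pmf (step i))"
      by (rule emeasure_bind[OF _ k B]) simp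
    also have "\<dots> = (\<integral>\<^sup>+l. emeasure (law l) (case_nat i -` B \<inter> space ?S) \<partial>measure_pmf (step i))"
      by (rule nn_integral_cong_AE, rule AE_mp[OF AE_step[OF i]])
         (auto intro!: AE_I2 simp: emeasure_distr[OF meas B] space_law)
    finally show ?thesis .
  qed
  have sets_K: "sets ?K = sets ?S"
    by (rule sets_bind_measurable[OF k]) simp
  have space_K: "space ?K = space ?S"
    using sets_K by (rule sets_eq_imp_space_eq)
  have case_space: "case_nat i \<omega> \<in> space ?S" if "\<omega> \<in> space ?S" for \<omega>
    using that measurable_space[OF measurable_case_nat_path_space[OF i]] by blast
  have one: "emeasure (law l) (space ?S) = 1" if "l \<in> J" for l
    using prob_space.emeasure_space_1[OF prob_space_law[OF that]] by (simp add: space_law[OF that])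
  have total: "(\<integral>\<^sup>+l. emeasure (law l) (space ?S) \<partial>measure_pmf (step i)) = 1"
  proof -
    have "(\<integral>\<^sup>+l. emeasure (law l) (space ?S) \<partial>measure_pmf (step i)) = (\<integral>\<^sup>+l. 1 \<partial>measure_pmf (step i))"
      by (rule nn_integral_cong_AE, rule AE_mp[OF AE_step[OF i]]) (auto simp: one)
    then show ?thesis by simp
  qed
  have "case_nat i -` space ?S \<inter> space ?S = space ?S"
    using case_space by auto
  then have "emeasure ?K (space ?S) = 1"
    using K[OF sets.top] total by simp
  then have "prob_space ?K" by (intro prob_spaceI) (simp add: space_K)
  then interpret K: prob_space ?K .
  have "is_chain_law J P i ?K"
    unfolding is_chain_law_def
  proof (intro conjI allI impI)
    fix s :: "nat \<Rightarrow> nat" and n assume s: "\<forall>k. s k \<in> J"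
    let ?C = "{\<omega> \<in> space ?S. \<forall>k\<le>n. \<omega> k = s k}"
    have C: "?C \<in> sets ?S" by measurable
    show "measure ?K {\<omega> \<in> space ?K. \<forall>k\<le>n. \<omega> k = s k} =
        (if s 0 = i then \<Prod>k<n. P (s k) (s (Suc k)) else 0)"
    proof (cases "s 0 = i")
      case False
      then have "case_nat i -` ?C \<inter> space ?S = {}" by fastforce
      then show ?thesis using False K[OF C] by (simp add: space_K measure_def)
    next
      case True
      show ?thesis
      proof (cases n)
        case 0
        have "case_nat i -` ?C \<inter> space ?S = space ?S"
          using 0 True case_space by auto
        then show ?thesis using True 0 K[OF C] total by (simp add: space_K measure_def)
      next
        case (Suc m)
        let ?D = "{\<omega> \<in> space ?S. \<forall>k\<le>m. \<omega> k = s (Suc k)}"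
        let ?c = "\<Prod>k<m. P (s (Suc k)) (s (Suc (Suc k)))"
        have c: "?c \<ge> 0"
          using s stochastic by (auto intro!: prod_nonneg simp: row_stochastic_def)
        have D: "emeasure (law l) ?D = ennreal ?c * indicator {s 1} l" if "l \<in> J" for l
          using prob_space.finite_measure[OF prob_space_law[OF that]]
          measure_law_cylinder[OF that, of "\<lambda>k. s (Suc k)" m] s
          by (simp add: finite_measure.emeasure_eq_measure indicator_def)
        have "case_nat i -` ?C \<inter> space ?S = ?D"
          unfolding Suc using True case_space by (auto split: nat.splits)
        then have "emeasure ?K ?C = (\<integral>\<^sup>+l. emeasure (law l) ?D \<partial>measure_pmf (step i))"
          using K[OF C] by simp
        also have "\<dots> = (\<integral>\<^sup>+l. ennreal ?c * indicator {s 1} l \<partial>measure_pmf (step i))"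
          by (rule nn_integral_cong_AE, rule AE_mp[OF AE_step[OF i]]) (auto simp: D)
        also have "\<dots> = ennreal ?c * ennreal (P i (s 1))"
          using s by (simp add: nn_integral_cmult_indicator emeasure_pmf_single pmf_step[OF i])
        also have "\<dots> = ennreal (P i (s 1) * ?c)"
          using c by (subst ennreal_mult'[symmetric]) (simp_all add: mult.commute)
        also have "P i (s 1) * ?c = (\<Prod>k<n. P (s k) (s (Suc k)))"
          unfolding Suc using True by (subst prod.lessThan_Suc_shift) simp
        finally have "emeasure ?K ?C = ennreal (\<Prod>k<n. P (s k) (s (Suc k)))" .
        moreover have "0 \<le> (\<Prod>k<n. P (s k) (s (Suc k)))"
          using s stochastic by (auto intro!: prod_nonneg simp: row_stochastic_def)
        ultimately show ?thesis using True by (simp add: space_K measure_def)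
      qed
    qed
  qed (simp_all add: K.prob_space_axioms sets_K)
  then have "law i = ?K"
    by (rule chain_law_unique[OF is_chain_law_law[OF i] _ i])
  then show ?thesis using K[OF A] by simp
qed

lemma measure_law_le_1: "i \<in> J \<Longrightarrow> measure (law i) A \<le> 1"
  using prob_space.prob_le_1[OF prob_space_law] .

corollary measure_law_one_step:
  assumes i: "i \<in> J" and A: "A \<in> sets (path_space J)"
    and g: "\<And>l. l \<in> J \<Longrightarrow> measure (law l) (case_nat i -` A \<inter> space (path_space J)) = g l"
  shows "measure (law i) A = measure_pmf.expectation (step i) g"
proof -
  have "ennreal (measure (law i) A) = emeasure (law i) A"
    using prob_space.finite_measure[OF prob_space_law[OF i]] by (simp add: finite_measure.emeasure_eq_measure)
  also have "\<dots> = (\<integral>\<^sup>+l. ennreal (g l) \<partial>measure_pmf (step i))"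
    unfolding law_one_step[OF i A]
    by (rule nn_integral_cong_AE, rule AE_mp[OF AE_step[OF i]])
       (auto simp: g finite_measure.emeasure_eq_measure[OF prob_space.finite_measure[OF prob_space_law]])
  also have "\<dots> = ennreal (measure_pmf.expectation (step i) g)"
  proof (rule nn_integral_eq_integral)
    show "AE l in measure_pmf (step i). 0 \<le> g l"
      by (rule AE_mp[OF AE_step[OF i]]) (auto simp: g[symmetric])
    show "integrable (measure_pmf (step i)) g"
      by (rule measure_pmf.integrable_const_bound[where B = 1])
         (rule AE_mp[OF AE_step[OF i]], auto simp: g[symmetric] measure_law_le_1)
  qed
  finally have "ennreal (measure (law i) A) = ennreal (measure_pmf.expectation (step i) g)" .
  moreover have "0 \<le> measure_pmf.expectation (step i) g"
    by (rule integral_nonneg_AE, rule AE_mp[OF AE_step[OF i]]) (simp add: g[symmetric])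
  ultimately show ?thesis by simp
qed


section \<open>First passage times and the renewal equation\<close>

text \<open>The starting point does not count as a visit, so \<open>hit j j\<close> lists the first
  return probabilities.\<close>

definition hit :: "nat \<Rightarrow> nat \<Rightarrow> nat \<Rightarrow> real" where
  "hit i j n = measure (law i)
     {\<omega> \<in> space (path_space J). 1 \<le> n \<and> \<omega> n = j \<and> (\<forall>k. 1 \<le> k \<and> k < n \<longrightarrow> \<omega> k \<noteq> j)}"

definition ever_hit :: "nat \<Rightarrow> nat \<Rightarrow> real" where
  "ever_hit i j = measure (law i) {\<omega> \<in> space (path_space J). \<exists>n\<ge>1. \<omega> n = j}"

lemma hit_nonneg: "0 \<le> hit i j n"
  by (simp add: hit_def)

lemma hit_le_1: "i \<in> J \<Longrightarrow> hit i j n \<le> 1"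
  by (simp add: hit_def measure_law_le_1)

lemma hit_0: "hit i j 0 = 0"
  by (simp add: hit_def)

lemma case_nat_in_path_space:
  assumes "i \<in> J"
  shows "case_nat i \<omega> \<in> space (path_space J) \<longleftrightarrow> \<omega> \<in> space (path_space J)"
proof
  assume "case_nat i \<omega> \<in> space (path_space J)"
  then have "case_nat i \<omega> (Suc n) \<in> J" for n unfolding space_path_space by blast
  then show "\<omega> \<in> space (path_space J)" by (simp add: space_path_space)
qed (use assms in \<open>auto simp: space_path_space split: nat.split\<close>)

text \<open>Almost every path under \<open>law l\<close> starts at \<open>l\<close>. This decides
  the conditions on coordinate 0 that arise when an event for a prefixed path is rewritten for the
  remaining path.\<close>

lemma measure_law_start:
  assumes l: "l \<in> J" and A: "A \<in> sets (path_space J)" and B: "B \<in> sets (path_space J)"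
    and eq: "\<And>\<omega>. \<omega> \<in> space (path_space J) \<Longrightarrow> \<omega> 0 = l \<Longrightarrow> \<omega> \<in> A \<longleftrightarrow> \<omega> \<in> B"
  shows "measure (law l) A = measure (law l) B"
proof -
  interpret prob_space "law l" by (rule prob_space_law[OF l])
  show ?thesis
  proof (rule finite_measure_eq_AE)
    show "AE \<omega> in law l. \<omega> \<in> A \<longleftrightarrow> \<omega> \<in> B"
      using AE_law_start[OF l] AE_space by eventually_elim (use eq in \<open>auto simp: space_law[OF l]\<close>)
  qed (use A B in \<open>simp_all add: sets_law[OF l]\<close>)
qed

lemma hit_Suc_0:
  assumes i: "i \<in> J" and j: "j \<in> J"
  shows "hit i j (Suc 0) = pmf (step i) j"
proof -
  have "hit i j (Suc 0) = measure_pmf.expectation (step i) (\<lambda>l. indicator {j} l)"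
    unfolding hit_def
  proof (rule measure_law_one_step[OF i sets_path_space_first_hit])
    fix l assume l: "l \<in> J"
    have "measure (law l) (case_nat i -` {\<omega> \<in> space (path_space J). 1 \<le> Suc 0 \<and> \<omega> (Suc 0) = j \<and> (\<forall>k. 1 \<le> k \<and> k < Suc 0 \<longrightarrow> \<omega> k \<noteq> j)} \<inter> space (path_space J))
      = measure (law l) {\<omega> \<in> space (path_space J). \<forall>k\<le>0. \<omega> k = (\<lambda>_. j) k}"
      using i by (intro arg_cong[of _ _ "measure (law l)"]) (auto simp: case_nat_in_path_space)
    also have "\<dots> = indicator {j} l"
      by (subst measure_law_cylinder[OF l]) (use j in \<open>auto simp: indicator_def\<close>)
    finally show "measure (law l) (case_nat i -` {\<omega> \<in> space (path_space J). 1 \<le> Suc 0 \<and> \<omega> (Suc 0) = j \<and> (\<forall>k. 1 \<le> k \<and> k < Suc 0 \<longrightarrow> \<omega> k \<noteq> j)} \<inter> space (path_space J)) = indicator {j} l" .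
  qed
  then show ?thesis by (simp add: measure_pmf_single)
qed

text \<open>A first step to \<open>j\<close> is a visit at time 1 and excludes a later first visit;
  from any other \<open>l\<close> the remaining time is \<open>Suc n\<close>.\<close>

lemma hit_Suc_Suc:
  assumes i: "i \<in> J"
  shows "hit i j (Suc (Suc n)) = measure_pmf.expectation (step i) (\<lambda>l. if l = j then 0 else hit l j (Suc n))"
  unfolding hit_def[of i]
proof (rule measure_law_one_step[OF i sets_path_space_first_hit])
  fix l assume l: "l \<in> J"
  let ?A = "{\<omega> \<in> space (path_space J). 1 \<le> Suc (Suc n) \<and> \<omega> (Suc (Suc n)) = j \<and> (\<forall>k. 1 \<le> k \<and> k < Suc (Suc n) \<longrightarrow> \<omega> k \<noteq> j)}"
  let ?B = "{\<omega> \<in> space (path_space J). 1 \<le> Suc n \<and> \<omega> (Suc n) = j \<and> (\<forall>k. 1 \<le> k \<and> k < Suc n \<longrightarrow> \<omega> k \<noteq> j)}"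
  \<comment> \<open>Times from 1 on for the prefixed path are times from 0 on for the remaining
    path, hence the extra condition \<open>\<omega> 0 \<noteq> j\<close>.\<close>
  have mem: "\<omega> \<in> case_nat i -` ?A \<inter> space (path_space J) \<longleftrightarrow> \<omega> \<in> ?B \<and> \<omega> 0 \<noteq> j" for \<omega>
  proof -
    have "(\<forall>k. 1 \<le> k \<and> k < Suc (Suc n) \<longrightarrow> case_nat i \<omega> k \<noteq> j) \<longleftrightarrow> (\<forall>k. k < Suc n \<longrightarrow> \<omega> k \<noteq> j)"
      (is "?L = ?R")
    proof
      assume L: ?L
      show ?R
      proof (intro allI impI)
        fix k assume "k < Suc n"
        then show "\<omega> k \<noteq> j" using L[rule_format, of "Suc k"] by simp
      qed
    qed (auto split: nat.split)
    moreover have "(\<forall>k. k < Suc n \<longrightarrow> \<omega> k \<noteq> j) \<longleftrightarrow> \<omega> 0 \<noteq> j \<and> (\<forall>k. 1 \<le> k \<and> k < Suc n \<longrightarrow> \<omega> k \<noteq> j)"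
      by (metis One_nat_def less_one not_le zero_less_Suc)
    moreover have "\<omega> \<in> case_nat i -` ?A \<inter> space (path_space J) \<longleftrightarrow> \<omega> \<in> space (path_space J) \<and> \<omega> (Suc n) = j \<and> ?L"
      by (auto simp only: vimage_eq mem_Collect_eq Int_iff case_nat_in_path_space[OF i] nat.case)
    ultimately show ?thesis by simp blast
  qed
  have meas: "case_nat i -` ?A \<inter> space (path_space J) \<in> sets (path_space J)"
    by (rule measurable_sets[OF measurable_case_nat_path_space[OF i] sets_path_space_first_hit])
  show "measure (law l) (case_nat i -` ?A \<inter> space (path_space J)) = (if l = j then 0 else hit l j (Suc n))"
  proof (cases "l = j")
    case True
    have "measure (law l) (case_nat i -` ?A \<inter> space (path_space J)) = measure (law l) {}"
    proof (rule measure_law_start[OF l meas])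
      fix \<omega> :: "nat \<Rightarrow> nat" assume "\<omega> 0 = l"
      then have "\<not> (\<omega> \<in> ?B \<and> \<omega> 0 \<noteq> j)" using True by simp
      then show "\<omega> \<in> case_nat i -` ?A \<inter> space (path_space J) \<longleftrightarrow> \<omega> \<in> {}"
        by (simp only: mem empty_iff simp_thms)
    qed (rule sets.empty_sets)
    then show ?thesis using True by simp
  next
    case False
    have "measure (law l) (case_nat i -` ?A \<inter> space (path_space J)) = measure (law l) ?B"
      by (rule measure_law_start[OF l meas sets_path_space_first_hit]) (subst mem, use False in blast)
    then show ?thesis using False by (simp add: hit_def)
  qed
qed

lemma expectation_split_at:
  fixes g h :: "nat \<Rightarrow> real"
  assumes "\<And>l. l \<in> set_pmf p \<Longrightarrow> g l = h l + indicator {j} l * c" "\<And>l. l \<in> set_pmf p \<Longrightarrow> \<bar>h l\<bar> \<le> B"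
  shows "measure_pmf.expectation p g = measure_pmf.expectation p h + pmf p j * c"
proof -
  have "integrable (measure_pmf p) h"
    by (rule measure_pmf.integrable_const_bound[where B = B]) (use assms(2) in \<open>auto intro: AE_pmfI\<close>)
  moreover have "integrable (measure_pmf p) (\<lambda>l. indicator {j} l * c)"
    by (rule integrable_pmf_bounded[of _ "\<bar>c\<bar>"]) (auto simp: indicator_def)
  moreover have "measure_pmf.expectation p g = measure_pmf.expectation p (\<lambda>l. h l + indicator {j} l * c)"
    by (rule integral_cong_AE) (use assms(1) in \<open>auto intro: AE_pmfI\<close>)
  ultimately show ?thesis by (simp add: measure_pmf_single)
qed

text \<open>Decomposition at the first visit to \<open>j\<close>. Conditioning on the first step
  takes the place of the strong Markov property: a first step to \<open>j\<close> yields the summand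
  \<open>k = 0\<close>, and from any other state the induction hypothesis applies with the first
  visit one step later.\<close>

lemma renewal_equation:
  assumes i: "i \<in> J" and j: "j \<in> J"
  shows "pmf (iter (Suc n) i) j = (\<Sum>k\<le>n. hit i j (Suc k) * pmf (iter (n - k) j) j)"
  using i
proof (induction n arbitrary: i)
  case 0
  have "iter 0 = return_pmf" by (simp add: fun_eq_iff)
  then have "iter (Suc 0) i = step i" by (simp add: bind_return_pmf')
  then show ?case using 0 j by (simp add: hit_Suc_0)
next
  case (Suc n)
  let ?p = "\<lambda>m. pmf (iter m j) j"
  let ?h = "\<lambda>k l. if l = j then 0 else hit l j (Suc k)"
  have "pmf (iter (Suc (Suc n)) i) j = measure_pmf.expectation (step i) (\<lambda>l. pmf (iter (Suc n) l) j)"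
    by (simp only: iter.simps(2)[of "Suc n"] pmf_bind)
  also have "\<dots> = measure_pmf.expectation (step i) (\<lambda>l. \<Sum>k\<le>n. ?h k l * ?p (n - k)) + pmf (step i) j * ?p (Suc n)"
  proof (rule expectation_split_at)
    fix l assume "l \<in> set_pmf (step i)"
    then have l: "l \<in> J" using set_pmf_step[OF Suc.prems] by blast
    show "pmf (iter (Suc n) l) j = (\<Sum>k\<le>n. ?h k l * ?p (n - k)) + indicator {j} l * ?p (Suc n)"
      using Suc.IH[OF l] by (cases "l = j") simp_all
    have "\<bar>?h k l * ?p (n - k)\<bar> \<le> 1" for k
      using hit_nonneg[of l j] hit_le_1[OF l, of j] by (auto simp: abs_mult pmf_le_1 intro!: mult_le_one)
    then have "(\<Sum>k\<le>n. \<bar>?h k l * ?p (n - k)\<bar>) \<le> (\<Sum>k\<le>n. 1)"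
      by (intro sum_mono)
    then show "\<bar>\<Sum>k\<le>n. ?h k l * ?p (n - k)\<bar> \<le> real (Suc n)"
      by (intro order_trans[OF sum_abs]) simp
  qed
  also have "measure_pmf.expectation (step i) (\<lambda>l. \<Sum>k\<le>n. ?h k l * ?p (n - k))
      = (\<Sum>k\<le>n. measure_pmf.expectation (step i) (?h k) * ?p (n - k))"
  proof (subst Bochner_Integration.integral_sum)
    show "integrable (measure_pmf (step i)) (\<lambda>l. ?h k l * ?p (n - k))" for k
    proof (rule measure_pmf.integrable_const_bound[where B = 1])
      show "AE l in step i. norm (?h k l * ?p (n - k)) \<le> 1"
      proof (rule AE_pmfI)
        fix l assume "l \<in> set_pmf (step i)"
        then have l: "l \<in> J" using set_pmf_step[OF Suc.prems] by blast
        show "norm (?h k l * ?p (n - k)) \<le> 1"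
          using hit_nonneg[of l j] hit_le_1[OF l, of j] by (auto simp: abs_mult pmf_le_1 intro!: mult_le_one)
      qed
    qed simp
  qed simp
  also have "\<dots> = (\<Sum>k\<le>n. hit i j (Suc (Suc k)) * ?p (n - k))"
    by (simp add: hit_Suc_Suc[OF Suc.prems])
  also have "\<dots> + pmf (step i) j * ?p (Suc n) = (\<Sum>k\<le>Suc n. hit i j (Suc k) * ?p (Suc n - k))"
    by (subst sum.atMost_Suc_shift) (simp add: hit_Suc_0[OF Suc.prems j])
  finally show ?case .
qed

text \<open>The event of a visit is split disjointly by the time of the first visit.\<close>

lemma hit_sums_ever_hit:
  assumes i: "i \<in> J"
  shows "hit i j sums ever_hit i j"
proof -
  interpret prob_space "law i" by (rule prob_space_law[OF i])
  let ?A = "\<lambda>n. {\<omega> \<in> space (path_space J). 1 \<le> n \<and> \<omega> n = j \<and> (\<forall>k. 1 \<le> k \<and> k < n \<longrightarrow> \<omega> k \<noteq> j)}"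
  have "(\<lambda>n. measure (law i) (?A n)) sums measure (law i) (\<Union>n. ?A n)"
  proof (rule finite_measure_UNION)
    show "range ?A \<subseteq> sets (law i)" using sets_path_space_first_hit by (auto simp: sets_law[OF i])
    have lt: "?A m \<inter> ?A n = {}" if "m < n" for m n
      using that by auto
    have "?A m \<inter> ?A n = {}" if "m \<noteq> n" for m n
      by (rule linorder_cases[of m n]) (use that lt[of m n] lt[of n m] in blast)+
    then show "disjoint_family ?A"
      unfolding disjoint_family_on_def by blast
  qed
  moreover have "(\<Union>n. ?A n) = {\<omega> \<in> space (path_space J). \<exists>n\<ge>1. \<omega> n = j}"
  proof (intro set_eqI iffI)
    fix \<omega> assume *: "\<omega> \<in> {\<omega> \<in> space (path_space J). \<exists>n\<ge>1. \<omega> n = j}"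
    let ?n = "LEAST n. 1 \<le> n \<and> \<omega> n = j"
    have "1 \<le> ?n \<and> \<omega> ?n = j" by (rule LeastI_ex) (use * in blast)
    moreover have "\<omega> k \<noteq> j" if "1 \<le> k" "k < ?n" for k
      using not_less_Least[OF that(2)] that(1) by blast
    ultimately have "\<omega> \<in> ?A ?n" using * by blast
    then show "\<omega> \<in> (\<Union>n. ?A n)" by blast
  qed auto
  ultimately show ?thesis by (simp add: hit_def[abs_def] ever_hit_def)
qed

section \<open>Hitting probabilities as harmonic functions\<close>

lemma sets_path_space_ever_hit:
  "{\<omega> \<in> space (path_space J). \<exists>n\<ge>1. \<omega> n = j} \<in> sets (path_space J)"
  by measurable

text \<open>First-step analysis; the value 1 at \<open>j\<close> records that arriving there is a
  visit, whether or not the path ever comes back.\<close>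

lemma ever_hit_harmonic:
  assumes i: "i \<in> J"
  shows "ever_hit i j = measure_pmf.expectation (step i) (\<lambda>l. if l = j then 1 else ever_hit l j)"
  unfolding ever_hit_def[of i]
proof (rule measure_law_one_step[OF i sets_path_space_ever_hit])
  fix l assume l: "l \<in> J"
  interpret prob_space "law l" by (rule prob_space_law[OF l])
  let ?A = "{\<omega> \<in> space (path_space J). \<exists>n\<ge>1. \<omega> n = j}"
  have mem: "\<omega> \<in> case_nat i -` ?A \<inter> space (path_space J) \<longleftrightarrow> \<omega> \<in> space (path_space J) \<and> (\<omega> 0 = j \<or> \<omega> \<in> ?A)" for \<omega>
  proof -
    have "(\<exists>n\<ge>1. case_nat i \<omega> n = j) \<longleftrightarrow> (\<exists>n. \<omega> n = j)"
      by (metis One_nat_def Suc_le_D nat.case(2) not_less_eq_eq zero_le)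
    also have "\<dots> \<longleftrightarrow> \<omega> 0 = j \<or> (\<exists>n\<ge>1. \<omega> n = j)"
      by (metis One_nat_def Suc_leI neq0_conv)
    finally have "(\<exists>n\<ge>1. case_nat i \<omega> n = j) \<longleftrightarrow> \<omega> 0 = j \<or> (\<exists>n\<ge>1. \<omega> n = j)" .
    moreover have "\<omega> \<in> case_nat i -` ?A \<inter> space (path_space J) \<longleftrightarrow> \<omega> \<in> space (path_space J) \<and> (\<exists>n\<ge>1. case_nat i \<omega> n = j)"
      by (auto simp only: vimage_eq mem_Collect_eq Int_iff case_nat_in_path_space[OF i] nat.case)
    ultimately show ?thesis by (simp only: mem_Collect_eq) blast
  qed
  have meas: "case_nat i -` ?A \<inter> space (path_space J) \<in> sets (path_space J)"
    by (rule measurable_sets[OF measurable_case_nat_path_space[OF i] sets_path_space_ever_hit])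
  show "measure (law l) (case_nat i -` ?A \<inter> space (path_space J)) = (if l = j then 1 else ever_hit l j)"
  proof (cases "l = j")
    case True
    have "measure (law l) (case_nat i -` ?A \<inter> space (path_space J)) = measure (law l) (space (path_space J))"
      by (rule measure_law_start[OF l meas]) (simp, subst mem, use True in blast)
    also have "\<dots> = 1"
      using prob_space by (simp add: space_law[OF l])
    finally show ?thesis using True by simp
  next
    case False
    have "measure (law l) (case_nat i -` ?A \<inter> space (path_space J)) = measure (law l) ?A"
      by (rule measure_law_start[OF l meas sets_path_space_ever_hit]) (subst mem, use False in blast)
    then show ?thesis using False by (simp add: ever_hit_def)
  qed
qed

lemma ever_hit_eq_return_prob: "j \<in> J \<Longrightarrow> ever_hit j j = return_prob J P j"
  by (simp add: ever_hit_def return_prob_def space_law)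

lemma expectation_pmf_eq_1D:
  fixes h :: "'a \<Rightarrow> real"
  assumes "measure_pmf.expectation p h = 1" "\<And>l. l \<in> set_pmf p \<Longrightarrow> 0 \<le> h l \<and> h l \<le> 1" "l \<in> set_pmf p"
  shows "h l = 1"
proof -
  have int: "integrable (measure_pmf p) h"
    by (rule measure_pmf.integrable_const_bound[where B = 1]) (use assms(2) in \<open>auto intro: AE_pmfI\<close>)
  have "measure_pmf.expectation p (\<lambda>l. 1 - h l) = 0"
    using int assms(1) by simp
  then have "AE l in measure_pmf p. 1 - h l = 0"
    by (subst (asm) integral_nonneg_eq_0_iff_AE) (use int assms(2) in \<open>auto intro: AE_pmfI\<close>)
  then show ?thesis using assms(3) by (simp add: AE_measure_pmf_iff)
qed

lemma ever_hit_eq_1_step: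
  assumes j: "j \<in> J" "return_prob J P j = 1" and i: "i \<in> J" "ever_hit i j = 1" and l: "l \<in> set_pmf (step i)"
  shows "ever_hit l j = 1"
proof -
  have "(if l = j then 1 else ever_hit l j) = 1"
  proof (rule expectation_pmf_eq_1D[OF _ _ l, of "\<lambda>l. if l = j then 1 else ever_hit l j"])
    show "measure_pmf.expectation (step i) (\<lambda>l. if l = j then 1 else ever_hit l j) = 1"
      using ever_hit_harmonic[OF i(1), of j] i(2) by simp
    show "0 \<le> (if m = j then 1 else ever_hit m j) \<and> (if m = j then 1 else ever_hit m j) \<le> 1"
      if "m \<in> set_pmf (step i)" for m
      using that set_pmf_step[OF i(1)] measure_law_le_1[of m] by (auto simp: ever_hit_def)
  qed
  \<comment> \<open>Recurrence of \<open>j\<close> makes the exceptional value at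
    \<open>l = j\<close> agree with \<open>ever_hit j j\<close>.\<close>
  then show ?thesis using ever_hit_eq_return_prob[OF j(1)] j(2) by (auto split: if_splits)
qed

lemma ever_hit_eq_1_iter:
  assumes j: "j \<in> J" "return_prob J P j = 1" and i: "i \<in> J" "ever_hit i j = 1" and l: "l \<in> set_pmf (iter n i)"
  shows "ever_hit l j = 1"
  using i l
proof (induction n arbitrary: i)
  case (Suc n)
  then obtain m where m: "m \<in> set_pmf (step i)" "l \<in> set_pmf (iter n m)" by auto
  have "m \<in> J" using set_pmf_step[OF Suc.prems(1)] m(1) by blast
  then show ?case
    using Suc.IH m(2) ever_hit_eq_1_step[OF j Suc.prems(1,2) m(1)] by blast
qed simp

end

section \<open>Convergence of recurrent chains\<close>

locale recurrent_chain = stochastic_matrix +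
  assumes irreducible: "irreducible_chain J P"
    and aperiodic: "aperiodic_chain J P"
    and recurrent: "\<And>i. i \<in> J \<Longrightarrow> return_prob J P i = 1"
begin

definition tail :: "nat \<Rightarrow> nat \<Rightarrow> real" where
  "tail j k = 1 - (\<Sum>n\<le>k. hit j j n)"

text \<open>\<open>tail j k\<close> is the probability that the first return takes longer than \<open>k\<close>, so
  \<open>suminf (tail j)\<close> is the mean return time.\<close>

definition limit :: "nat \<Rightarrow> real" where
  "limit j = (if j \<in> J \<and> summable (tail j) then 1 / suminf (tail j) else 0)"

lemma renewal_equation':
  assumes "i \<in> J" "j \<in> J" "1 \<le> n"
  shows "pmf (iter n i) j = (\<Sum>k\<le>n. hit i j k * pmf (iter (n - k) j) j)"
proof -
  obtain m where m: "n = Suc m" using assms(3) by (cases n) auto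
  show ?thesis
    unfolding m renewal_equation[OF assms(1,2)] by (subst sum.atMost_Suc_shift) (simp add: hit_0)
qed

text \<open>Since \<open>ever_hit j j = 1\<close>, the function \<open>\<lambda>i. ever_hit i j\<close> is harmonic with values in
  \<open>[0, 1]\<close>, and the value \<open>1\<close> at \<open>j\<close> spreads to every state reachable from \<open>j\<close>.\<close>

lemma ever_hit_eq_1:
  assumes i: "i \<in> J" and j: "j \<in> J"
  shows "ever_hit i j = 1"
proof -
  obtain n where "matrix_power J P n j i > 0"
    using irreducible i j unfolding irreducible_chain_def by blast
  then have "i \<in> set_pmf (iter n j)"
    by (simp add: matrix_power_eq_pmf[OF j] set_pmf_iff)
  then show ?thesis
    using ever_hit_eq_1_iter[OF j recurrent[OF j] j _ ] ever_hit_eq_return_prob[OF j] recurrent[OF j] by simp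
qed

lemma iter_diagonal_tendsto:
  assumes j: "j \<in> J"
  shows "(\<lambda>n. pmf (iter n j) j) \<longlonglongrightarrow> limit j"
proof -
  have "Gcd {n. 1 \<le> n \<and> pmf (iter n j) j > 0} = 1"
    using aperiodic j unfolding aperiodic_chain_def by (simp add: matrix_power_eq_pmf)
  note renewal = renewal_limit[of "hit j j" "\<lambda>n. pmf (iter n j) j", OF hit_0 hit_nonneg _ _ _ this]
  have tail: "tail j = (\<lambda>k. 1 - (\<Sum>n\<le>k. hit j j n))" by (simp add: tail_def[abs_def])
  have "hit j j sums 1"
    using hit_sums_ever_hit[OF j, of j] by (simp add: ever_hit_eq_1[OF j j])
  then show ?thesis
    using renewal renewal_equation'[OF j j] j unfolding limit_def tail by auto
qed

text \<open>The renewal equation writes the left side as a convolution of \<open>hit i j\<close>,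
  which has total mass 1 by recurrence, with the diagonal sequence. The starting state is therefore
  forgotten.\<close>

theorem iter_tendsto:
  assumes i: "i \<in> J"
  shows "(\<lambda>n. pmf (iter n i) j) \<longlonglongrightarrow> limit j"
proof (cases "j \<in> J")
  case True
  have sums: "hit i j sums 1"
    using hit_sums_ever_hit[OF i, of j] by (simp add: ever_hit_eq_1[OF i True])
  have "(\<lambda>n. \<Sum>k\<le>n. hit i j k * pmf (iter (n - k) j) j) \<longlonglongrightarrow> suminf (hit i j) * limit j"
    by (rule convolution_tendsto[where B = 1])
       (auto simp: hit_nonneg sums_summable[OF sums] iter_diagonal_tendsto[OF True] pmf_le_1)
  then have lim: "(\<lambda>n. \<Sum>k\<le>n. hit i j k * pmf (iter (n - k) j) j) \<longlonglongrightarrow> limit j"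
    using sums_unique[OF sums] by simp
  show ?thesis
    by (rule Lim_transform_eventually[OF lim])
       (use renewal_equation'[OF i True] in \<open>auto simp: eventually_sequentially intro!: exI[of _ 1]\<close>)
next
  case False
  then have "pmf (iter n i) j = 0" for n
    using set_pmf_iter[OF i, of n] by (auto simp: set_pmf_iff)
  then show ?thesis using False by (simp add: limit_def)
qed

lemma lim_matrix_power: "j \<in> J \<Longrightarrow> lim (\<lambda>k. matrix_power J P k j j) = limit j"
  by (rule limI) (simp add: matrix_power_eq_pmf iter_diagonal_tendsto)

lemma limit_bounds:
  assumes "J \<noteq> {}"
  shows "0 \<le> limit j" "limit j \<le> 1"
proof -
  obtain i where "i \<in> J" using assms by blast
  from iter_tendsto[OF this, of j] show "0 \<le> limit j" "limit j \<le> 1"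
    by (auto intro: LIMSEQ_le_const LIMSEQ_le_const2 simp: pmf_le_1)
qed

text \<open>Fatou's lemma for counting measure, applied to the mass functions of
  \<open>iter n i\<close>.\<close>

lemma nn_integral_limit_le_liminf:
  assumes i: "i \<in> J"
  shows "(\<integral>\<^sup>+k. ennreal (limit k) * g k \<partial>count_space UNIV) \<le> liminf (\<lambda>n. \<integral>\<^sup>+k. g k \<partial>measure_pmf (iter n i))"
proof -
  have "(\<integral>\<^sup>+k. ennreal (limit k) * g k \<partial>count_space UNIV)
      \<le> (\<integral>\<^sup>+k. liminf (\<lambda>n. ennreal (pmf (iter n i) k) * g k) \<partial>count_space UNIV)"
  proof (rule nn_integral_mono)
    fix k
    have lim: "(\<lambda>n. ennreal (pmf (iter n i) k)) \<longlonglongrightarrow> ennreal (limit k)"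
      by (intro tendsto_ennrealI iter_tendsto i)
    have l0: "0 \<le> limit k" using limit_bounds(1) i by blast
    show "ennreal (limit k) * g k \<le> liminf (\<lambda>n. ennreal (pmf (iter n i) k) * g k)"
    \<comment> \<open>Multiplication is discontinuous at the pair of 0 and \<infinity>; in that case
      the left side is 0.\<close>
    proof (cases "g k = \<infinity> \<and> limit k = 0")
      case False
      have "(\<lambda>n. ennreal (pmf (iter n i) k) * g k) \<longlonglongrightarrow> ennreal (limit k) * g k"
        using False l0
        by (intro tendsto_mult_ennreal lim tendsto_const) (auto simp: ennreal_eq_0_iff)
      then show ?thesis by (simp add: lim_imp_Liminf)
    qed simp
  qed
  also have "\<dots> \<le> liminf (\<lambda>n. \<integral>\<^sup>+k. ennreal (pmf (iter n i) k) * g k \<partial>count_space UNIV)"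
    by (rule nn_integral_liminf) simp
  finally show ?thesis by (simp add: nn_integral_measure_pmf)
qed

lemma expectation_tendsto_finite_support:
  fixes g :: "nat \<Rightarrow> real"
  assumes i: "i \<in> J" and g: "\<And>k. 0 \<le> g k" "\<And>k. k > N \<Longrightarrow> g k = 0"
  shows "(\<lambda>n. \<integral>\<^sup>+k. ennreal (g k) \<partial>measure_pmf (iter n i)) \<longlonglongrightarrow> (\<integral>\<^sup>+k. ennreal (limit k) * ennreal (g k) \<partial>count_space UNIV)"
proof -
  have fin: "(\<integral>\<^sup>+k. ennreal (h k) * ennreal (g k) \<partial>count_space UNIV) = (\<Sum>k\<le>N. ennreal (h k) * ennreal (g k))" for h
  proof -
    have "(\<integral>\<^sup>+k. ennreal (h k) * ennreal (g k) \<partial>count_space UNIV) = (\<integral>\<^sup>+k. ennreal (h k) * ennreal (g k) \<partial>count_space {..N})"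
      by (rule nn_integral_count_space_eq) (auto simp: g(2) not_le)
    then show ?thesis by (simp add: nn_integral_count_space_finite)
  qed
  show ?thesis
    unfolding nn_integral_measure_pmf fin
    by (intro tendsto_sum tendsto_mult_ennreal tendsto_ennrealI iter_tendsto i tendsto_const) auto
qed


section \<open>Mean return times and positivity of the limits\<close>

lemma tail_nonneg: "j \<in> J \<Longrightarrow> 0 \<le> tail j k"
proof -
  assume j: "j \<in> J"
  have sums: "hit j j sums 1"
    using hit_sums_ever_hit[OF j, of j] by (simp add: ever_hit_eq_1[OF j j])
  have "(\<Sum>n\<le>k. hit j j n) \<le> suminf (hit j j)"
    by (rule sum_le_suminf[OF sums_summable[OF sums]]) (simp_all add: hit_nonneg)
  then show ?thesis by (simp add: tail_def sums_unique[OF sums, symmetric])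
qed

text \<open>A path that visits \<open>j\<close> by time \<open>k\<close> has its first visit at some
  \<open>n \<le> k\<close>; take complements.\<close>

lemma tail_le_measure:
  assumes j: "j \<in> J"
  shows "tail j k \<le> measure (law j) {\<omega> \<in> space (path_space J). \<forall>m. 1 \<le> m \<and> m \<le> k \<longrightarrow> \<omega> m \<noteq> j}"
proof -
  interpret prob_space "law j" by (rule prob_space_law[OF j])
  let ?A = "\<lambda>n. {\<omega> \<in> space (path_space J). 1 \<le> n \<and> \<omega> n = j \<and> (\<forall>k. 1 \<le> k \<and> k < n \<longrightarrow> \<omega> k \<noteq> j)}"
  let ?N = "{\<omega> \<in> space (path_space J). \<forall>m. 1 \<le> m \<and> m \<le> k \<longrightarrow> \<omega> m \<noteq> j}"
  have A: "?A n \<in> events" for n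
    using sets_path_space_first_hit by (simp add: sets_law[OF j])
  have N: "?N \<in> events"
    unfolding sets_law[OF j] by measurable
  have sub: "space (law j) - ?N \<subseteq> (\<Union>n\<in>{..k}. ?A n)"
  proof
    fix \<omega> assume "\<omega> \<in> space (law j) - ?N"
    then have sp: "\<omega> \<in> space (path_space J)" and ex: "\<exists>m. 1 \<le> m \<and> \<omega> m = j \<and> m \<le> k"
      by (auto simp: space_law[OF j])
    from ex obtain m where m: "1 \<le> m \<and> \<omega> m = j" "m \<le> k" by blast
    let ?n = "LEAST n. 1 \<le> n \<and> \<omega> n = j"
    have "1 \<le> ?n \<and> \<omega> ?n = j" by (rule LeastI) (rule m(1))
    moreover have "\<omega> k \<noteq> j" if "1 \<le> k" "k < ?n" for k
      using not_less_Least[OF that(2)] that(1) by blast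
    moreover have "?n \<le> k" using Least_le[of "\<lambda>n. 1 \<le> n \<and> \<omega> n = j", OF m(1)] m(2) by linarith
    ultimately show "\<omega> \<in> (\<Union>n\<in>{..k}. ?A n)" using sp by blast
  qed
  have "prob (space (law j) - ?N) \<le> prob (\<Union>n\<in>{..k}. ?A n)"
    by (rule finite_measure_mono[OF sub]) (rule sets.finite_UN[OF finite_atMost A])
  also have "\<dots> \<le> (\<Sum>n\<le>k. hit j j n)"
    unfolding hit_def by (rule finite_measure_subadditive_finite) (simp, use A in blast)
  finally show ?thesis
    using prob_compl[OF N] by (simp add: tail_def)
qed

text \<open>The number of \<open>k\<close> for which the path has not returned by time
  \<open>k\<close> is at most the return time. Integration bounds the partial sums of
  \<open>tail j\<close> by the mean return time.\<close>

lemma summable_tail: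
  assumes j: "j \<in> J" and mean: "mean_return_time J P j < \<infinity>"
  shows "summable (tail j)"
proof (rule bounded_imp_summable)
  interpret prob_space "law j" by (rule prob_space_law[OF j])
  let ?N = "\<lambda>k. {\<omega> \<in> space (path_space J). \<forall>m. 1 \<le> m \<and> m \<le> k \<longrightarrow> \<omega> m \<noteq> j}"
  have N: "?N k \<in> events" for k
    unfolding sets_law[OF j] by measurable
  fix K
  have "ennreal (\<Sum>k\<le>K. tail j k) = (\<Sum>k\<le>K. ennreal (tail j k))"
    by (rule sum_ennreal[symmetric]) (rule tail_nonneg[OF j])
  also have "\<dots> \<le> (\<Sum>k\<le>K. emeasure (law j) (?N k))"
    by (intro sum_mono) (simp only: emeasure_eq_measure ennreal_leI tail_le_measure[OF j])
  also have "\<dots> = (\<Sum>k\<le>K. \<integral>\<^sup>+\<omega>. indicator (?N k) \<omega> \<partial>law j)"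
    by (rule sum.cong[OF refl], rule nn_integral_indicator[symmetric], rule N)
  also have "\<dots> = (\<integral>\<^sup>+\<omega>. (\<Sum>k\<le>K. indicator (?N k) \<omega>) \<partial>law j)"
    by (rule nn_integral_sum[symmetric]) (rule borel_measurable_indicator[OF N])
  also have "\<dots> \<le> (\<integral>\<^sup>+\<omega>. return_time j \<omega> \<partial>law j)"
  proof (rule nn_integral_mono)
    fix \<omega>
    show "(\<Sum>k\<le>K. indicator (?N k) \<omega>) \<le> return_time j \<omega>"
      unfolding return_time_def
    proof (rule INF_greatest)
      fix n assume n: "n \<in> {n. 1 \<le> n \<and> \<omega> n = j}"
      have "(\<Sum>k\<le>K. indicator (?N k) \<omega> :: ennreal) \<le> (\<Sum>k\<le>K. if k \<in> {..<n} then 1 else 0)"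
      proof (rule sum_mono)
        fix k
        show "(indicator (?N k) \<omega> :: ennreal) \<le> (if k \<in> {..<n} then 1 else 0)"
        proof (cases "k < n")
          case False
          with n have "1 \<le> n \<and> n \<le> k" "\<omega> n = j" by simp_all
          then have "\<omega> \<notin> ?N k" by blast
          then have "indicator (?N k) \<omega> = (0::ennreal)" by (rule indicator_simps(2))
          then show ?thesis by (simp only: zero_le)
        qed (auto simp: indicator_def)
      qed
      also have "\<dots> = of_nat (card ({..K} \<inter> {..<n}))"
        unfolding sum.inter_restrict[OF finite_atMost, symmetric] by simp
      also have "\<dots> \<le> of_nat n"
        using card_mono[of "{..<n}" "{..K} \<inter> {..<n}"] by (simp add: of_nat_mono)
      finally show "(\<Sum>k\<le>K. indicator (?N k) \<omega> :: ennreal) \<le> of_nat n" .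
    qed
  qed
  also have "\<dots> = ennreal (enn2real (mean_return_time J P j))"
    using mean by (simp add: mean_return_time_def)
  finally show "(\<Sum>k\<le>K. tail j k) \<le> enn2real (mean_return_time J P j)"
    using ennreal_le_iff[OF enn2real_nonneg] by blast
qed (rule tail_nonneg[OF j])

lemma limit_pos:
  assumes j: "j \<in> J" and mean: "mean_return_time J P j < \<infinity>"
  shows "0 < limit j"
proof -
  note s = summable_tail[OF j mean]
  have "0 < tail j 0" by (simp add: tail_def hit_0)
  then have "0 < suminf (tail j)"
    using suminf_pos2[OF s tail_nonneg[OF j]] by blast
  then show ?thesis using j s by (simp add: limit_def)
qed

section \<open>The limits as a stationary distribution\<close>

lemma nn_integral_limit_le_1:
  assumes "J \<noteq> {}"
  shows "(\<integral>\<^sup>+k. ennreal (limit k) \<partial>count_space UNIV) \<le> 1"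
proof -
  obtain i where "i \<in> J" using assms by blast
  from nn_integral_limit_le_liminf[OF this, of "\<lambda>_. 1"] show ?thesis by (simp add: Liminf_const)
qed

text \<open>Fatou's lemma gives only \<open>\<le>\<close>, but summed over \<open>j\<close> both sides have the same finite mass.\<close>

lemma limit_stationary:
  assumes i: "i \<in> J"
  shows "(\<integral>\<^sup>+k. ennreal (limit k) * ennreal (pmf (iter m k) j) \<partial>count_space UNIV) = ennreal (limit j)"
proof -
  let ?a = "\<lambda>j. \<integral>\<^sup>+k. ennreal (limit k) * ennreal (pmf (iter m k) j) \<partial>count_space UNIV"
  have le: "?a j \<le> ennreal (limit j)" for j
  proof -
    have "?a j \<le> liminf (\<lambda>n. \<integral>\<^sup>+k. ennreal (pmf (iter m k) j) \<partial>measure_pmf (iter n i))"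
      by (rule nn_integral_limit_le_liminf[OF i])
    also have "\<dots> = liminf (\<lambda>n. ennreal (pmf (iter (n + m) i) j))"
      by (simp add: iter_add ennreal_pmf_bind)
    also have "\<dots> = ennreal (limit j)"
      by (intro lim_imp_Liminf tendsto_ennrealI LIMSEQ_ignore_initial_segment iter_tendsto i) simp
    finally show ?thesis .
  qed
  have S: "(\<integral>\<^sup>+k. ennreal (limit k) \<partial>count_space UNIV) \<noteq> \<infinity>"
    using nn_integral_limit_le_1 i by (metis empty_iff ennreal_one_neq_top infinity_ennreal_def top.extremum_unique)
  have "(\<integral>\<^sup>+j. ?a j \<partial>count_space UNIV) = (\<integral>\<^sup>+k. \<integral>\<^sup>+j. ennreal (limit k) * ennreal (pmf (iter m k) j) \<partial>count_space UNIV \<partial>count_space UNIV)"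
    using nn_integral_fst_count_space[of "\<lambda>(k, j). ennreal (limit k) * ennreal (pmf (iter m k) j)"]
      nn_integral_snd_count_space[of "\<lambda>(k, j). ennreal (limit k) * ennreal (pmf (iter m k) j)"]
    by simp
  also have "\<dots> = (\<integral>\<^sup>+k. ennreal (limit k) \<partial>count_space UNIV)"
    by (simp add: nn_integral_cmult nn_integral_pmf)
  finally have eq: "(\<integral>\<^sup>+j. ?a j \<partial>count_space UNIV) = (\<integral>\<^sup>+k. ennreal (limit k) \<partial>count_space UNIV)" .
  have "(\<integral>\<^sup>+j. ennreal (limit j) - ?a j \<partial>count_space UNIV) = 0"
    using S by (subst nn_integral_diff) (auto simp: eq le diff_eq_0_ennreal less_top)
  then have "ennreal (limit j) - ?a j = 0"
    by (subst (asm) nn_integral_0_iff_AE) (auto simp: AE_count_space)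
  then have "ennreal (limit j) \<le> ?a j"
    by (simp add: diff_eq_0_iff_ennreal)
  with le show ?thesis by (rule order.antisym)
qed

text \<open>As \<open>m\<close> tends to infinity in \<open>limit_stationary\<close>,
  \<open>pmf (iter m k) j\<close> becomes \<open>limit j\<close> for each \<open>k\<close> in
  \<open>J\<close>. So \<open>limit j\<close> equals itself times the total mass, and positivity
  permits cancelling.\<close>

lemma nn_integral_limit_eq_1:
  assumes j: "j \<in> J" and pos: "0 < limit j"
  shows "(\<integral>\<^sup>+k. ennreal (limit k) \<partial>count_space UNIV) = 1"
proof -
  let ?S = "\<integral>\<^sup>+k. ennreal (limit k) \<partial>count_space UNIV"
  have S: "?S < \<infinity>"
    using nn_integral_limit_le_1 j by (metis empty_iff ennreal_one_less_top infinity_ennreal_def order.strict_trans1)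
  have l1: "ennreal (limit k) * ennreal (pmf p j) \<le> ennreal (limit k)" for k p
    by (rule order_trans[OF mult_left_mono[of _ 1]]) (auto simp: pmf_le_1 ennreal_le_1)
  have "(\<lambda>m. \<integral>\<^sup>+k. ennreal (limit k) * ennreal (pmf (iter m k) j) \<partial>count_space UNIV)
      \<longlonglongrightarrow> (\<integral>\<^sup>+k. ennreal (limit k) * ennreal (limit j) \<partial>count_space UNIV)"
  proof (rule nn_integral_dominated_convergence[where w = "\<lambda>k. ennreal (limit k)"])
    show "AE k in count_space UNIV. (\<lambda>m. ennreal (limit k) * ennreal (pmf (iter m k) j)) \<longlonglongrightarrow> ennreal (limit k) * ennreal (limit j)"
    proof (rule AE_I2)
      fix k
      show "(\<lambda>m. ennreal (limit k) * ennreal (pmf (iter m k) j)) \<longlonglongrightarrow> ennreal (limit k) * ennreal (limit j)"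
      proof (cases "k \<in> J")
        case True
        then show ?thesis
          by (intro tendsto_mult_ennreal tendsto_const tendsto_ennrealI iter_tendsto) auto
      qed (simp add: limit_def)
    qed
  qed (use S l1 in auto)
  then have "ennreal (limit j) = (\<integral>\<^sup>+k. ennreal (limit k) * ennreal (limit j) \<partial>count_space UNIV)"
    by (simp add: limit_stationary[OF j] LIMSEQ_const_iff)
  also have "\<dots> = ?S * ennreal (limit j)"
    by (simp add: nn_integral_multc)
  finally have "ennreal (limit j) = ?S * ennreal (limit j)" .
  moreover obtain s where s: "?S = ennreal s" "s \<ge> 0"
    using S by (cases ?S) auto
  ultimately have "ennreal (limit j) = ennreal (s * limit j)"
    using pos by (simp add: ennreal_mult)
  then have "s = 1" using pos s(2) by simp
  then show ?thesis using s by simp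
qed

section \<open>Convergence of expectations of bounded functions\<close>

lemma expectation_eventually_greater:
  fixes g :: "nat \<Rightarrow> real"
  assumes i: "i \<in> J" and g: "\<And>k. 0 \<le> g k" "\<And>k. g k \<le> 1"
    and r: "(\<integral>\<^sup>+k. ennreal (limit k) * ennreal (g k) \<partial>count_space UNIV) = ennreal r" and l: "l < r"
  shows "eventually (\<lambda>n. l < measure_pmf.expectation (iter n i) g) sequentially"
proof (cases "l < 0")
  \<comment> \<open>The embedding into \<open>ennreal\<close> sends negative numbers to 0, so
    negative \<open>l\<close> are treated apart.\<close>
  case True
  have "0 \<le> measure_pmf.expectation (iter n i) g" for n
    using g(1) by simp
  then show ?thesis using True by (intro always_eventually allI) (rule less_le_trans)
next
  case False
  have "ennreal l < ennreal r" using False l by (simp add: ennreal_less_iff)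
  also have "\<dots> \<le> liminf (\<lambda>n. \<integral>\<^sup>+k. ennreal (g k) \<partial>measure_pmf (iter n i))"
    unfolding r[symmetric] by (rule nn_integral_limit_le_liminf[OF i])
  finally have "eventually (\<lambda>n. ennreal l < (\<integral>\<^sup>+k. ennreal (g k) \<partial>measure_pmf (iter n i))) sequentially"
    by (rule less_LiminfD)
  then show ?thesis
  proof eventually_elim
    case (elim n)
    have "(\<integral>\<^sup>+k. ennreal (g k) \<partial>measure_pmf (iter n i)) = ennreal (measure_pmf.expectation (iter n i) g)"
      by (rule nn_integral_eq_integral) (use g in \<open>auto intro: integrable_pmf_bounded[of _ 1]\<close>)
    then show ?case using elim False by (simp add: ennreal_less_iff)
  qed
qed

theorem expectation_tendsto_positive_recurrent:
  fixes g :: "nat \<Rightarrow> real"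
  assumes i: "i \<in> J" and g: "\<And>k. 0 \<le> g k" "\<And>k. g k \<le> 1"
    and pos: "positive_recurrent_chain J P"
  shows "(\<lambda>n. \<integral>\<^sup>+k. ennreal (g k) \<partial>measure_pmf (iter n i)) \<longlonglongrightarrow> (\<integral>\<^sup>+k. ennreal (limit k) * ennreal (g k) \<partial>count_space UNIV)"
proof -
  let ?G = "\<lambda>g. \<integral>\<^sup>+k. ennreal (limit k) * ennreal (g k) \<partial>count_space UNIV"
  have "0 < limit i"
    using pos i by (intro limit_pos) (auto simp: positive_recurrent_chain_def)
  then have one: "(\<integral>\<^sup>+k. ennreal (limit k) \<partial>count_space UNIV) = 1"
    by (rule nn_integral_limit_eq_1[OF i])
  have "?G g + ?G (\<lambda>k. 1 - g k) = (\<integral>\<^sup>+k. ennreal (limit k) * (ennreal (g k) + ennreal (1 - g k)) \<partial>count_space UNIV)"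
    by (subst nn_integral_add[symmetric]) (simp_all add: distrib_left)
  also have "\<dots> = 1"
    using g by (simp add: ennreal_plus[symmetric] one del: ennreal_plus)
  finally have sum: "?G g + ?G (\<lambda>k. 1 - g k) = 1" .
  obtain r where r: "?G g = ennreal r" "0 \<le> r"
    using sum by (cases "?G g") auto
  obtain r' where r': "?G (\<lambda>k. 1 - g k) = ennreal r'" "0 \<le> r'"
    using sum by (cases "?G (\<lambda>k. 1 - g k)") auto
  have "ennreal (r + r') = 1" using sum r r' by (simp add: ennreal_plus)
  then have rr: "r' = 1 - r" by simp
  have "(\<lambda>n. measure_pmf.expectation (iter n i) g) \<longlonglongrightarrow> r"
    unfolding order_tendsto_iff
  proof (intro conjI allI impI)
    fix l assume "l < r"
    then show "eventually (\<lambda>n. l < measure_pmf.expectation (iter n i) g) sequentially"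
      by (rule expectation_eventually_greater[OF i g r(1)])
  next
    fix l assume "r < l"
    \<comment> \<open>A lower bound for the expectation of \<open>1 - g\<close> is an upper bound
      for that of \<open>g\<close>, and the two limiting integrals add up to 1.\<close>
    then have "eventually (\<lambda>n. 1 - l < measure_pmf.expectation (iter n i) (\<lambda>k. 1 - g k)) sequentially"
      using g by (intro expectation_eventually_greater[OF i _ _ r'(1)]) (auto simp: rr)
    then show "eventually (\<lambda>n. measure_pmf.expectation (iter n i) g < l) sequentially"
    proof eventually_elim
      case (elim n)
      have "integrable (measure_pmf (iter n i)) g"
        using g by (intro integrable_pmf_bounded[of _ 1]) auto
      then show ?case using elim by simp
    qed
  qed
  then have "(\<lambda>n. ennreal (measure_pmf.expectation (iter n i) g)) \<longlonglongrightarrow> ennreal r"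
    by (rule tendsto_ennrealI)
  moreover have "(\<integral>\<^sup>+k. ennreal (g k) \<partial>measure_pmf (iter n i)) = ennreal (measure_pmf.expectation (iter n i) g)" for n
    by (rule nn_integral_eq_integral) (use g in \<open>auto intro: integrable_pmf_bounded[of _ 1]\<close>)
  ultimately show ?thesis by (simp add: r)
qed

end

section \<open>Sequences of asymptotically independent sets\<close>

text \<open>The error bound holds for all \<open>n\<close> at once, so the limits may be
  interchanged; three errors of \<open>r / 4\<close> stay below \<open>r\<close>.\<close>

lemma tendsto_uniform_approx:
  fixes a :: "nat \<Rightarrow> real"
  assumes "\<And>\<epsilon>. \<epsilon> > 0 \<Longrightarrow> \<exists>b M. b \<longlonglongrightarrow> M \<and> (\<forall>n. \<bar>a n - b n\<bar> \<le> \<epsilon>) \<and> \<bar>L - M\<bar> \<le> \<epsilon>"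
  shows "a \<longlonglongrightarrow> L"
proof (rule LIMSEQ_I)
  fix r :: real assume "0 < r"
  then have r: "r / 4 > 0" by simp
  obtain b M where b: "b \<longlonglongrightarrow> M" "\<And>n. \<bar>a n - b n\<bar> \<le> r / 4" "\<bar>L - M\<bar> \<le> r / 4"
    using assms[OF r] by blast
  obtain no where no: "\<And>n. n \<ge> no \<Longrightarrow> norm (b n - M) < r / 4"
    using LIMSEQ_D[OF b(1) r] by blast
  have "norm (a n - L) < r" if "n \<ge> no" for n
    using no[OF that] b(2)[of n] b(3) \<open>0 < r\<close> unfolding real_norm_def by linarith
  then show "\<exists>no. \<forall>n\<ge>no. norm (a n - L) < r" by blast
qed

section \<open>Closure properties of the class of mixing sets\<close>

lemma measure_le_add_Diff:
  assumes "A \<in> fmeasurable M" "B \<in> fmeasurable M"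
  shows "measure M A \<le> measure M B + measure M (sym_diff A B)"
proof -
  have "measure M A \<le> measure M (B \<union> sym_diff A B)"
    using assms by (intro measure_mono_fmeasurable) (auto intro!: fmeasurable.Un fmeasurable.Diff)
  also have "\<dots> \<le> measure M B + measure M (sym_diff A B)"
    using assms by (intro measure_Un_le) (auto dest: fmeasurableD)
  finally show ?thesis .
qed

lemma abs_measure_diff_le:
  assumes "A \<in> fmeasurable M" "B \<in> fmeasurable M"
  shows "\<bar>measure M A - measure M B\<bar> \<le> measure M (sym_diff A B)"
  using measure_le_add_Diff[OF assms] measure_le_add_Diff[OF assms(2,1)] by (simp add: Un_commute abs_le_iff)

text \<open>Kept abstract because it serves both \<open>lebesgue\<close>, where cylinders and
  intervals are treated, and \<open>lebesgue_on X\<close>, where the densities live.\<close>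

locale set_sequence =
  fixes M :: "'a measure" and B :: "nat \<Rightarrow> 'a set" and c :: real
  assumes sets_B: "\<And>n. B n \<in> sets M"
    and c_nonneg: "0 \<le> c"
begin

text \<open>Asymptotic independence of \<open>E\<close> from the sets \<open>B n\<close>, which
  behave like sets of density \<open>c\<close>. Finite measure is part of the notion because
  \<open>measure\<close> is 0 on sets of infinite measure.\<close>

definition mixes :: "'a set \<Rightarrow> bool" where
  "mixes E \<longleftrightarrow> E \<in> fmeasurable M \<and> (\<lambda>n. measure M (E \<inter> B n)) \<longlonglongrightarrow> c * measure M E"

lemma fmeasurable_Int_B: "E \<in> fmeasurable M \<Longrightarrow> E \<inter> B n \<in> fmeasurable M"
  by (rule fmeasurable_Int_fmeasurable[OF _ sets_B])

text \<open>Intersecting with \<open>B n\<close> does not enlarge a symmetric difference, so the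
  error is uniform in \<open>n\<close>.\<close>

lemma mixes_approx:
  assumes E: "E \<in> fmeasurable M"
    and approx: "\<And>\<delta>. \<delta> > 0 \<Longrightarrow> \<exists>F. mixes F \<and> emeasure M (sym_diff E F) < ennreal \<delta>"
  shows "mixes E"
  unfolding mixes_def
proof (intro conjI E tendsto_uniform_approx)
  fix \<epsilon> :: real assume e: "\<epsilon> > 0"
  \<comment> \<open>Division by \<open>1 + c\<close> keeps both \<open>\<delta>\<close> and
    \<open>c * \<delta>\<close> below \<open>\<epsilon>\<close>, also for
    \<open>c = 0\<close>.\<close>
  define \<delta> where "\<delta> = \<epsilon> / (1 + c)"
  have d: "\<delta> > 0" "\<delta> \<le> \<epsilon>" "c * \<delta> \<le> \<epsilon>"
    using e c_nonneg by (auto simp: \<delta>_def field_simps)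
  obtain F where F: "mixes F" and EF: "emeasure M (sym_diff E F) < ennreal \<delta>"
    using approx[OF d(1)] by blast
  have Fm: "F \<in> fmeasurable M" using F by (simp add: mixes_def)
  have D: "sym_diff E F \<in> fmeasurable M"
    using E Fm by (auto intro!: fmeasurable.Un fmeasurable.Diff dest: fmeasurableD)
  have md: "measure M (sym_diff E F) \<le> \<delta>"
    using EF d(1) D by (simp add: emeasure_eq_measure2 ennreal_less_iff)
  show "\<exists>b L. b \<longlonglongrightarrow> L \<and> (\<forall>n. \<bar>measure M (E \<inter> B n) - b n\<bar> \<le> \<epsilon>) \<and> \<bar>c * measure M E - L\<bar> \<le> \<epsilon>"
  proof (intro exI conjI allI)
    show "(\<lambda>n. measure M (F \<inter> B n)) \<longlonglongrightarrow> c * measure M F"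
      using F by (simp add: mixes_def)
    fix n
    have "\<bar>measure M (E \<inter> B n) - measure M (F \<inter> B n)\<bar> \<le> measure M (sym_diff (E \<inter> B n) (F \<inter> B n))"
      by (rule abs_measure_diff_le[OF fmeasurable_Int_B[OF E] fmeasurable_Int_B[OF Fm]])
    also have "\<dots> \<le> measure M (sym_diff E F)"
      using sets_B[of n] fmeasurableD[OF E] fmeasurableD[OF Fm] by (intro measure_mono_fmeasurable D) auto
    finally show "\<bar>measure M (E \<inter> B n) - measure M (F \<inter> B n)\<bar> \<le> \<epsilon>" using md d by linarith
    have "\<bar>measure M E - measure M F\<bar> \<le> \<delta>"
      using abs_measure_diff_le[OF E Fm] md by linarith
    then have "\<bar>c * measure M E - c * measure M F\<bar> \<le> c * \<delta>"
      using c_nonneg by (simp add: right_diff_distrib[symmetric] abs_mult mult_left_mono)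
    then show "\<bar>c * measure M E - c * measure M F\<bar> \<le> \<epsilon>" using d by linarith
  qed
qed

lemma mixes_empty: "mixes {}"
  by (simp add: mixes_def)

lemma mixes_fmeasurable: "mixes E \<Longrightarrow> E \<in> fmeasurable M"
  by (simp add: mixes_def)

lemma mixes_cong_null:
  assumes E: "mixes E" and F: "F \<in> sets M" and N: "sym_diff F E \<in> null_sets M"
  shows "mixes F"
proof (rule mixes_approx)
  have Em: "E \<in> fmeasurable M" using E by (rule mixes_fmeasurable)
  have "emeasure M F \<le> emeasure M (E \<union> sym_diff F E)"
    using F fmeasurableD[OF Em] by (intro emeasure_mono) auto
  also have "\<dots> = emeasure M E"
    by (rule emeasure_Un_null_set[OF fmeasurableD[OF Em] N])
  finally show "F \<in> fmeasurable M"
    using F Em unfolding fmeasurable_def by (auto intro: le_less_trans)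
  show "\<exists>E. mixes E \<and> emeasure M (sym_diff F E) < ennreal \<delta>" if "\<delta> > 0" for \<delta>
    using E N that by (intro exI[of _ E]) (simp add: null_setsD1)
qed

lemma mixes_Un:
  assumes E: "mixes E" and F: "mixes F" and N: "E \<inter> F \<in> null_sets M"
  shows "mixes (E \<union> F)"
proof -
  note Em = mixes_fmeasurable[OF E] and Fm = mixes_fmeasurable[OF F]
  have "measure M ((E \<union> F) \<inter> B n) = measure M (E \<inter> B n) + measure M (F \<inter> B n)" for n
  proof -
    have "(E \<inter> B n) \<inter> (F \<inter> B n) = (E \<inter> F) \<inter> B n" by blast
    then have "(E \<inter> B n) \<inter> (F \<inter> B n) \<in> null_sets M"
      using null_set_Int2[OF N sets_B] by simp
    then have "measure M ((E \<inter> B n) \<union> (F \<inter> B n)) = measure M (E \<inter> B n) + measure M (F \<inter> B n)"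
      using measure_Un3[OF fmeasurable_Int_B[OF Em] fmeasurable_Int_B[OF Fm], of n n]
      by (simp add: measure_eq_0_null_sets)
    then show ?thesis by (simp add: Int_Un_distrib2)
  qed
  moreover have "measure M (E \<union> F) = measure M E + measure M F"
    using measure_Un3[OF Em Fm] N by (simp add: measure_eq_0_null_sets)
  ultimately show ?thesis
    using E F Em Fm unfolding mixes_def by (auto simp: distrib_left intro: tendsto_add fmeasurable.Un)
qed

lemma mixes_Diff:
  assumes E: "mixes E" and F: "mixes F" and FE: "F \<subseteq> E"
  shows "mixes (E - F)"
proof -
  note Em = mixes_fmeasurable[OF E] and Fm = mixes_fmeasurable[OF F]
  have diff: "measure M (S - T) = measure M S - measure M T"
    if "S \<in> fmeasurable M" "T \<in> fmeasurable M" "T \<subseteq> S" for S T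
    using that by (intro measure_Diff) (auto simp: fmeasurable_def)
  have "measure M ((E - F) \<inter> B n) = measure M (E \<inter> B n) - measure M (F \<inter> B n)" for n
  proof -
    have "(E - F) \<inter> B n = E \<inter> B n - F \<inter> B n" by blast
    then show ?thesis
      using FE by (simp only:) (intro diff fmeasurable_Int_B Em Fm, blast)
  qed
  then show ?thesis
    using E F Em Fm diff[OF Em Fm FE] unfolding mixes_def
    by (auto simp: right_diff_distrib intro!: tendsto_diff fmeasurable.Diff)
qed

lemma mixes_incseq:
  assumes mix: "\<And>k. mixes (F k)" and inc: "incseq F" and fin: "(\<Union>k. F k) \<in> fmeasurable M"
  shows "mixes (\<Union>k. F k)"
proof (rule mixes_approx[OF fin])
  fix \<delta> :: real assume "\<delta> > 0"
  note Fm = mixes_fmeasurable[OF mix]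
  have "(\<lambda>k. measure M (F k)) \<longlonglongrightarrow> measure M (\<Union>k. F k)"
    using inc fin Fm by (intro Lim_measure_incseq) (auto simp: fmeasurable_def)
  then obtain k where k: "norm (measure M (F k) - measure M (\<Union>k. F k)) < \<delta>"
    using LIMSEQ_D[OF _ \<open>\<delta> > 0\<close>] by blast
  have "measure M ((\<Union>k. F k) - F k) = measure M (\<Union>k. F k) - measure M (F k)"
    using fin Fm by (intro measure_Diff) (auto simp: fmeasurable_def)
  then have "measure M ((\<Union>k. F k) - F k) < \<delta>" using k by (simp add: abs_if split: if_splits)
  moreover have "(\<Union>k. F k) - F k \<in> fmeasurable M"
    using fin Fm by (auto intro: fmeasurable.Diff dest: fmeasurableD)
  ultimately have "emeasure M ((\<Union>k. F k) - F k) < ennreal \<delta>"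
    by (simp add: emeasure_eq_measure2 ennreal_less_iff)
  moreover have "sym_diff (\<Union>k. F k) (F k) = (\<Union>k. F k) - F k" by blast
  ultimately show "\<exists>E. mixes E \<and> emeasure M (sym_diff (\<Union>k. F k) E) < ennreal \<delta>"
    using mix[of k] by metis
qed

lemma mixes_UN_finite:
  assumes "finite I" "\<And>i. i \<in> I \<Longrightarrow> mixes (E i)"
    and "\<And>i j. i \<in> I \<Longrightarrow> j \<in> I \<Longrightarrow> i \<noteq> j \<Longrightarrow> E i \<inter> E j \<in> null_sets M"
  shows "mixes (\<Union>i\<in>I. E i)"
  using assms
proof (induction I rule: finite_induct)
  case (insert i I)
  have "E i \<inter> (\<Union>j\<in>I. E j) = (\<Union>j\<in>I. E i \<inter> E j)" by blast
  also have "\<dots> \<in> null_sets M"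
    using insert by (intro null_sets_UN' countable_finite) auto
  finally show ?case
    using insert by (auto intro!: mixes_Un)
qed (simp add: mixes_empty)

lemma mixes_UN_nat:
  fixes E :: "nat \<Rightarrow> 'a set"
  assumes mix: "\<And>i. i \<in> I \<Longrightarrow> mixes (E i)"
    and null: "\<And>i j. i \<in> I \<Longrightarrow> j \<in> I \<Longrightarrow> i \<noteq> j \<Longrightarrow> E i \<inter> E j \<in> null_sets M"
    and fin: "(\<Union>i\<in>I. E i) \<in> fmeasurable M"
  shows "mixes (\<Union>i\<in>I. E i)"
proof -
  have eq: "(\<Union>i\<in>I. E i) = (\<Union>k. \<Union>i\<in>I \<inter> {..k}. E i)" by auto
  show ?thesis
    unfolding eq
  proof (rule mixes_incseq)
    show "mixes (\<Union>i\<in>I \<inter> {..k}. E i)" for k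
      by (rule mixes_UN_finite) (use mix null in auto)
    show "incseq (\<lambda>k. \<Union>i\<in>I \<inter> {..k}. E i)"
      by (intro incseq_SucI) force
  qed (use fin eq in simp)
qed

text \<open>Made for families of cylinders. A set contained in another one is dropped; otherwise the
  chosen \<open>E\<close> contains or almost misses each of the others, and the union is
  \<open>E\<close> together with those it almost misses.\<close>

lemma mixes_Union_nested:
  assumes "finite \<F>" "\<And>E. E \<in> \<F> \<Longrightarrow> mixes E"
    and "\<And>E F. E \<in> \<F> \<Longrightarrow> F \<in> \<F> \<Longrightarrow> E \<subseteq> F \<or> F \<subseteq> E \<or> E \<inter> F \<in> null_sets M"
  shows "mixes (\<Union>\<F>)"
  using assms
proof (induction \<F> rule: finite_psubset_induct)
  case (psubset \<F>)
  show ?case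
  proof (cases "\<F> = {}")
    case False
    then obtain E where E: "E \<in> \<F>" by blast
    show ?thesis
    proof (cases "\<exists>F\<in>\<F>. F \<noteq> E \<and> E \<subseteq> F")
      case True
      then have "\<Union>\<F> = \<Union>(\<F> - {E})" by blast
      moreover have "mixes (\<Union>(\<F> - {E}))"
        by (rule psubset.IH) (use E psubset.prems in auto)
      ultimately show ?thesis by simp
    next
      case False
      let ?G = "{F \<in> \<F>. F \<noteq> E \<and> E \<inter> F \<in> null_sets M}"
      have "F \<subseteq> E" if "F \<in> \<F>" "F \<noteq> E" "E \<inter> F \<notin> null_sets M" for F
        using psubset.prems(2)[OF E that(1)] that False by blast
      then have eq: "\<Union>\<F> = E \<union> \<Union>?G" using E by blast
      have "mixes (\<Union>?G)"
        by (rule psubset.IH) (use E psubset.prems in auto)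
      moreover have "E \<inter> \<Union>?G \<in> null_sets M"
      proof -
        have "E \<inter> \<Union>?G = (\<Union>F\<in>?G. E \<inter> F)" by blast
        also have "\<dots> \<in> null_sets M"
          using psubset.hyps by (intro null_sets_UN' countable_finite) auto
        finally show ?thesis .
      qed
      ultimately show ?thesis
        unfolding eq using psubset.prems(1)[OF E] by (intro mixes_Un)
    qed
  qed (simp add: mixes_empty)
qed

section \<open>From sets to integrable densities\<close>

theorem nn_integral_mixes:
  fixes \<gamma> :: "'a \<Rightarrow> ennreal"
  assumes mix: "\<And>E. E \<in> fmeasurable M \<Longrightarrow> mixes E"
    and \<gamma>: "\<gamma> \<in> borel_measurable M" and fin: "(\<integral>\<^sup>+x. \<gamma> x \<partial>M) < \<infinity>"
  shows "(\<lambda>n. \<integral>\<^sup>+x. \<gamma> x * indicator (B n) x \<partial>M) \<longlonglongrightarrow> ennreal c * (\<integral>\<^sup>+x. \<gamma> x \<partial>M)"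
  using \<gamma> fin
proof (induction rule: borel_measurable_induct)
  case (cong f g)
  have "(\<integral>\<^sup>+x. f x \<partial>M) = (\<integral>\<^sup>+x. g x \<partial>M)"
    by (rule nn_integral_cong) (rule cong)
  moreover have "(\<integral>\<^sup>+x. f x * indicator (B n) x \<partial>M) = (\<integral>\<^sup>+x. g x * indicator (B n) x \<partial>M)" for n
    by (rule nn_integral_cong) (simp add: cong)
  ultimately show ?case using cong by simp
next
  case (set A)
  then have A: "A \<in> fmeasurable M" by (simp add: fmeasurable_def)
  have "(\<integral>\<^sup>+x. indicator A x * indicator (B n) x \<partial>M) = ennreal (measure M (A \<inter> B n))" for n
    using fmeasurable_Int_B[OF A, of n]
    by (simp add: indicator_inter_arith[symmetric] emeasure_eq_measure2 fmeasurableD)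
  moreover have "(\<lambda>n. ennreal (measure M (A \<inter> B n))) \<longlonglongrightarrow> ennreal (c * measure M A)"
    using mix[OF A] by (intro tendsto_ennrealI) (simp add: mixes_def)
  ultimately show ?case
    using set A c_nonneg by (simp add: ennreal_mult emeasure_eq_measure2)
next
  case (mult u a)
  have int: "(\<integral>\<^sup>+x. a * u x \<partial>M) = a * (\<integral>\<^sup>+x. u x \<partial>M)"
    by (rule nn_integral_cmult) (rule mult)
  show ?case
  proof (cases "a = 0")
    \<comment> \<open>Only for \<open>a \<noteq> 0\<close> does finiteness pass from the integral of
      \<open>a * u\<close> to that of \<open>u\<close>; for \<open>a = 0\<close> both sides
      vanish.\<close>
    case False
    have "(\<integral>\<^sup>+x. u x \<partial>M) < \<infinity>"
      using mult.prems False unfolding int by (auto simp: ennreal_mult_less_top)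
    then have "(\<lambda>n. a * (\<integral>\<^sup>+x. u x * indicator (B n) x \<partial>M)) \<longlonglongrightarrow> a * (ennreal c * (\<integral>\<^sup>+x. u x \<partial>M))"
      using mult by (intro ennreal_tendsto_cmult) auto
    moreover have "(\<integral>\<^sup>+x. a * u x * indicator (B n) x \<partial>M) = a * (\<integral>\<^sup>+x. u x * indicator (B n) x \<partial>M)" for n
      using mult sets_B by (simp add: mult.assoc nn_integral_cmult)
    ultimately show ?thesis by (simp add: int mult.left_commute)
  qed simp
next
  case (add u v)
  have int: "(\<integral>\<^sup>+x. v x + u x \<partial>M) = (\<integral>\<^sup>+x. v x \<partial>M) + (\<integral>\<^sup>+x. u x \<partial>M)"
    using add by (intro nn_integral_add) auto
  have "(\<lambda>n. (\<integral>\<^sup>+x. v x * indicator (B n) x \<partial>M) + (\<integral>\<^sup>+x. u x * indicator (B n) x \<partial>M))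
      \<longlonglongrightarrow> ennreal c * (\<integral>\<^sup>+x. v x \<partial>M) + ennreal c * (\<integral>\<^sup>+x. u x \<partial>M)"
    using add int by (intro tendsto_add) auto
  moreover have "(\<integral>\<^sup>+x. (v x + u x) * indicator (B n) x \<partial>M) = (\<integral>\<^sup>+x. v x * indicator (B n) x \<partial>M) + (\<integral>\<^sup>+x. u x * indicator (B n) x \<partial>M)" for n
    using add sets_B by (subst nn_integral_add[symmetric]) (auto simp: distrib_right)
  ultimately show ?case by (simp add: int distrib_left)
next
  case (seq U)
  define V where "V = (SUP i. U i)"
  have "(\<lambda>x. V x) \<in> borel_measurable M"
    unfolding V_def SUP_apply by (intro borel_measurable_SUP seq(1)) simp
  then have um: "V \<in> borel_measurable M" .
  have le: "U i x \<le> V x" for i x unfolding V_def by (rule le_funD, rule SUP_upper) simp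
  let ?s = "\<integral>\<^sup>+x. V x \<partial>M"
  have "?s < \<infinity>" using seq.prems unfolding V_def[symmetric] .
  have Us: "(\<integral>\<^sup>+x. U i x \<partial>M) \<le> ?s" for i by (intro nn_integral_mono le)
  have UB: "(\<integral>\<^sup>+x. g x * indicator (B n) x \<partial>M) \<le> (\<integral>\<^sup>+x. g x \<partial>M)" for g :: "'a \<Rightarrow> ennreal" and n
    by (intro nn_integral_mono) (simp add: indicator_def)
  \<comment> \<open>All integrals are bounded by the finite integral of \<open>V\<close>; as real
    numbers they can be subtracted.\<close>
  define s where "s = enn2real ?s"
  define S where "S i = enn2real (\<integral>\<^sup>+x. U i x \<partial>M)" for i
  define a where "a n = enn2real (\<integral>\<^sup>+x. V x * indicator (B n) x \<partial>M)" for n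
  define b where "b i n = enn2real (\<integral>\<^sup>+x. U i x * indicator (B n) x \<partial>M)" for i n
  have s: "?s = ennreal s" using \<open>?s < \<infinity>\<close> by (simp add: s_def)
  have S: "(\<integral>\<^sup>+x. U i x \<partial>M) = ennreal (S i)" for i
    using le_less_trans[OF Us \<open>?s < \<infinity>\<close>] by (simp add: S_def)
  have a: "(\<integral>\<^sup>+x. V x * indicator (B n) x \<partial>M) = ennreal (a n)" for n
    using le_less_trans[OF UB \<open>?s < \<infinity>\<close>] unfolding a_def by simp
  have b: "(\<integral>\<^sup>+x. U i x * indicator (B n) x \<partial>M) = ennreal (b i n)" for i n
    using le_less_trans[OF order_trans[OF UB Us] \<open>?s < \<infinity>\<close>] unfolding b_def by simp
  have nonneg: "0 \<le> s" "0 \<le> S i" "0 \<le> a n" "0 \<le> b i n" for i n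
    by (simp_all add: s_def S_def a_def b_def)
  have "incseq U" using seq by blast
  then have "?s = (SUP i. \<integral>\<^sup>+x. U i x \<partial>M)"
    unfolding V_def SUP_apply by (rule nn_integral_monotone_convergence_SUP) (rule seq(1))
  moreover have "incseq (\<lambda>i. \<integral>\<^sup>+x. U i x \<partial>M)"
    using \<open>incseq U\<close> by (auto simp: incseq_def le_fun_def intro: nn_integral_mono)
  ultimately have "(\<lambda>i. \<integral>\<^sup>+x. U i x \<partial>M) \<longlonglongrightarrow> ?s"
    using LIMSEQ_SUP by metis
  then have S_lim: "S \<longlonglongrightarrow> s" unfolding s S by (simp add: nonneg)
  have S_le: "S i \<le> s" for i using Us[of i] nonneg by (simp add: s S)
  have b_lim: "b i \<longlonglongrightarrow> c * S i" for i
  proof -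
    have "(\<lambda>n. ennreal (b i n)) \<longlonglongrightarrow> ennreal c * ennreal (S i)"
      using seq.IH[of i] le_less_trans[OF Us \<open>?s < \<infinity>\<close>] by (simp add: b S)
    then show ?thesis
      using nonneg c_nonneg by (simp add: ennreal_mult[symmetric])
  qed
  \<comment> \<open>The truncation error is at most \<open>s - S i\<close> for every
    \<open>n\<close>. It is proved in additive form because subtraction in \<open>ennreal\<close> is
    truncated.\<close>
  have ab: "b i n \<le> a n" "a n \<le> b i n + (s - S i)" for i n
  proof -
    have "(\<integral>\<^sup>+x. U i x * indicator (B n) x \<partial>M) \<le> (\<integral>\<^sup>+x. V x * indicator (B n) x \<partial>M)"
      by (intro nn_integral_mono mult_right_mono le) simp
    then show "b i n \<le> a n" using nonneg by (simp add: a b)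
    have "(\<integral>\<^sup>+x. V x * indicator (B n) x \<partial>M) + (\<integral>\<^sup>+x. U i x \<partial>M)
        = (\<integral>\<^sup>+x. V x * indicator (B n) x + U i x \<partial>M)"
      using um seq(1) sets_B by (intro nn_integral_add[symmetric]) auto
    also have "\<dots> \<le> (\<integral>\<^sup>+x. U i x * indicator (B n) x + V x \<partial>M)"
    proof (rule nn_integral_mono)
      fix x
      show "V x * indicator (B n) x + U i x \<le> U i x * indicator (B n) x + V x"
        using le[of i x] by (cases "x \<in> B n") (simp_all add: add.commute)
    qed
    also have "\<dots> = (\<integral>\<^sup>+x. U i x * indicator (B n) x \<partial>M) + ?s"
      using um seq(1) sets_B by (intro nn_integral_add) auto
    finally have "ennreal (a n + S i) \<le> ennreal (b i n + s)"
      unfolding a b s S using nonneg by (simp add: ennreal_plus)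
    then show "a n \<le> b i n + (s - S i)"
      using nonneg by (subst (asm) ennreal_le_iff) (auto intro: add_nonneg_nonneg)
  qed
  have "a \<longlonglongrightarrow> c * s"
  proof (rule tendsto_uniform_approx)
    fix \<epsilon> :: real assume e: "\<epsilon> > 0"
    define \<delta> where "\<delta> = \<epsilon> / (1 + c)"
    have d: "\<delta> > 0" "\<delta> \<le> \<epsilon>" "c * \<delta> \<le> \<epsilon>"
      using e c_nonneg by (auto simp: \<delta>_def field_simps)
    obtain i where "norm (S i - s) < \<delta>" using LIMSEQ_D[OF S_lim d(1)] by blast
    then have i: "s - S i \<le> \<delta>" by simp
    have "\<bar>a n - b i n\<bar> \<le> \<epsilon>" for n using ab(1)[of i n] ab(2)[of n i] i d by linarith
    moreover have "\<bar>c * s - c * S i\<bar> \<le> \<epsilon>"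
    proof -
      have "\<bar>c * s - c * S i\<bar> = c * (s - S i)"
        using S_le[of i] c_nonneg by (simp add: right_diff_distrib[symmetric])
      also have "\<dots> \<le> c * \<delta>" using i c_nonneg by (rule mult_left_mono)
      finally show ?thesis using d by linarith
    qed
    ultimately show "\<exists>b M. b \<longlonglongrightarrow> M \<and> (\<forall>n. \<bar>a n - b n\<bar> \<le> \<epsilon>) \<and> \<bar>c * s - M\<bar> \<le> \<epsilon>"
      using b_lim[of i] by blast
  qed
  then have "(\<lambda>n. ennreal (a n)) \<longlonglongrightarrow> ennreal (c * s)" by (rule tendsto_ennrealI)
  then show ?case
    unfolding V_def[symmetric] a s using c_nonneg nonneg by (simp add: ennreal_mult)
qed

end

section \<open>Interval lengths under a Markov map\<close>

text \<open>Partition elements are allowed to be unbounded; finite length excludes this, since it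
  bounds the distance between any two points of \<open>I\<close>.\<close>

lemma bounded_closed_interval:
  fixes I :: "real set"
  assumes I: "nondegenerate_closed_interval I" and fin: "emeasure lebesgue I < \<infinity>"
  obtains a b where "a < b" "I = {a..b}"
proof -
  have intv: "is_interval I" and cl: "closed I" and int: "interior I \<noteq> {}"
    using I by (auto simp: nondegenerate_closed_interval_def)
  obtain x where x: "x \<in> I" using int interior_subset by blast
  have Im: "I \<in> sets lebesgue" using cl by (simp add: borel_closed)
  have diam: "z - y \<le> enn2real (emeasure lebesgue I)" if "y \<in> I" "z \<in> I" "y \<le> z" for y z
  proof -
    have "{y..z} \<subseteq> I"
      using mem_is_interval_1_I[OF intv that(1,2)] by auto
    then have "emeasure lebesgue {y..z} \<le> emeasure lebesgue I"
      by (rule emeasure_mono) (rule Im)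
    then have "enn2real (ennreal (z - y)) \<le> enn2real (emeasure lebesgue I)"
      using that(3) fin by (intro enn2real_mono) simp_all
    then show ?thesis using that(3) by simp
  qed
  have "bounded I"
  proof (rule boundedI)
    fix y assume "y \<in> I"
    then show "norm y \<le> \<bar>x\<bar> + enn2real (emeasure lebesgue I)"
      using diam[OF x, of y] diam[OF _ x, of y] by (cases "x \<le> y") auto
  qed
  then have "compact I" using cl by (simp add: compact_eq_bounded_closed)
  moreover have "connected I" using intv by (simp add: is_interval_connected_1)
  ultimately obtain a b where ab: "I = {a..b}"
    using connected_compact_interval_1 by blast
  moreover have "a < b"
    using int unfolding ab by simp
  ultimately show ?thesis using that by blast
qed

lemma has_sum_count_space:
  fixes p :: "'a \<Rightarrow> real"
  assumes nonneg: "\<And>j. j \<in> J \<Longrightarrow> 0 \<le> p j" and total: "(\<integral>\<^sup>+j. ennreal (p j) \<partial>count_space J) = ennreal c" and c: "0 \<le> c"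
  shows "(p has_sum c) J"
proof -
  have int: "integrable (count_space J) p"
    by (rule integrableI_nn_integral_finite[OF _ _ total]) (auto simp: nonneg AE_count_space)
  then have abs: "Infinite_Set_Sum.abs_summable_on p J"
    by (simp add: Infinite_Set_Sum.abs_summable_on_def)
  have "infsetsum p J = c"
    unfolding infsetsum_def using total c int nonneg
    by (simp add: integral_eq_nn_integral AE_count_space)
  then have "infsum p J = c" using infsetsum_infsum[OF abs] by simp
  moreover have "p summable_on J"
    using abs abs_summable_equivalent summable_on_iff_abs_summable_on_real by blast
  ultimately show ?thesis by (simp add: has_sum_infsum flip: \<open>infsum p J = c\<close>)
qed

lemma emeasure_eq_mod_null:
  assumes "B \<in> sets M" "A \<in> sets M" "N \<in> null_sets M" "B \<subseteq> A" "A \<subseteq> B \<union> N"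
  shows "emeasure M A = emeasure M B"
proof (rule antisym)
  have "emeasure M A \<le> emeasure M (B \<union> N)"
    using assms by (intro emeasure_mono) auto
  also have "\<dots> = emeasure M B" by (rule emeasure_Un_null_set[OF assms(1,3)])
  finally show "emeasure M A \<le> emeasure M B" .
qed (use assms in \<open>intro emeasure_mono\<close>)

section \<open>The interval map and its partition\<close>

locale markov_system =
  fixes X :: "real set" and f :: "real \<Rightarrow> real"
    and \<H> :: "real set set" and J :: "nat set" and H :: "nat \<Rightarrow> real set"
  assumes system: "dynamical_system X f"
    and partition: "markov_partition X f \<H>" "enumerates J H \<H>"
    and finite_length: "\<And>i. i \<in> J \<Longrightarrow> emeasure lebesgue (H i) < \<infinity>"
begin

abbreviation P where "P \<equiv> transition_matrix f H"

lemma
  assumes "A \<in> \<H>"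
  shows partition_interval: "nondegenerate_closed_interval A"
    and partition_disjoint: "B \<in> \<H> \<Longrightarrow> A \<noteq> B \<Longrightarrow> interior A \<inter> interior B = {}"
    and partition_image: "\<exists>\<A>. \<A> \<noteq> {} \<and> \<A> \<subseteq> \<H> \<and> interior (f ` A) = interior (\<Union>\<A>)"
    and partition_affine: "affine_on f (interior A)"
  using assms partition(1) by (simp_all add: markov_partition_def)

lemma bij: "bij_betw H J \<H>"
  using partition(2) by (simp add: enumerates_def)

lemma H_in: "i \<in> J \<Longrightarrow> H i \<in> \<H>"
  using bij by (auto simp: bij_betw_def)

lemma interval_H:
  assumes "i \<in> J"
  obtains a b where "a < b" "H i = {a..b}"
  using bounded_closed_interval[OF partition_interval[OF H_in[OF assms]] finite_length[OF assms]] by blast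

lemma X_eq: "X = (\<Union>i\<in>J. H i)"
  using partition(1) bij by (auto simp: markov_partition_def bij_betw_def)

lemma H_subset: "i \<in> J \<Longrightarrow> H i \<subseteq> X"
  using X_eq by blast

lemma disjoint_interior:
  assumes "i \<in> J" "j \<in> J" "i \<noteq> j"
  shows "interior (H i) \<inter> interior (H j) = {}"
proof -
  have "H i \<noteq> H j" using bij assms by (auto simp: bij_betw_def inj_on_def)
  then show ?thesis
    by (rule partition_disjoint[OF H_in[OF assms(1)] H_in[OF assms(2)]])
qed

lemma sets_X [measurable]: "X \<in> sets lebesgue"
  using system by (simp add: dynamical_system_def)

lemma sets_H: "i \<in> J \<Longrightarrow> H i \<in> sets lebesgue"
  by (erule interval_H) simp

lemma sets_interior_H: "interior (H i) \<in> sets lebesgue"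
  by (simp add: borel_open)

lemma sets_on_X: "A \<in> sets (lebesgue_on X) \<longleftrightarrow> A \<in> sets lebesgue \<and> A \<subseteq> X"
  using sets_X by (auto simp: sets_restrict_space_iff)

lemma boundary_H_null: "i \<in> J \<Longrightarrow> H i - interior (H i) \<in> null_sets lebesgue"
proof -
  assume "i \<in> J"
  then obtain a b where ab: "a < b" "H i = {a..b}" by (rule interval_H)
  then have "H i - interior (H i) \<subseteq> {a, b}" by auto
  moreover have "finite {a, b}" by simp
  ultimately show ?thesis
    using negligible_finite negligible_iff_null_sets finite_subset by blast
qed

text \<open>The endpoints of all partition elements, a countable set that contains every overlap of
  distinct elements.\<close>

definition boundary :: "real set" where
  "boundary = (\<Union>i\<in>J. H i - interior (H i))"

lemma boundary_null: "boundary \<in> null_sets lebesgue"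
  unfolding boundary_def by (rule null_sets_UN') (auto intro: boundary_H_null)

lemma measure_H_pos: "i \<in> J \<Longrightarrow> 0 < measure lebesgue (H i)"
  by (erule interval_H) simp

lemma emeasure_H: "i \<in> J \<Longrightarrow> emeasure lebesgue (H i) = ennreal (measure lebesgue (H i))"
  using finite_length by (simp add: emeasure_eq_ennreal_measure less_top[symmetric])

lemma f_in_X: "x \<in> X \<Longrightarrow> f x \<in> X"
  using system measurable_space[of f "lebesgue_on X" "lebesgue_on X" x]
  by (auto simp: dynamical_system_def)

lemma sets_preimage: "A \<in> sets (lebesgue_on X) \<Longrightarrow> f -` A \<inter> X \<in> sets (lebesgue_on X)"
  using system measurable_sets[of f "lebesgue_on X" "lebesgue_on X" A]
  by (auto simp: dynamical_system_def)

lemma affine_H: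
  assumes i: "i \<in> J"
  obtains t where "\<And>x. x \<in> interior (H i) \<Longrightarrow> f x = slope f (H i) * x + t"
proof -
  obtain a b where ab: "\<forall>x\<in>interior (H i). f x = a * x + b"
    using partition_affine[OF H_in[OF i]] unfolding affine_on_def by blast
  have "slope f (H i) = a"
    unfolding slope_def
  proof (rule the_equality)
    fix c assume "\<exists>b. \<forall>x\<in>interior (H i). f x = c * x + b"
    then obtain d where d: "\<forall>x\<in>interior (H i). f x = c * x + d" by blast
    obtain l r where lr: "l < r" "H i = {l..r}" using i by (rule interval_H)
    \<comment> \<open>Two distinct interior points determine the slope.\<close>
    define x y where "x = (2 * l + r) / 3" and "y = (l + 2 * r) / 3"
    have xy: "x \<in> interior (H i)" "y \<in> interior (H i)" "x < y"
      using lr by (auto simp: x_def y_def field_simps)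
    then have "a * x + b = c * x + d" "a * y + b = c * y + d"
      using ab d by metis+
    then have "(a - c) * (x - y) = 0" by (simp add: algebra_simps)
    then show "c = a" using xy(3) by simp
  qed (use ab in blast)
  then show ?thesis using ab that by blast
qed

lemma image_H_structure:
  assumes i: "i \<in> J"
  obtains \<A> where "\<A> \<noteq> {}" "\<A> \<subseteq> \<H>" "interior (f ` H i) = interior (\<Union>\<A>)"
  using partition_image[OF H_in[OF i]] by blast

text \<open>A constant branch would have a finite image, namely the constant and the two endpoint
  values, whereas the Markov condition puts the interior of some partition element into the
  image.\<close>

lemma slope_nonzero:
  assumes i: "i \<in> J"
  shows "slope f (H i) \<noteq> 0"
proof
  assume s0: "slope f (H i) = 0"
  obtain t where t: "\<And>x. x \<in> interior (H i) \<Longrightarrow> f x = slope f (H i) * x + t"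
    using affine_H[OF i] by blast
  obtain a b where ab: "a < b" "H i = {a..b}" using i by (rule interval_H)
  have "f ` H i \<subseteq> {t, f a, f b}"
  proof
    fix y assume "y \<in> f ` H i"
    then obtain x where x: "x \<in> {a..b}" "y = f x" unfolding ab(2) by blast
    then consider "x = a" | "x = b" | "x \<in> {a<..<b}" by fastforce
    then show "y \<in> {t, f a, f b}"
      using t[of x] s0 x(2) by cases (auto simp: ab(2))
  qed
  then have "finite (f ` H i)" using finite_subset by blast
  then have e: "interior (f ` H i) = {}"
    by (rule empty_interior_finite)
  obtain \<A> where A: "\<A> \<noteq> {}" "\<A> \<subseteq> \<H>" "interior (f ` H i) = interior (\<Union>\<A>)"
    using image_H_structure[OF i] by blast
  then obtain B where "B \<in> \<A>" by blast
  then have "interior B \<subseteq> interior (\<Union>\<A>)" by (intro interior_mono) blast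
  moreover have "interior B \<noteq> {}"
    using \<open>B \<in> \<A>\<close> A(2) partition_interval[of B] unfolding nondegenerate_closed_interval_def by blast
  ultimately show False using A(3) e by blast
qed

section \<open>Lengths of preimages and the transition matrix\<close>

definition succs :: "nat \<Rightarrow> nat set" where
  "succs i = {j \<in> J. interior (H j) \<subseteq> f ` H i}"

text \<open>The values of \<open>f\<close> at the endpoints of \<open>H i\<close> are arbitrary, so only the sandwich
  \<open>f ` int (H i) \<subseteq> int (f ` H i) \<subseteq> f ` int (H i) \<union> {f a, f b}\<close> is available.\<close>

lemma emeasure_branch_preimage:
  assumes i: "i \<in> J" and A: "A \<in> sets (lebesgue_on X)"
  shows "ennreal \<bar>slope f (H i)\<bar> * emeasure lebesgue (H i \<inter> (f -` A \<inter> X)) =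
    (\<integral>\<^sup>+j. emeasure lebesgue (H j \<inter> A) \<partial>count_space (succs i))"
proof -
  let ?s = "slope f (H i)"
  obtain t where t: "\<And>x. x \<in> interior (H i) \<Longrightarrow> f x = ?s * x + t"
    using affine_H[OF i] by blast
  note s0 = slope_nonzero[OF i]
  let ?T = "\<lambda>x. t + ?s * x"
  let ?U = "?T ` interior (H i)"
  let ?V = "interior (f ` H i)"
  have Am: "A \<in> sets lebesgue" "A \<subseteq> X" using A by (auto simp: sets_on_X)
  have pre: "f -` A \<inter> X \<in> sets lebesgue" using sets_preimage[OF A] by (simp add: sets_on_X)
  obtain a b where ab: "a < b" "H i = {a..b}" using i by (rule interval_H)
  have openU: "open ?U"
  proof -
    have "?U = (\<lambda>x. t + x) ` ((\<lambda>x. ?s *\<^sub>R x) ` interior (H i))" by (simp add: image_image)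
    then show ?thesis by (metis open_translation open_scaling[OF s0] open_interior)
  qed
  have U_f: "?U = f ` interior (H i)"
    using t by (auto simp: image_def algebra_simps intro!: bexI)
  have UV: "?U \<subseteq> ?V"
    using openU interior_subset[of "H i"] by (intro interior_maximal) (auto simp: U_f)
  have VU: "?V \<subseteq> ?U \<union> {f a, f b}"
  proof
    fix y assume "y \<in> ?V"
    then obtain x where x: "x \<in> {a..b}" "y = f x" using interior_subset ab(2) by blast
    then consider "x = a" | "x = b" | "x \<in> {a<..<b}" by fastforce
    then show "y \<in> ?U \<union> {f a, f b}"
      unfolding U_f using x(2) by cases (auto simp: ab(2))
  qed
  have nab: "{f a, f b} \<in> null_sets lebesgue"
    using negligible_finite[of "{f a, f b}"] by (simp add: negligible_iff_null_sets)
  \<comment> \<open>Change of variables along the affine map \<open>?T\<close>, which agrees with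
    \<open>f\<close> on the interior of \<open>H i\<close>.\<close>
  have "emeasure lebesgue (A \<inter> ?U) = (\<integral>\<^sup>+x. indicator (A \<inter> ?U) x \<partial>lebesgue)"
    using Am openU by (intro nn_integral_indicator[symmetric] sets.Int) (auto intro: borel_open)
  also have "\<dots> = ennreal \<bar>?s\<bar> * (\<integral>\<^sup>+x. indicator (A \<inter> ?U) (?T x) \<partial>lebesgue)"
    using Am openU s0 by (intro nn_integral_real_affine_lebesgue borel_measurable_indicator sets.Int) (auto intro: borel_open)
  also have "(\<lambda>x. indicator (A \<inter> ?U) (?T x) :: ennreal) = indicator (interior (H i) \<inter> (f -` A \<inter> X))"
  proof
    fix x
    have "?T x \<in> A \<inter> ?U \<longleftrightarrow> x \<in> interior (H i) \<inter> (f -` A \<inter> X)"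
      using s0 t[of x] interior_subset[of "H i"] H_subset[OF i] by (auto simp: add.commute)
    then show "indicator (A \<inter> ?U) (?T x) = (indicator (interior (H i) \<inter> (f -` A \<inter> X)) x :: ennreal)"
      by (simp only: indicator_def)
  qed
  also have "(\<integral>\<^sup>+x. indicator (interior (H i) \<inter> (f -` A \<inter> X)) x \<partial>lebesgue) = emeasure lebesgue (interior (H i) \<inter> (f -` A \<inter> X))"
    by (rule nn_integral_indicator[OF sets.Int[OF sets_interior_H pre]])
  also have "\<dots> = emeasure lebesgue (H i \<inter> (f -` A \<inter> X))"
    by (rule emeasure_eq_mod_null[symmetric, OF sets.Int[OF sets_interior_H pre] sets.Int[OF sets_H[OF i] pre] boundary_H_null[OF i]])
       (use interior_subset[of "H i"] in blast)+
  finally have left: "emeasure lebesgue (A \<inter> ?U) = ennreal \<bar>?s\<bar> * emeasure lebesgue (H i \<inter> (f -` A \<inter> X))" .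
  obtain \<A> where \<A>: "\<A> \<noteq> {}" "\<A> \<subseteq> \<H>" "?V = interior (\<Union>\<A>)"
    using image_H_structure[OF i] by blast
  \<comment> \<open>The Markov condition enters here: every element of \<open>\<A>\<close> has its
    whole interior inside \<open>?V\<close>, so its index is a successor of
    \<open>i\<close>.\<close>
  have V_cover: "?V \<subseteq> (\<Union>j\<in>succs i. interior (H j)) \<union> boundary"
  proof
    fix x assume x: "x \<in> ?V"
    then obtain B where B: "B \<in> \<A>" "x \<in> B" using \<A>(3) interior_subset by blast
    then obtain j where j: "j \<in> J" "B = H j" using \<A>(2) bij by (auto simp: bij_betw_def)
    have "interior (H j) \<subseteq> ?V"
      unfolding \<A>(3) using B(1) j(2) by (intro interior_mono) blast
    then have "j \<in> succs i" using j(1) interior_subset[of "f ` H i"] by (auto simp: succs_def)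
    then show "x \<in> (\<Union>j\<in>succs i. interior (H j)) \<union> boundary"
      using B(2) j by (auto simp: boundary_def)
  qed
  have V_super: "(\<Union>j\<in>succs i. interior (H j)) \<subseteq> ?V"
  proof (rule UN_least)
    fix j assume "j \<in> succs i"
    then have "interior (H j) \<subseteq> f ` H i" by (simp add: succs_def)
    then show "interior (H j) \<subseteq> ?V" using open_interior by (rule interior_maximal)
  qed
  have meas_un: "(\<Union>j\<in>succs i. interior (H j) \<inter> A) \<in> sets lebesgue"
    using Am by (intro sets.countable_UN' sets.Int sets_interior_H) auto
  have Vm: "A \<inter> ?V \<in> sets lebesgue" using Am by (intro sets.Int) (auto intro: borel_open)
  have Um: "A \<inter> ?U \<in> sets lebesgue" using Am openU by (intro sets.Int) (auto intro: borel_open)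
  have "emeasure lebesgue (A \<inter> ?U) = emeasure lebesgue (A \<inter> ?V)"
    by (rule emeasure_eq_mod_null[symmetric, OF Um Vm nab]) (use UV VU in blast)+
  also have "\<dots> = emeasure lebesgue (\<Union>j\<in>succs i. interior (H j) \<inter> A)"
    by (rule emeasure_eq_mod_null[OF meas_un Vm boundary_null]) (use V_cover V_super in blast)+
  also have "\<dots> = (\<integral>\<^sup>+j. emeasure lebesgue (interior (H j) \<inter> A) \<partial>count_space (succs i))"
  proof (rule emeasure_UN_countable)
    show "disjoint_family_on (\<lambda>j. interior (H j) \<inter> A) (succs i)"
      using disjoint_interior unfolding disjoint_family_on_def succs_def by blast
  qed (use Am in \<open>auto intro!: sets.Int sets_interior_H\<close>)
  also have "\<dots> = (\<integral>\<^sup>+j. emeasure lebesgue (H j \<inter> A) \<partial>count_space (succs i))"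
  proof (rule nn_integral_cong)
    fix j assume "j \<in> space (count_space (succs i))"
    then have j: "j \<in> J" by (simp add: succs_def)
    show "emeasure lebesgue (interior (H j) \<inter> A) = emeasure lebesgue (H j \<inter> A)"
      by (rule emeasure_eq_mod_null[symmetric, OF _ _ boundary_H_null[OF j]])
         (use Am interior_subset[of "H j"] in \<open>auto intro!: sets.Int sets_H[OF j] sets_interior_H\<close>)
  qed
  finally show ?thesis using left by simp
qed


definition share :: "nat \<Rightarrow> real set \<Rightarrow> real" where
  "share i A = measure lebesgue (H i \<inter> A) / measure lebesgue (H i)"

lemma emeasure_H_Int:
  assumes i: "i \<in> J"
  shows "emeasure lebesgue (H i \<inter> A) = ennreal (measure lebesgue (H i \<inter> A))"
proof -
  have "emeasure lebesgue (H i \<inter> A) \<le> emeasure lebesgue (H i)"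
    by (rule emeasure_mono[OF Int_lower1 sets_H[OF i]])
  also have "\<dots> < \<infinity>" by (rule finite_length[OF i])
  finally show ?thesis by (intro emeasure_eq_ennreal_measure) simp
qed

lemma emeasure_H_Int_share: "i \<in> J \<Longrightarrow> emeasure lebesgue (H i \<inter> A) = ennreal (measure lebesgue (H i) * share i A)"
  using measure_H_pos by (simp add: emeasure_H_Int share_def less_le)

lemma share_nonneg: "0 \<le> share i A"
  by (simp add: share_def)

lemma share_le_1:
  assumes i: "i \<in> J"
  shows "share i A \<le> 1"
proof -
  have "ennreal (measure lebesgue (H i \<inter> A)) \<le> ennreal (measure lebesgue (H i))"
    unfolding emeasure_H_Int[OF i, symmetric] emeasure_H[OF i, symmetric]
    by (rule emeasure_mono[OF Int_lower1 sets_H[OF i]])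
  then show ?thesis using measure_H_pos[OF i] by (simp add: share_def)
qed

lemma share_X: "i \<in> J \<Longrightarrow> share i X = 1"
  using H_subset[of i] measure_H_pos[of i] by (simp add: share_def Int_absorb2)

lemma P_nonneg: "0 \<le> P i j"
  by (simp add: transition_matrix_def)

text \<open>This is \<open>emeasure_branch_preimage\<close> divided by the length of
  \<open>H i\<close> times the absolute slope; the length of \<open>H j\<close> in the numerator of
  \<open>P i j\<close> turns \<open>share j A\<close> into the length of
  \<open>H j \<inter> A\<close>.\<close>

lemma share_preimage:
  assumes i: "i \<in> J" and A: "A \<in> sets (lebesgue_on X)"
  shows "(\<integral>\<^sup>+j. ennreal (P i j * share j A) \<partial>count_space J) = ennreal (share i (f -` A \<inter> X))"
proof -
  let ?c = "\<bar>slope f (H i)\<bar>" and ?m = "\<lambda>i. measure lebesgue (H i)"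
  let ?d = "?m i * ?c"
  have c: "0 < ?c" "0 < ?d" using slope_nonzero[OF i] measure_H_pos[OF i] by auto
  have "(\<integral>\<^sup>+j. ennreal (P i j * share j A) \<partial>count_space J)
      = (\<integral>\<^sup>+j. ennreal (1 / ?d) * (emeasure lebesgue (H j \<inter> A) * indicator (succs i) j) \<partial>count_space J)"
  proof (rule nn_integral_cong)
    fix j assume "j \<in> space (count_space J)"
    then have j: "j \<in> J" by simp
    show "ennreal (P i j * share j A) = ennreal (1 / ?d) * (emeasure lebesgue (H j \<inter> A) * indicator (succs i) j)"
    proof (cases "j \<in> succs i")
      case True
      then have "P i j = ?m j / ?d" by (simp add: transition_matrix_def succs_def)
      then have "P i j * share j A = 1 / ?d * (?m j * share j A)" by simp
      then have "ennreal (P i j * share j A) = ennreal (1 / ?d * (?m j * share j A))" by (simp only:)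
      also have "\<dots> = ennreal (1 / ?d) * ennreal (?m j * share j A)"
        by (rule ennreal_mult') (use c in simp)
      finally show ?thesis
        unfolding emeasure_H_Int_share[OF j] using True by simp
    next
      case False
      then have "P i j = 0" using j by (simp add: transition_matrix_def succs_def)
      then show ?thesis using False by simp
    qed
  qed
  also have "\<dots> = ennreal (1 / ?d) * (\<integral>\<^sup>+j. emeasure lebesgue (H j \<inter> A) * indicator (succs i) j \<partial>count_space J)"
    by (rule nn_integral_cmult) simp
  also have "(\<integral>\<^sup>+j. emeasure lebesgue (H j \<inter> A) * indicator (succs i) j \<partial>count_space J)
      = (\<integral>\<^sup>+j. emeasure lebesgue (H j \<inter> A) \<partial>count_space (succs i))"
    by (auto simp: nn_integral_count_space_indicator indicator_def succs_def intro!: nn_integral_cong)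
  also have "\<dots> = ennreal ?c * emeasure lebesgue (H i \<inter> (f -` A \<inter> X))"
    by (rule emeasure_branch_preimage[OF i A, symmetric])
  also have "\<dots> = ennreal (?c * (?m i * share i (f -` A \<inter> X)))"
    by (simp only: emeasure_H_Int_share[OF i] ennreal_mult'[OF abs_ge_zero])
  also have "ennreal (1 / ?d) * \<dots> = ennreal (1 / ?d * (?c * (?m i * share i (f -` A \<inter> X))))"
    using c by (intro ennreal_mult'[symmetric]) simp
  also have "1 / ?d * (?c * (?m i * share i (f -` A \<inter> X))) = share i (f -` A \<inter> X)"
    using c measure_H_pos[OF i] by (simp add: field_simps)
  finally show ?thesis .
qed

text \<open>Take \<open>A = X\<close> in \<open>share_preimage\<close>: all shares are 1, and
  \<open>f\<close> maps \<open>X\<close> into itself.\<close>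

lemma row_stochastic_P: "row_stochastic J P"
  unfolding row_stochastic_def
proof (intro ballI conjI)
  fix i assume i: "i \<in> J"
  have X: "X \<in> sets (lebesgue_on X)" by (simp add: sets_on_X)
  have "f -` X \<inter> X = X" using f_in_X by auto
  then have "(\<integral>\<^sup>+j. ennreal (P i j * share j X) \<partial>count_space J) = ennreal 1"
    using share_preimage[OF i X] share_X[OF i] by simp
  also have "(\<integral>\<^sup>+j. ennreal (P i j * share j X) \<partial>count_space J) = (\<integral>\<^sup>+j. ennreal (P i j) \<partial>count_space J)"
    by (intro nn_integral_cong) (simp add: share_X)
  finally show "(P i has_sum 1) J"
    by (intro has_sum_count_space P_nonneg) simp_all
qed (rule P_nonneg)

end

sublocale markov_system \<subseteq> stochastic_matrix J "transition_matrix f H"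
  by unfold_locales (rule row_stochastic_P)

context markov_system
begin

lemma share_preimage_step:
  assumes i: "i \<in> J" and A: "A \<in> sets (lebesgue_on X)"
  shows "ennreal (share i (f -` A \<inter> X)) = (\<integral>\<^sup>+j. ennreal (share j A) \<partial>measure_pmf (step i))"
proof -
  have "(\<integral>\<^sup>+j. ennreal (share j A) \<partial>measure_pmf (step i))
      = (\<integral>\<^sup>+j. ennreal (P i j * share j A) * indicator J j \<partial>count_space UNIV)"
    unfolding nn_integral_measure_pmf
    by (intro nn_integral_cong) (auto simp: pmf_step[OF i] indicator_def ennreal_mult' P_nonneg)
  also have "\<dots> = (\<integral>\<^sup>+j. ennreal (P i j * share j A) \<partial>count_space J)"
    by (simp add: nn_integral_count_space_indicator)
  finally show ?thesis using share_preimage[OF i A] by simp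
qed

lemma preimage_iter_0: "A \<subseteq> X \<Longrightarrow> preimage_iter X f 0 A = A"
  by (auto simp: preimage_iter_def)

lemma preimage_iter_Suc: "preimage_iter X f (Suc n) A = f -` preimage_iter X f n A \<inter> X"
  by (auto simp: preimage_iter_def funpow_Suc_right f_in_X simp del: funpow.simps)

lemma sets_preimage_iter:
  assumes A: "A \<in> sets (lebesgue_on X)"
  shows "preimage_iter X f n A \<in> sets (lebesgue_on X)"
proof (induction n)
  case 0
  then show ?case using A by (simp add: preimage_iter_0 sets_on_X)
qed (simp add: preimage_iter_Suc sets_preimage)

lemma share_preimage_iter:
  assumes i: "i \<in> J" and A: "A \<in> sets (lebesgue_on X)"
  shows "ennreal (share i (preimage_iter X f n A)) = (\<integral>\<^sup>+j. ennreal (share j A) \<partial>measure_pmf (iter n i))"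
  using i
proof (induction n arbitrary: i)
  case 0
  then show ?case using A by (simp add: preimage_iter_0 sets_on_X)
next
  case (Suc n)
  have "ennreal (share i (preimage_iter X f (Suc n) A)) = (\<integral>\<^sup>+j. ennreal (share j (preimage_iter X f n A)) \<partial>measure_pmf (step i))"
    unfolding preimage_iter_Suc by (rule share_preimage_step[OF Suc.prems sets_preimage_iter[OF A]])
  also have "\<dots> = (\<integral>\<^sup>+j. (\<integral>\<^sup>+k. ennreal (share k A) \<partial>measure_pmf (iter n j)) \<partial>measure_pmf (step i))"
    by (rule nn_integral_cong_AE, rule AE_mp[OF AE_step[OF Suc.prems]]) (simp add: Suc.IH)
  also have "\<dots> = (\<integral>\<^sup>+k. ennreal (share k A) \<partial>measure_pmf (iter (Suc n) i))"
    by (simp add: nn_integral_bind_pmf)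
  finally show ?case .
qed

lemma null_iff_share:
  assumes "A \<in> sets (lebesgue_on X)"
  shows "A \<in> null_sets lebesgue \<longleftrightarrow> (\<forall>i\<in>J. share i A = 0)"
proof
  assume A: "A \<in> null_sets lebesgue"
  have "H i \<inter> A \<in> null_sets lebesgue" if "i \<in> J" for i
    by (rule null_set_Int1[OF A sets_H[OF that]])
  then show "\<forall>i\<in>J. share i A = 0"
    by (auto simp: share_def measure_eq_0_null_sets)
next
  assume 0: "\<forall>i\<in>J. share i A = 0"
  have Am: "A \<in> sets lebesgue" "A \<subseteq> X" using assms by (auto simp: sets_on_X)
  have "(\<Union>i\<in>J. H i \<inter> A) \<in> null_sets lebesgue"
  proof (rule null_sets_UN')
    fix i assume i: "i \<in> J"
    then show "H i \<inter> A \<in> null_sets lebesgue"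
      using 0 Am by (intro null_setsI) (auto simp: emeasure_H_Int_share sets_H)
  qed simp
  also have "(\<Union>i\<in>J. H i \<inter> A) = A" using Am(2) X_eq by blast
  finally show "A \<in> null_sets lebesgue" .
qed

text \<open>Nonsingularity of \<open>f\<close>: the share of the preimage in \<open>H i\<close> is
  an average of shares of \<open>A\<close>, all of which vanish.\<close>

lemma null_preimage_iter:
  assumes A: "A \<in> sets (lebesgue_on X)" "A \<in> null_sets lebesgue"
  shows "preimage_iter X f n A \<in> null_sets lebesgue"
  unfolding null_iff_share[OF sets_preimage_iter[OF A(1)]]
proof
  fix i assume i: "i \<in> J"
  have "(\<integral>\<^sup>+j. ennreal (share j A) \<partial>measure_pmf (iter n i)) = (\<integral>\<^sup>+j. 0 \<partial>measure_pmf (iter n i))"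
  proof (rule nn_integral_cong_AE, rule AE_pmfI)
    fix j assume "j \<in> set_pmf (iter n i)"
    then have "j \<in> J" using set_pmf_iter[OF i] by blast
    then show "ennreal (share j A) = 0" using A(2) null_iff_share[OF A(1)] by simp
  qed
  then have "ennreal (share i (preimage_iter X f n A)) = 0"
    unfolding share_preimage_iter[OF i A(1)] by simp
  then show "share i (preimage_iter X f n A) = 0"
    using share_nonneg by (simp add: ennreal_eq_0_iff antisym)
qed

end

section \<open>Cylinders and densities\<close>

context markov_system
begin

lemma share_preimage_expectation:
  assumes i: "i \<in> J" and A: "A \<in> sets (lebesgue_on X)"
  shows "share i (f -` A \<inter> X) = measure_pmf.expectation (step i) (\<lambda>j. share j A)"
proof -
  have "ennreal (share i (f -` A \<inter> X)) = ennreal (measure_pmf.expectation (step i) (\<lambda>j. share j A))"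
    unfolding share_preimage_step[OF i A]
  proof (rule nn_integral_eq_integral)
    show "integrable (measure_pmf (step i)) (\<lambda>j. share j A)"
      by (rule measure_pmf.integrable_const_bound[where B = 1], rule AE_mp[OF AE_step[OF i]])
         (simp_all add: share_nonneg share_le_1)
  qed (simp add: share_nonneg)
  then show ?thesis
    using share_nonneg by simp
qed

section \<open>Cylinders and their overlaps\<close>

lemma H_Int_null:
  assumes "i \<in> J" "j \<in> J" "i \<noteq> j"
  shows "H i \<inter> H j \<in> null_sets lebesgue"
proof -
  have "H i \<inter> H j \<subseteq> boundary"
    using disjoint_interior[OF assms] assms by (auto simp: boundary_def)
  then show ?thesis
    by (rule null_sets_subset[OF boundary_null, rotated])
       (auto intro!: sets.Int sets_H assms)
qed

lemma measure_eq_share: "i \<in> J \<Longrightarrow> measure lebesgue (H i \<inter> A) = measure lebesgue (H i) * share i A"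
  using measure_H_pos[of i] by (simp add: share_def)

text \<open>The empty word gives \<open>X\<close> here, where an empty intersection would give all
  real numbers; recursion on words can then start from it.\<close>

definition cyl :: "nat list \<Rightarrow> real set" where
  "cyl w = cylinder X f H w \<inter> X"

lemma mem_cyl: "x \<in> cyl w \<longleftrightarrow> x \<in> X \<and> (\<forall>k<length w. x \<in> preimage_iter X f k (H (w ! k)))"
  by (auto simp: cyl_def cylinder_def)

lemma cyl_Nil: "cyl [] = X"
  by (simp add: cyl_def cylinder_def)

lemma cyl_Cons: "i \<in> J \<Longrightarrow> cyl (i # w) = H i \<inter> (f -` cyl w \<inter> X)"
proof (rule set_eqI)
  fix x assume i: "i \<in> J"
  have "x \<in> cyl (i # w) \<longleftrightarrow> x \<in> X \<and> x \<in> preimage_iter X f 0 (H i) \<and> (\<forall>k<length w. x \<in> preimage_iter X f (Suc k) (H (w ! k)))"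
    unfolding mem_cyl using All_less_Suc2[of "length w" "\<lambda>k. x \<in> preimage_iter X f k (H ((i # w) ! k))"]
    by simp
  also have "\<dots> \<longleftrightarrow> x \<in> H i \<and> x \<in> X \<and> f x \<in> cyl w"
    unfolding preimage_iter_Suc preimage_iter_0[OF H_subset[OF i]] mem_cyl using f_in_X by auto
  finally show "x \<in> cyl (i # w) \<longleftrightarrow> x \<in> H i \<inter> (f -` cyl w \<inter> X)"
    by auto
qed

lemma cylinder_eq_cyl: "w \<noteq> [] \<Longrightarrow> cylinder X f H w = cyl w"
  unfolding cyl_def cylinder_def preimage_iter_def by (cases w) auto

lemma sets_cyl: "set w \<subseteq> J \<Longrightarrow> cyl w \<in> sets (lebesgue_on X)"
proof (induction w)
  case Nil
  then show ?case by (simp add: cyl_Nil sets_on_X)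
next
  case (Cons i w)
  then have "f -` cyl w \<inter> X \<in> sets (lebesgue_on X)" by (intro sets_preimage) simp
  then show ?case using Cons.prems by (auto simp: cyl_Cons sets_on_X intro!: sets.Int sets_H)
qed

text \<open>Either one word is a prefix of the other, or they differ at some position
  \<open>k\<close>, and then the overlap lies in the preimage under \<open>f ^^ k\<close> of the
  null set \<open>H (v ! k) \<inter> H (w ! k)\<close>.\<close>

lemma cyl_nested_or_null:
  assumes "set v \<subseteq> J" "set w \<subseteq> J"
  shows "cyl v \<subseteq> cyl w \<or> cyl w \<subseteq> cyl v \<or> cyl v \<inter> cyl w \<in> null_sets lebesgue"
proof (cases "\<exists>k. k < length v \<and> k < length w \<and> v ! k \<noteq> w ! k")
  case True
  then obtain k where k: "k < length v" "k < length w" "v ! k \<noteq> w ! k" by blast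
  then have J: "v ! k \<in> J" "w ! k \<in> J" using assms by (auto dest: nth_mem)
  have HH: "H (v ! k) \<inter> H (w ! k) \<in> sets (lebesgue_on X)"
    using J H_subset by (auto simp: sets_on_X intro!: sets.Int sets_H)
  have "cyl v \<subseteq> preimage_iter X f k (H (v ! k))" "cyl w \<subseteq> preimage_iter X f k (H (w ! k))"
    using k by (auto simp: cyl_def cylinder_def)
  then have "cyl v \<inter> cyl w \<subseteq> preimage_iter X f k (H (v ! k) \<inter> H (w ! k))"
    unfolding preimage_iter_def by blast
  moreover have "preimage_iter X f k (H (v ! k) \<inter> H (w ! k)) \<in> null_sets lebesgue"
    by (rule null_preimage_iter[OF HH H_Int_null[OF J k(3)]])
  moreover have "cyl v \<inter> cyl w \<in> sets lebesgue"
    using sets_cyl assms by (auto simp: sets_on_X)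
  ultimately have "cyl v \<inter> cyl w \<in> null_sets lebesgue"
    using null_sets_subset by blast
  then show ?thesis by blast
next
  case False
  have sub: "cyl s \<subseteq> cyl r" if "length r \<le> length s" "\<And>k. k < length r \<Longrightarrow> r ! k = s ! k" for r s
  proof
    fix x assume "x \<in> cyl s"
    then have "x \<in> X" "x \<in> preimage_iter X f k (H (s ! k))" if "k < length s" for k
      using that by (auto simp: mem_cyl)
    with \<open>x \<in> cyl s\<close> that show "x \<in> cyl r"
      by (simp add: mem_cyl)
  qed
  show ?thesis
  proof (cases "length v \<le> length w")
    case True
    then have "v ! k = w ! k" if "k < length v" for k
      using False that less_le_trans by blast
    then show ?thesis using sub[OF True] by blast
  next
    case len: False
    then have "w ! k = v ! k" if "k < length w" for k
      using False that by (metis less_trans not_le)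
    then show ?thesis using sub[of w v] len by auto
  qed
qed

end

section \<open>Mixing of cylinders, intervals and sets of finite measure\<close>

text \<open>In the application \<open>c\<close> is the \<pi>-measure of \<open>A\<close>; what
  matters is that it does not depend on \<open>i\<close>.\<close>

locale mixing_markov_system = markov_system +
  fixes A :: "real set" and c :: real
  assumes expansive: "expansive X f J H"
    and sets_A: "A \<in> sets (lebesgue_on X)"
    and c_nonneg: "0 \<le> c"
    and share_tendsto: "\<And>i. i \<in> J \<Longrightarrow> (\<lambda>n. share i (preimage_iter X f n A)) \<longlonglongrightarrow> c"
begin

abbreviation B where "B n \<equiv> preimage_iter X f n A"

lemma sets_B: "B n \<in> sets lebesgue"
  using sets_preimage_iter[OF sets_A] by (simp add: sets_on_X)

sublocale set_sequence lebesgue B c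
  by unfold_locales (rule sets_B, rule c_nonneg)

text \<open>Conditioning on the step out of \<open>j\<close> removes the first letter of the word
  and one preimage from \<open>B (Suc n)\<close>. Dominated convergence then carries the induction
  hypothesis, needed for all states at once, through the expectation.\<close>

lemma share_cyl_tendsto:
  assumes "set w \<subseteq> J" "i \<in> J"
  shows "(\<lambda>n. share i (cyl w \<inter> B n)) \<longlonglongrightarrow> c * share i (cyl w)"
  using assms
proof (induction w arbitrary: i)
  case Nil
  have "X \<inter> B n = B n" for n by (auto simp: preimage_iter_def)
  then show ?case using share_tendsto[OF Nil(2)] Nil(2) by (simp add: cyl_Nil share_X)
next
  case (Cons j w)
  then have j: "j \<in> J" and w: "set w \<subseteq> J" by simp_all
  show ?case
  proof (cases "i = j")
    case False
    \<comment> \<open>The cylinder lies in \<open>H j\<close>, which meets \<open>H i\<close> in a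
      null set. \<open>E\<close> will be \<open>B n\<close> and \<open>UNIV\<close>.\<close>
    have "share i (cyl (j # w) \<inter> E) = 0" if "cyl (j # w) \<inter> E \<in> sets lebesgue" for E
    proof -
      have "H i \<inter> (cyl (j # w) \<inter> E) \<in> null_sets lebesgue"
        by (rule null_sets_subset[OF H_Int_null[OF Cons.prems(2) j False]])
           (use that in \<open>auto simp: cyl_Cons[OF j] intro!: sets.Int sets_H[OF Cons.prems(2)]\<close>)
      then show ?thesis by (simp add: share_def measure_eq_0_null_sets)
    qed
    note zero = this
    have "cyl (j # w) \<in> sets lebesgue" using sets_cyl[OF Cons.prems(1)] by (simp add: sets_on_X)
    then have "share i (cyl (j # w) \<inter> B n) = 0" "share i (cyl (j # w)) = 0" for n
      using zero[of "B n"] zero[of UNIV] sets_B[of n] by auto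
    then show ?thesis by simp
  next
    case True
    have sets: "cyl w \<inter> B n \<in> sets (lebesgue_on X)" for n
      using sets_cyl[OF w] sets_B[of n] by (auto simp: sets_on_X)
    have share_H: "share j (H j \<inter> E) = share j E" for E
      by (simp add: share_def Int_assoc[symmetric])
    have eq: "share j (cyl (j # w) \<inter> B (Suc n)) = measure_pmf.expectation (step j) (\<lambda>l. share l (cyl w \<inter> B n))" for n
    proof -
      have "cyl (j # w) \<inter> B (Suc n) = H j \<inter> (f -` (cyl w \<inter> B n) \<inter> X)"
        unfolding cyl_Cons[OF j] preimage_iter_Suc by blast
      then show ?thesis
        by (simp only: share_H share_preimage_expectation[OF j sets])
    qed
    have "(\<lambda>n. measure_pmf.expectation (step j) (\<lambda>l. share l (cyl w \<inter> B n)))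
        \<longlonglongrightarrow> measure_pmf.expectation (step j) (\<lambda>l. c * share l (cyl w))"
    proof (rule integral_dominated_convergence[where w = "\<lambda>_. 1"])
      show "AE l in step j. (\<lambda>n. share l (cyl w \<inter> B n)) \<longlonglongrightarrow> c * share l (cyl w)"
        by (rule AE_mp[OF AE_step[OF j]]) (simp add: Cons.IH[OF w])
      show "AE l in step j. norm (share l (cyl w \<inter> B n)) \<le> 1" for n
        by (rule AE_mp[OF AE_step[OF j]]) (simp add: share_le_1 share_nonneg)
    qed simp_all
    also have "measure_pmf.expectation (step j) (\<lambda>l. c * share l (cyl w)) = c * share j (cyl (j # w))"
      by (simp add: cyl_Cons[OF j] share_H share_preimage_expectation[OF j sets_cyl[OF w]])
    finally have "(\<lambda>n. share j (cyl (j # w) \<inter> B (Suc n))) \<longlonglongrightarrow> c * share j (cyl (j # w))"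
      by (simp add: eq)
    \<comment> \<open>The recursion reaches only indices of the form \<open>Suc n\<close>, which
      suffices for a limit.\<close>
    then have "(\<lambda>n. share j (cyl (j # w) \<inter> B n)) \<longlonglongrightarrow> c * share j (cyl (j # w))"
      by (rule LIMSEQ_imp_Suc)
    then show ?thesis using True by simp
  qed
qed

text \<open>A nonempty word confines the cylinder to a single \<open>H i\<close> and so gives it
  finite measure.\<close>

lemma mixes_cyl:
  assumes w: "set w \<subseteq> J" "w \<noteq> []"
  shows "mixes (cyl w)"
proof -
  obtain i v where iv: "w = i # v" using w(2) by (cases w) auto
  then have i: "i \<in> J" using w(1) by simp
  have sub: "cyl w \<subseteq> H i" unfolding iv cyl_Cons[OF i] by blast
  have m: "measure lebesgue (cyl w \<inter> E) = measure lebesgue (H i) * share i (cyl w \<inter> E)" for E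
  proof -
    have "H i \<inter> (cyl w \<inter> E) = cyl w \<inter> E" using sub by blast
    then show ?thesis using measure_eq_share[OF i, of "cyl w \<inter> E"] by simp
  qed
  have "H i \<in> fmeasurable lebesgue"
    using finite_length[OF i] sets_H[OF i] by (simp add: fmeasurable_def)
  then have "cyl w \<in> fmeasurable lebesgue"
    by (rule fmeasurableI2[OF _ sub]) (use sets_cyl[OF w(1)] in \<open>simp add: sets_on_X\<close>)
  moreover have "(\<lambda>n. measure lebesgue (cyl w \<inter> B n)) \<longlonglongrightarrow> measure lebesgue (H i) * (c * share i (cyl w))"
    unfolding m by (intro tendsto_mult tendsto_const share_cyl_tendsto w(1) i)
  moreover have "measure lebesgue (H i) * (c * share i (cyl w)) = c * measure lebesgue (cyl w)"
    using m[of UNIV] by simp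
  ultimately show ?thesis by (simp add: mixes_def)
qed

text \<open>Expansiveness supplies approximations by finite unions of cylinders, which mix because
  cylinders are nested or almost disjoint.\<close>

lemma mixes_interval:
  assumes I: "is_interval I" "bounded I" "I \<subseteq> X"
  shows "mixes I"
proof (rule mixes_approx)
  show "I \<in> fmeasurable lebesgue"
    using I by (intro measurable_convex) (auto simp: is_interval_convex)
  fix \<delta> :: real assume "\<delta> > 0"
  then obtain W where W: "finite W" "\<And>w. w \<in> W \<Longrightarrow> w \<noteq> [] \<and> set w \<subseteq> J"
    and small: "emeasure lebesgue (sym_diff I (\<Union>w\<in>W. cylinder X f H w)) < ennreal \<delta>"
    using expansive I unfolding expansive_def by meson
  have eq: "(\<Union>w\<in>W. cylinder X f H w) = \<Union>(cyl ` W)"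
    using W(2) cylinder_eq_cyl by auto
  have "mixes (\<Union>(cyl ` W))"
    by (rule mixes_Union_nested) (use W cyl_nested_or_null mixes_cyl in blast)+
  then show "\<exists>F. mixes F \<and> emeasure lebesgue (sym_diff I F) < ennreal \<delta>"
    using small unfolding eq by blast
qed

text \<open>Dynkin's argument inside one \<open>H i\<close>, where complements have finite measure.
  The generators \<open>{..x}\<close> cut \<open>H i\<close> in bounded intervals contained in
  \<open>X\<close>.\<close>

lemma mixes_H_Int_borel:
  assumes i: "i \<in> J" and E: "E \<in> sets borel"
  shows "mixes (H i \<inter> E)"
proof -
  obtain a b where ab: "H i = {a..b}" using i by (rule interval_H)
  have intv: "mixes (H i \<inter> {..x})" for x
    by (rule mixes_interval) (use H_subset[OF i] in \<open>auto simp: ab is_interval_1 intro: bounded_subset[OF bounded_closed_interval]\<close>)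
  have full: "mixes (H i)"
    by (rule mixes_interval) (use H_subset[OF i] in \<open>auto simp: ab is_interval_1\<close>)
  have "Int_stable (range (\<lambda>x::real. {..x}))"
    by (auto simp: Int_stable_def)
  moreover have "range (\<lambda>x::real. {..x}) \<subseteq> Pow UNIV" by simp
  moreover have "E \<in> sigma_sets UNIV (range (\<lambda>x::real. {..x}))"
    using E unfolding borel_eq_atMost by simp
  ultimately show ?thesis
  proof (induction rule: sigma_sets_induct_disjoint[where P = "\<lambda>E. mixes (H i \<inter> E)", consumes 3, case_names basic empty compl union])
    case (compl E)
    have "H i \<inter> (UNIV - E) = H i - H i \<inter> E" by blast
    then show ?case using mixes_Diff[OF full compl(2)] by simp
  next
    case (union E)
    have "E k \<in> sets borel" for k
      using union(2) unfolding borel_eq_atMost by auto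
    then have "(\<Union>k. H i \<inter> E k) \<in> fmeasurable lebesgue"
      by (intro fmeasurableI2[OF mixes_fmeasurable[OF full]]) (auto intro!: sets.Int sets_H[OF i])
    then have "mixes (\<Union>k\<in>UNIV. H i \<inter> E k)"
    proof (rule mixes_UN_nat[rotated 2])
      fix k l :: nat assume "k \<noteq> l"
      then have "(H i \<inter> E k) \<inter> (H i \<inter> E l) = {}"
        using union(1) by (auto simp: disjoint_family_on_def)
      then show "(H i \<inter> E k) \<inter> (H i \<inter> E l) \<in> null_sets lebesgue" by simp
    qed (rule union(3))
    then show ?case by simp
  qed (auto simp: mixes_empty intro: intv)
qed

text \<open>A Lebesgue set differs from a Borel set by a null set.\<close>

lemma mixes_H_Int:
  assumes i: "i \<in> J" and E: "E \<in> sets lebesgue"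
  shows "mixes (H i \<inter> E)"
proof -
  obtain S N N' where SN: "E = S \<union> N" "N \<subseteq> N'" "N' \<in> null_sets lborel" "S \<in> sets lborel"
    using E by (rule sets_completionE)
  have "N' \<in> null_sets lebesgue" using SN(3) by (rule null_sets_completionI)
  then have "sym_diff (H i \<inter> E) (H i \<inter> S) \<in> null_sets lebesgue"
    by (rule null_sets_completion_subset[rotated]) (use SN(1,2) in blast)
  then show ?thesis
    using mixes_cong_null[OF mixes_H_Int_borel[OF i]] SN(4) sets.Int[OF sets_H[OF i] E] by auto
qed

lemma mixes_subset_X:
  assumes E: "E \<in> fmeasurable lebesgue" "E \<subseteq> X"
  shows "mixes E"
proof -
  have eq: "E = (\<Union>i\<in>J. H i \<inter> E)" using E(2) X_eq by blast
  have "mixes (\<Union>i\<in>J. H i \<inter> E)"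
  proof (rule mixes_UN_nat)
    fix i j assume ij: "i \<in> J" "j \<in> J" "i \<noteq> j"
    show "H i \<inter> E \<inter> (H j \<inter> E) \<in> null_sets lebesgue"
      by (rule null_sets_subset[OF H_Int_null[OF ij]])
         (use E ij in \<open>auto intro!: sets.Int sets_H dest: fmeasurableD\<close>)
  qed (use E eq in \<open>auto intro: mixes_H_Int dest: fmeasurableD\<close>)
  then show ?thesis using eq by simp
qed

theorem density_tendsto:
  assumes \<gamma>: "\<gamma> \<in> borel_measurable (lebesgue_on X)" and fin: "(\<integral>\<^sup>+x. \<gamma> x \<partial>lebesgue_on X) < \<infinity>"
  shows "(\<lambda>n. \<integral>\<^sup>+x\<in>B n. \<gamma> x \<partial>lebesgue_on X) \<longlonglongrightarrow> ennreal c * (\<integral>\<^sup>+x. \<gamma> x \<partial>lebesgue_on X)"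
proof -
  interpret on_X: set_sequence "lebesgue_on X" B c
    by unfold_locales (rule sets_preimage_iter[OF sets_A], rule c_nonneg)
  have meas: "measure (lebesgue_on X) E = measure lebesgue E" "emeasure (lebesgue_on X) E = emeasure lebesgue E" if "E \<subseteq> X" for E
    using that by (simp_all add: measure_restrict_space emeasure_restrict_space)
  show ?thesis
  proof (rule on_X.nn_integral_mixes[OF _ \<gamma> fin])
    fix E assume E: "E \<in> fmeasurable (lebesgue_on X)"
    then have EX: "E \<subseteq> X" "E \<in> sets lebesgue"
      using fmeasurableD[OF E] unfolding sets_on_X by blast+
    then have "E \<in> fmeasurable lebesgue" using E meas[of E] by (simp add: fmeasurable_def)
    then have "mixes E" using EX(1) by (rule mixes_subset_X)
    moreover have "E \<inter> B n \<subseteq> X" for n using EX(1) by blast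
    ultimately show "on_X.mixes E"
      using E EX(1) by (simp add: mixes_def on_X.mixes_def meas)
  qed
qed

end

section \<open>The limit measure in terms of shares\<close>

context markov_system
begin

text \<open>\<open>\<tau>\<close> is prescribed on interiors only; the rest of \<open>X\<close> lies
  in \<open>boundary\<close>, which is null for \<open>\<pi>\<close> because \<open>\<pi>\<close>
  has a density. On each interior the density is constant, so lengths become shares.\<close>

lemma emeasure_density_eq_share:
  assumes \<tau>: "\<And>i x. i \<in> J \<Longrightarrow> x \<in> interior (H i) \<Longrightarrow> \<tau> x = ennreal (q i / measure lebesgue (H i))"
    and q: "\<And>i. i \<in> J \<Longrightarrow> 0 \<le> q i"
    and \<pi>: "has_density X \<pi> \<tau>" and A: "A \<in> sets (lebesgue_on X)"
  shows "emeasure \<pi> A = (\<integral>\<^sup>+i. ennreal (q i) * ennreal (share i A) \<partial>count_space J)"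
proof -
  have sets_pi: "sets \<pi> = sets (lebesgue_on X)" and dens: "\<And>E. E \<in> sets (lebesgue_on X) \<Longrightarrow> emeasure \<pi> E = (\<integral>\<^sup>+x\<in>E. \<tau> x \<partial>lebesgue_on X)"
    using \<pi> by (auto simp: has_density_def)
  have AX: "A \<in> sets lebesgue" "A \<subseteq> X" using A by (auto simp: sets_on_X)
  have bX: "boundary \<in> sets (lebesgue_on X)"
    using boundary_null H_subset by (auto simp: sets_on_X boundary_def dest: null_setsD2)
  have "boundary \<in> null_sets (lebesgue_on X)"
    using bX boundary_null by (auto simp: null_sets_def sets_on_X emeasure_restrict_space)
  then have "emeasure \<pi> boundary = 0"
    unfolding dens[OF bX] by (rule nn_integral_null_set)
  then have bpi: "boundary \<in> null_sets \<pi>" using bX sets_pi by (intro null_setsI) auto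
  have part: "interior (H i) \<inter> A \<in> sets (lebesgue_on X)" for i
    using AX sets_interior_H by (auto simp: sets_on_X)
  have un: "(\<Union>i\<in>J. interior (H i) \<inter> A) \<in> sets \<pi>"
    unfolding sets_pi by (rule sets.countable_UN') (auto intro: part)
  have cover: "A \<subseteq> (\<Union>i\<in>J. interior (H i) \<inter> A) \<union> boundary"
    using AX(2) X_eq by (auto simp: boundary_def)
  have "emeasure \<pi> A = emeasure \<pi> (\<Union>i\<in>J. interior (H i) \<inter> A)"
    by (rule emeasure_eq_mod_null[OF un _ bpi _ cover]) (use A sets_pi in auto)
  also have "\<dots> = (\<integral>\<^sup>+i. emeasure \<pi> (interior (H i) \<inter> A) \<partial>count_space J)"
  proof (rule emeasure_UN_countable)
    show "disjoint_family_on (\<lambda>i. interior (H i) \<inter> A) J"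
      using disjoint_interior unfolding disjoint_family_on_def by blast
  qed (use part sets_pi in auto)
  also have "\<dots> = (\<integral>\<^sup>+i. ennreal (q i) * ennreal (share i A) \<partial>count_space J)"
  proof (rule nn_integral_cong)
    fix i assume "i \<in> space (count_space J)"
    then have i: "i \<in> J" by simp
    let ?m = "measure lebesgue (H i)"
    have "emeasure \<pi> (interior (H i) \<inter> A) = (\<integral>\<^sup>+x. ennreal (q i / ?m) * indicator (interior (H i) \<inter> A) x \<partial>lebesgue_on X)"
      unfolding dens[OF part] by (rule nn_integral_cong) (simp add: \<tau>[OF i] indicator_def)
    also have "\<dots> = ennreal (q i / ?m) * emeasure (lebesgue_on X) (interior (H i) \<inter> A)"
      by (rule nn_integral_cmult_indicator[OF part])
    also have "emeasure (lebesgue_on X) (interior (H i) \<inter> A) = emeasure lebesgue (interior (H i) \<inter> A)"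
      using AX(2) by (intro emeasure_restrict_space) auto
    also have "\<dots> = emeasure lebesgue (H i \<inter> A)"
      by (rule emeasure_eq_mod_null[symmetric, OF _ _ boundary_H_null[OF i]])
         (use AX interior_subset[of "H i"] in \<open>auto intro!: sets.Int sets_H[OF i] sets_interior_H\<close>)
    also have "\<dots> = ennreal (?m * share i A)" by (rule emeasure_H_Int_share[OF i])
    also have "ennreal (q i / ?m) * \<dots> = ennreal (q i / ?m * (?m * share i A))"
      by (rule ennreal_mult'[symmetric]) (use q[OF i] in simp)
    also have "q i / ?m * (?m * share i A) = q i * share i A"
      using measure_H_pos[OF i] by simp
    also have "ennreal (q i * share i A) = ennreal (q i) * ennreal (share i A)"
      by (rule ennreal_mult'[OF q[OF i]])
    finally show "emeasure \<pi> (interior (H i) \<inter> A) = ennreal (q i) * ennreal (share i A)" .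
  qed
  finally show ?thesis .
qed

text \<open>\<open>H j \<inter> A\<close> lies in the given null set together with the overlaps of
  \<open>H j\<close> with the elements of index at most \<open>N\<close>, which are null as
  well.\<close>

lemma share_eq_0_beyond:
  assumes A: "A \<in> sets (lebesgue_on X)" and null: "emeasure lebesgue (A - (\<Union>i\<in>J \<inter> {1..N}. H i)) = 0"
    and j: "j \<in> J" "N < j"
  shows "share j A = 0"
proof -
  let ?R = "A - (\<Union>i\<in>J \<inter> {1..N}. H i)"
  have AX: "A \<in> sets lebesgue" "A \<subseteq> X" using A by (auto simp: sets_on_X)
  have "(\<Union>i\<in>J \<inter> {1..N}. H i) \<in> sets lebesgue"
    by (intro sets.countable_UN') (auto intro: sets_H)
  then have "?R \<in> null_sets lebesgue" using null AX by (intro null_setsI) auto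
  moreover have "(\<Union>i\<in>J \<inter> {1..N}. H j \<inter> H i) \<in> null_sets lebesgue"
    by (rule null_sets_UN') (use j in \<open>auto intro: H_Int_null\<close>)
  ultimately have "?R \<union> (\<Union>i\<in>J \<inter> {1..N}. H j \<inter> H i) \<in> null_sets lebesgue" by (rule null_sets.Un)
  then have "H j \<inter> A \<in> null_sets lebesgue"
    by (rule null_sets_subset) (use AX sets_H[OF j(1)] in auto)
  then show ?thesis by (simp add: share_def measure_eq_0_null_sets)
qed

end

theorem theorem5p1:
  fixes X :: "real set" and f :: "real \<Rightarrow> real"
    and \<H> :: "real set set" and J :: "nat set" and H :: "nat \<Rightarrow> real set"
    and P :: "nat \<Rightarrow> nat \<Rightarrow> real"
    and \<tau> :: "real \<Rightarrow> ennreal" and \<pi> \<mu> :: "real measure"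
  assumes system: "dynamical_system X f"
    and partition: "markov_partition X f \<H>" "enumerates J H \<H>"
    and expansive: "expansive X f J H"
    and finite_length: "\<forall>i\<in>J. emeasure lebesgue (H i) < \<infinity>"
    and P_def: "P = transition_matrix f H"
    and irreducible: "irreducible_chain J P"
    and aperiodic: "aperiodic_chain J P"
    and recurrent: "\<forall>i\<in>J. return_prob J P i = 1"
    and \<tau>: "\<forall>i\<in>J. \<forall>x\<in>interior (H i).
               \<tau> x = ennreal (lim (\<lambda>k. matrix_power J P k i i) / measure lebesgue (H i))"
    and \<pi>: "has_density X \<pi> \<tau>"
    and \<mu>: "has_some_density X \<mu>" "emeasure \<mu> X < \<infinity>"
  shows "(\<forall>A\<in>sets (lebesgue_on X).
            (\<exists>N. emeasure lebesgue (A - (\<Union>i\<in>J \<inter> {1..N}. H i)) = 0) \<longrightarrow>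
            (\<lambda>n. emeasure \<mu> (preimage_iter X f n A)) \<longlonglongrightarrow> emeasure \<mu> X * emeasure \<pi> A)
       \<and> (positive_recurrent_chain J P \<longrightarrow>
            (\<forall>A\<in>sets (lebesgue_on X).
               (\<lambda>n. emeasure \<mu> (preimage_iter X f n A)) \<longlonglongrightarrow> emeasure \<mu> X * emeasure \<pi> A))"
proof -
  interpret markov_system X f \<H> J H
    by unfold_locales (use system partition finite_length in auto)
  interpret recurrent_chain J "transition_matrix f H"
    by unfold_locales (use irreducible aperiodic recurrent P_def in auto)
  obtain \<gamma> where \<gamma>: "has_density X \<mu> \<gamma>"
    using \<mu>(1) by (auto simp: has_some_density_def)
  have dens: "emeasure \<mu> E = (\<integral>\<^sup>+x\<in>E. \<gamma> x \<partial>lebesgue_on X)" if "E \<in> sets (lebesgue_on X)" for E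
    using \<gamma> that by (simp add: has_density_def)
  have X: "X \<in> sets (lebesgue_on X)" by (simp add: sets_on_X)
  have total: "emeasure \<mu> X = (\<integral>\<^sup>+x. \<gamma> x \<partial>lebesgue_on X)"
    unfolding dens[OF X] by (rule nn_integral_cong) simp
  \<comment> \<open>The limit theorems for the chain ask for bounds on all natural numbers, while
    \<open>share_le_1\<close> speaks of states in \<open>J\<close>.\<close>
  define g where "g A k = (if k \<in> J then share k A else 0)" for A k
  have g: "0 \<le> g A k" "g A k \<le> 1" for A k
    by (auto simp: g_def share_nonneg share_le_1)
  have l0: "0 \<le> limit i" if "i \<in> J" for i
    using limit_bounds(1) that by blast
  have pi_eq: "emeasure \<pi> A = (\<integral>\<^sup>+k. ennreal (limit k) * ennreal (g A k) \<partial>count_space UNIV)"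
    if A: "A \<in> sets (lebesgue_on X)" for A
  proof -
    have "emeasure \<pi> A = (\<integral>\<^sup>+i. ennreal (limit i) * ennreal (share i A) \<partial>count_space J)"
      by (rule emeasure_density_eq_share[OF _ l0 \<pi> A]) (use \<tau> lim_matrix_power P_def in auto)
    also have "\<dots> = (\<integral>\<^sup>+i. ennreal (limit i) * ennreal (g A i) \<partial>count_space J)"
      by (rule nn_integral_cong) (simp add: g_def)
    also have "\<dots> = (\<integral>\<^sup>+i. ennreal (limit i) * ennreal (g A i) \<partial>count_space UNIV)"
      by (rule nn_integral_count_space_eq) (auto simp: g_def)
    finally show ?thesis .
  qed
  \<comment> \<open>Both parts reduce to the convergence \<open>lim\<close> of expectations along
    the chain.\<close>
  have concl: "(\<lambda>n. emeasure \<mu> (preimage_iter X f n A)) \<longlonglongrightarrow> emeasure \<mu> X * emeasure \<pi> A"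
    if A: "A \<in> sets (lebesgue_on X)"
      and lim: "\<And>i. i \<in> J \<Longrightarrow> (\<lambda>n. \<integral>\<^sup>+k. ennreal (g A k) \<partial>measure_pmf (iter n i))
        \<longlonglongrightarrow> (\<integral>\<^sup>+k. ennreal (limit k) * ennreal (g A k) \<partial>count_space UNIV)" for A
  proof -
    \<comment> \<open>The mass of \<open>limit\<close> is at most 1, which makes the \<pi>-measure
      of \<open>A\<close> a real number \<open>c\<close>. For empty \<open>J\<close> the function
      \<open>g\<close> vanishes.\<close>
    have "(\<integral>\<^sup>+k. ennreal (limit k) * ennreal (g A k) \<partial>count_space UNIV) \<le> 1"
    proof (cases "J = {}")
      case False
      have "(\<integral>\<^sup>+k. ennreal (limit k) * ennreal (g A k) \<partial>count_space UNIV) \<le> (\<integral>\<^sup>+k. ennreal (limit k) \<partial>count_space UNIV)"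
        using g by (intro nn_integral_mono mult_left_le) auto
      also have "\<dots> \<le> 1" by (rule nn_integral_limit_le_1[OF False])
      finally show ?thesis .
    qed (simp add: g_def)
    then have "emeasure \<pi> A \<le> 1" by (simp add: pi_eq[OF A])
    then obtain c where c: "emeasure \<pi> A = ennreal c" "0 \<le> c"
      by (cases "emeasure \<pi> A") (auto simp: top_unique)
    interpret mixing_markov_system X f \<H> J H A c
    proof unfold_locales
      fix i assume i: "i \<in> J"
      have "ennreal (share i (preimage_iter X f n A)) = (\<integral>\<^sup>+k. ennreal (g A k) \<partial>measure_pmf (iter n i))" for n
        unfolding share_preimage_iter[OF i A]
        by (rule nn_integral_cong_AE, rule AE_pmfI) (use set_pmf_iter[OF i, of n] in \<open>auto simp: g_def\<close>)
      then have "(\<lambda>n. ennreal (share i (preimage_iter X f n A))) \<longlonglongrightarrow> ennreal c"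
        using lim[OF i] by (simp add: pi_eq[OF A, symmetric] c)
      then show "(\<lambda>n. share i (preimage_iter X f n A)) \<longlonglongrightarrow> c"
        using c(2) by (simp add: share_nonneg)
    qed (use expansive A c in auto)
    have "(\<lambda>n. \<integral>\<^sup>+x\<in>preimage_iter X f n A. \<gamma> x \<partial>lebesgue_on X) \<longlonglongrightarrow> ennreal c * (\<integral>\<^sup>+x. \<gamma> x \<partial>lebesgue_on X)"
      by (rule density_tendsto) (use \<gamma> \<mu>(2) total in \<open>auto simp: has_density_def\<close>)
    then show ?thesis
      by (simp add: dens[OF sets_preimage_iter[OF A]] total c mult.commute)
  qed
  show ?thesis
  proof (intro conjI ballI impI)
    fix A assume A: "A \<in> sets (lebesgue_on X)" and "\<exists>N. emeasure lebesgue (A - (\<Union>i\<in>J \<inter> {1..N}. H i)) = 0"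
    then obtain N where N: "emeasure lebesgue (A - (\<Union>i\<in>J \<inter> {1..N}. H i)) = 0" by blast
    have "g A k = 0" if "k > N" for k
      using share_eq_0_beyond[OF A N _ that] by (simp add: g_def)
    then show "(\<lambda>n. emeasure \<mu> (preimage_iter X f n A)) \<longlonglongrightarrow> emeasure \<mu> X * emeasure \<pi> A"
      by (intro concl[OF A] expectation_tendsto_finite_support g(1))
  next
    fix A assume pos: "positive_recurrent_chain J P" and A: "A \<in> sets (lebesgue_on X)"
    show "(\<lambda>n. emeasure \<mu> (preimage_iter X f n A)) \<longlonglongrightarrow> emeasure \<mu> X * emeasure \<pi> A"
      using pos P_def by (intro concl[OF A] expectation_tendsto_positive_recurrent g) simp_all
  qed
qed

end
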